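(* Let $\mathcal{E}$ be a unital qubit channel with Stokes matrix $R$, let $S=\begin{pmatrix}R_{zz}&R_{zx}\\R_{xz}&R_{xx}\end{pmatrix}=V\,\mathrm{diag}[d_z,d_x]\,U$ with $U,V\in SO(2)$, $d_z,d_x$ real, and for $j\in\{z,x\}$ let $|\tilde U_j\rangle$ be the $j$-th column of $\mathrm{diag}[d_z,d_x]U$. Then $G_2(\mathcal{E})=\tilde G_2(\mathcal{E})$, where the maximum defining $\tilde G_2(\mathcal{E})$ is achieved by $Q_A^*=U^{-1}$, $Q_B^*=V^{-1}$. Furthermore, $G_1(\mathcal{E})=\tilde G_1(\mathcal{E})$ if and only if $|\tilde U_z\rangle$ and $|\tilde U_x\rangle$ are orthogonal; if this holds, the maximum defining $\tilde G_1(\mathcal{E})$ is achieved by $Q_B^*\in SO(2)$ whose first and second rows are scalar multiples of $(R_{zz},R_{xz})$ and $(R_{zx},R_{xx})$ respectively.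
   Context: A qubit channel is described by its Stokes parameterization $(R,t)$: in Bloch coordinates $(\theta_z,\theta_x,\theta_y)$, $\theta_a=\mathrm{Tr}(\rho\sigma_a)$, it acts as $\theta\mapsto R\theta+t$ (indices ordered $z,x,y$); unital means $t=0$. A unitary channel rotating the Bloch sphere within the $z$–$x$ plane (fixing the $y$ axis) corresponds to $\begin{pmatrix}Q&0\\0&1\end{pmatrix}$, $Q\in SO(2)$; then $\mathcal{E}'=\mathcal{U}_B\circ\mathcal{E}\circ\mathcal{U}_A$ has upper-left block $S'=Q_BSQ_A$. For a qubit channel $\mathcal{F}$ with complementary (environment) channel $\mathcal{F}_E$, and $|0_z\rangle,|1_z\rangle$ the $\pm1$ eigenvectors of $\sigma_z$: $H_{\mathcal{F}}(X|E)=H(\rho_{XE})-H(\rho_E)$ (von Neumann, base 2) for $\rho_{XE}=\sum_x\frac12|x_z\rangle\langle x_z|\otimes\mathcal{F}_E(|x_z\rangle\langle x_z|)$; $H_{\mathcal{F}}(X|Y)$ is the conditional Shannon entropy for $P_{XY}(x,y)=\frac12\langle y_z|\mathcal{F}(|x_z\rangle\langle x_z|)|y_z\rangle$; $K(\mathcal{F})=H_{\mathcal{F}}(X|E)-H_{\mathcal{F}}(X|Y)$. $\mathcal{P}_{ba}(\omega)$ ($\omega\in\mathbb{R}^6$) is the set of qubit channels with $(R_{zz},R_{zx},R_{xz},R_{xx},t_z,t_x)=\omega$; $\mathcal{P}_{bc}(\mu)$ ($\mu\in\mathbb{R}^2$) is the set of qubit channels with $(R_{zz},R_{xx})=\mu$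 (all other parameters arbitrary). With maxima over $z$–$x$ plane rotation channels and $\omega',\mu'$ the corresponding parameters of the compensated channel $\mathcal{E}'$: $G_1(\mathcal{E})=\max_{\mathcal{U}_B}\min_{\mathcal{P}_{ba}(\omega')}K$ and $\tilde G_1(\mathcal{E})=\max_{\mathcal{U}_B}\min_{\mathcal{P}_{bc}(\mu')}K$ with $\mathcal{E}'=\mathcal{U}_B\circ\mathcal{E}$; $G_2(\mathcal{E})=\max_{\mathcal{U}_A,\mathcal{U}_B}\min_{\mathcal{P}_{ba}(\omega')}K$ and $\tilde G_2(\mathcal{E})=\max_{\mathcal{U}_A,\mathcal{U}_B}\min_{\mathcal{P}_{bc}(\mu')}K$ with $\mathcal{E}'=\mathcal{U}_B\circ\mathcal{E}\circ\mathcal{U}_A$.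
   Formalization: The last clause is proved for every Q_B in SO(2) with the stated rows, without asserting that one exists: none does if a column of S is zero (e.g. R=0); if both columns are nonzero and orthogonal, normalizing them gives one. *)

theory Defs
  imports "Jordan_Normal_Form.Char_Poly" "Jordan_Normal_Form.Determinant"
begin

text \<open>Index convention: 0 = z, 1 = x, 2 = y (Bloch coordinates ordered z, x, y).\<close>

definition pauli :: "nat \<Rightarrow> complex mat" where
  "pauli a = (if a = 0 then mat_of_rows_list 2 [[1, 0], [0, -1]]
              else if a = 1 then mat_of_rows_list 2 [[0, 1], [1, 0]]
              else mat_of_rows_list 2 [[0, -\<i>], [\<i>, 0]])"

definition mtrace :: "complex mat \<Rightarrow> complex" where
  "mtrace A = (\<Sum>i<dim_row A. A $$ (i, i))"

definition adj :: "complex mat \<Rightarrow> complex mat" where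
  "adj K = map_mat cnj (transpose_mat K)"

text \<open>The linear map on 2x2 matrices with Stokes parameters (R,t):
  Bloch vector theta is mapped to R theta + t, extended linearly.\<close>
definition stokes_map :: "real mat \<Rightarrow> real vec \<Rightarrow> complex mat \<Rightarrow> complex mat" where
  "stokes_map R t X =
    (let c = (\<lambda>a. complex_of_real (t $ a) * mtrace X
                 + (\<Sum>b<3. complex_of_real (R $$ (a, b)) * mtrace (X * pauli b)))
     in (1/2) \<cdot>\<^sub>m (mtrace X \<cdot>\<^sub>m 1\<^sub>m 2 + c 0 \<cdot>\<^sub>m pauli 0 + c 1 \<cdot>\<^sub>m pauli 1 + c 2 \<cdot>\<^sub>m pauli 2))"

definition kraus_sum :: "complex mat list \<Rightarrow> complex mat \<Rightarrow> complex mat" where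
  "kraus_sum Ks X = foldr (\<lambda>K acc. K * X * adj K + acc) Ks (0\<^sub>m 2 2)"

definition is_kraus :: "real mat \<Rightarrow> real vec \<Rightarrow> complex mat list \<Rightarrow> bool" where
  "is_kraus R t Ks \<longleftrightarrow> (\<forall>K\<in>set Ks. K \<in> carrier_mat 2 2)
      \<and> (\<forall>X\<in>carrier_mat 2 2. stokes_map R t X = kraus_sum Ks X)"

text \<open>(R,t) is the Stokes parameterization of a qubit channel (CPTP map):
  the map is completely positive, i.e. has a Kraus representation (trace
  preservation is automatic for the affine Stokes form).\<close>
definition qubit_channel :: "real mat \<Rightarrow> real vec \<Rightarrow> bool" where
  "qubit_channel R t \<longleftrightarrow> R \<in> carrier_mat 3 3 \<and> t \<in> carrier_vec 3 \<and> (\<exists>Ks. is_kraus R t Ks)"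

definition kraus_of :: "real mat \<Rightarrow> real vec \<Rightarrow> complex mat list" where
  "kraus_of R t = (SOME Ks. is_kraus R t Ks)"

text \<open>Complementary channel from a Kraus representation (Stinespring isometry
  V = sum_i K_i (x) |i>): F_E(rho) = sum_ij Tr(K_i rho K_j^dagger) |i><j|.\<close>
definition comp_chan :: "complex mat list \<Rightarrow> complex mat \<Rightarrow> complex mat" where
  "comp_chan Ks \<rho> = mat (length Ks) (length Ks) (\<lambda>(i, j). mtrace (Ks ! i * \<rho> * adj (Ks ! j)))"

definition proj :: "nat \<Rightarrow> complex mat" where
  "proj x = (if x = 0 then mat_of_rows_list 2 [[1, 0], [0, 0]] else mat_of_rows_list 2 [[0, 0], [0, 1]])"

definition eigs :: "complex mat \<Rightarrow> complex list" where
  "eigs A = (SOME as. char_poly A = (\<Prod>a\<leftarrow>as. [:- a, 1:]) \<and> length as = dim_row A)"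

definition ent_term :: "real \<Rightarrow> real" where
  "ent_term p = (if p = 0 then 0 else p * log 2 p)"

definition vn_entropy :: "complex mat \<Rightarrow> real" where
  "vn_entropy A = - sum_list (map (\<lambda>l. ent_term (Re l)) (eigs A))"

definition H_XE :: "real mat \<Rightarrow> real vec \<Rightarrow> real" where
  "H_XE R t = (let Ks = kraus_of R t; n = length Ks;
       E0 = comp_chan Ks (proj 0); E1 = comp_chan Ks (proj 1);
       \<rho>XE = (1/2) \<cdot>\<^sub>m four_block_mat E0 (0\<^sub>m n n) (0\<^sub>m n n) E1;
       \<rho>E = (1/2) \<cdot>\<^sub>m (E0 + E1)
     in vn_entropy \<rho>XE - vn_entropy \<rho>E)"

definition P_XY :: "real mat \<Rightarrow> real vec \<Rightarrow> nat \<Rightarrow> nat \<Rightarrow> real" where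
  "P_XY R t x y = (1/2) * Re (stokes_map R t (proj x) $$ (y, y))"

definition H_XY :: "real mat \<Rightarrow> real vec \<Rightarrow> real" where
  "H_XY R t = - (\<Sum>x<2. \<Sum>y<2. ent_term (P_XY R t x y))
              + (\<Sum>y<2. ent_term (\<Sum>x<2. P_XY R t x y))"

definition Kr :: "real mat \<Rightarrow> real vec \<Rightarrow> real" where
  "Kr R t = H_XE R t - H_XY R t"

definition SO2 :: "real mat set" where
  "SO2 = {Q \<in> carrier_mat 2 2. transpose_mat Q * Q = 1\<^sub>m 2 \<and> det Q = 1}"

text \<open>Stokes matrix of the z-x plane rotation channel: diag(Q,1).\<close>
definition blk :: "real mat \<Rightarrow> real mat" where
  "blk Q = mat 3 3 (\<lambda>(i, j). if i < 2 \<and> j < 2 then Q $$ (i, j) else if i = j then 1 else 0)"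

definition Pba :: "real mat \<Rightarrow> real vec \<Rightarrow> (real mat \<times> real vec) set" where
  "Pba R t = {(R', t'). qubit_channel R' t' \<and> (\<forall>i<2. \<forall>j<2. R' $$ (i, j) = R $$ (i, j))
                        \<and> (\<forall>i<2. t' $ i = t $ i)}"

definition Pbc :: "real mat \<Rightarrow> real vec \<Rightarrow> (real mat \<times> real vec) set" where
  "Pbc R t = {(R', t'). qubit_channel R' t' \<and> R' $$ (0, 0) = R $$ (0, 0) \<and> R' $$ (1, 1) = R $$ (1, 1)}"

text \<open>Inner minima for the compensated channel U_B o E (o U_A).\<close>
definition val1_ba :: "real mat \<Rightarrow> real vec \<Rightarrow> real mat \<Rightarrow> real" where
  "val1_ba R t QB = (INF c \<in> Pba (blk QB * R) (blk QB *\<^sub>v t). Kr (fst c) (snd c))"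
definition val1_bc :: "real mat \<Rightarrow> real vec \<Rightarrow> real mat \<Rightarrow> real" where
  "val1_bc R t QB = (INF c \<in> Pbc (blk QB * R) (blk QB *\<^sub>v t). Kr (fst c) (snd c))"
definition val2_ba :: "real mat \<Rightarrow> real vec \<Rightarrow> real mat \<Rightarrow> real mat \<Rightarrow> real" where
  "val2_ba R t QA QB = (INF c \<in> Pba (blk QB * R * blk QA) (blk QB *\<^sub>v t). Kr (fst c) (snd c))"
definition val2_bc :: "real mat \<Rightarrow> real vec \<Rightarrow> real mat \<Rightarrow> real mat \<Rightarrow> real" where
  "val2_bc R t QA QB = (INF c \<in> Pbc (blk QB * R * blk QA) (blk QB *\<^sub>v t). Kr (fst c) (snd c))"

definition G1 :: "real mat \<Rightarrow> real vec \<Rightarrow> real" where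
  "G1 R t = (SUP QB \<in> SO2. val1_ba R t QB)"
definition G1t :: "real mat \<Rightarrow> real vec \<Rightarrow> real" where
  "G1t R t = (SUP QB \<in> SO2. val1_bc R t QB)"
definition G2 :: "real mat \<Rightarrow> real vec \<Rightarrow> real" where
  "G2 R t = (SUP Q \<in> SO2 \<times> SO2. val2_ba R t (fst Q) (snd Q))"
definition G2t :: "real mat \<Rightarrow> real vec \<Rightarrow> real" where
  "G2t R t = (SUP Q \<in> SO2 \<times> SO2. val2_bc R t (fst Q) (snd Q))"

definition diag2 :: "real \<Rightarrow> real \<Rightarrow> real mat" where
  "diag2 a b = mat_of_rows_list 2 [[a, 0], [0, b]]"

definition Sblock :: "real mat \<Rightarrow> real mat" where
  "Sblock R = mat 2 2 (\<lambda>(i, j). R $$ (i, j))"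

end

theory Submission
  imports Defs "Jordan_Normal_Form.Schur_Decomposition"
begin

text \<open>
  Let \<open>\<rho>\<close> be the Choi state of a channel and \<open>P\<close> the pinching in the \<open>z\<close>-basis of the input. Comparing
  spectra of \<open>W W\<^sup>\<dagger>\<close> and \<open>W\<^sup>\<dagger> W\<close> gives \<open>H(X|E) = S(P \<rho>) - S(\<rho>)\<close>, whatever the Kraus representation.
  Monotonicity of the relative entropy, \<open>D(\<rho> | \<sigma>) \<ge> D(P \<rho> | P \<sigma>)\<close>, bounds this from below by an
  expression that depends linearly on \<open>\<rho>\<close>. For \<open>\<sigma>\<close> take the Choi state of the channel with block
  \<open>Q\<^sub>B diag(dz, dx) Q\<^sub>A\<close> and \<open>R\<^sub>y\<^sub>y = dz dx\<close>: its logarithm involves only the \<open>z\<close>-\<open>x\<close> correlations, so the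
  bound is determined by the observed parameters, and \<open>\<sigma>\<close> itself attains it.

  With \<open>h(d)\<close> the binary entropy of \<open>(1 + d)/2\<close>, the minimum over \<open>P\<^sub>b\<^sub>c\<close> is therefore \<open>1 - h(R\<^sub>z\<^sub>z) - h(R\<^sub>x\<^sub>x)\<close>;
  the minimum over \<open>P\<^sub>b\<^sub>a\<close> is at most \<open>1 - h(dz) - h(dx)\<close>, with equality once the first column of the
  block points along \<open>z\<close>. The diagonal of a rotated \<open>diag(dz, dx)\<close> is a convex combination of
  \<open>\<plusminus>(dz, dx)\<close> and \<open>\<plusminus>(dx, dz)\<close>, so strict convexity of \<open>-h\<close> shows that \<open>1 - h(dz) - h(dx)\<close> is the
  maximum in all four problems, except that for the one-sided \<open>P\<^sub>b\<^sub>c\<close> problem it is reached only if some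
  rotation \<open>Q\<^sub>B\<close> makes the block diagonal, that is, if its columns are orthogonal.
\<close>

section \<open>Characteristic polynomials and entropy\<close>

text \<open>The logarithm of the reference state is blind to \<open>R\<^sub>y\<^sub>y\<close>
  because its eigenvalues are products of \<open>(1 \<plusminus> dz) / 2\<close> and
  \<open>(1 \<plusminus> dx) / 2\<close>. Logarithms of products add, and
  \<open>R\<^sub>y\<^sub>y\<close>, which enters the four Bell expectations of a state with signs +,
  +, -, -, cancels in both marginals. The pinched reference must see only
  \<open>R\<^sub>z\<^sub>z\<close>; a zero entry \<open>R\<^sub>x\<^sub>z\<close> achieves this by
  making it diagonal. The bound on H(X|E) then contains \<open>h(R\<^sub>z\<^sub>z)\<close>, which
  is the most that H(X|Y) can cost, so this term leaves \<open>K\<close>. The obstacle is that the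
  reference is singular once \<open>\<bar>dz\<bar> = 1\<close> or \<open>\<bar>dx\<bar> = 1\<close>.
  It is therefore shrunk by a factor \<open>l < 1\<close>, and \<open>l\<close> tends to 1 only in
  the final scalar inequality. Monotonicity concerns a single map, the average of the identity and
  one unitary conjugation, so joint convexity and unitary invariance suffice. Comparing integrands
  is turned into comparing relative entropies through monotone antiderivatives, without improper
  integrals.\<close>

lemma order_linear_factors:
  "Polynomial.order x (\<Prod>a\<leftarrow>as. [:- a, 1:]) = count (mset as) (x :: complex)"
proof (induction as)
  case Nil
  show ?case by (simp add: order_1_eq_0)
next
  case (Cons a as)
  have nz: "(\<Prod>a\<leftarrow>as. [:- a, 1:]) \<noteq> (0 :: complex poly)"
    by (auto simp: prod_list_zero_iff)
  have "Polynomial.order x [:- a, 1:] = (if x = a then 1 else 0)"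
    by (cases "x = a") (auto simp: order_0I order_power_n_n[of a 1, simplified])
  then show ?case
    using Cons nz by (simp add: order_mult del: mult_pCons_left)
qed

text \<open>\<open>eigs\<close> picks a root list by \<open>SOME\<close>. The linear factors fix the
  multiset of roots, so a sum over \<open>eigs\<close> depends on the characteristic polynomial
  alone.\<close>

lemma linear_factors_unique:
  assumes "(\<Prod>a\<leftarrow>as. [:- a, 1:]) = (\<Prod>b\<leftarrow>bs. [:- b, 1 :: complex:])"
  shows "mset as = mset bs"
  by (rule multiset_eqI) (simp add: order_linear_factors[symmetric] assms)

lemma char_poly_zero_mat: "char_poly (0\<^sub>m n n) = (\<Prod>a\<leftarrow>replicate n 0. [:- a, 1 :: complex:])"
proof -
  have "diag_mat (0\<^sub>m n n) = replicate n (0 :: complex)"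
    by (rule nth_equalityI) (auto simp: diag_mat_def)
  then show ?thesis by (subst char_poly_upper_triangular[of _ n]) auto
qed

text \<open>The block triangular matrices \<open>?M1\<close> and \<open>?M2\<close> are similar
  through the unipotent \<open>?P\<close>. Their diagonal blocks show that the two products share
  their spectrum up to zeros, also for rectangular factors.\<close>

lemma char_poly_mult_commute:
  fixes A B :: "complex mat"
  assumes A: "A \<in> carrier_mat m n" and B: "B \<in> carrier_mat n m"
  shows "char_poly (A * B) * char_poly (0\<^sub>m n n) = char_poly (0\<^sub>m m m) * char_poly (B * A)"
proof -
  let ?M1 = "four_block_mat (A * B) (0\<^sub>m m n) B (0\<^sub>m n n)"
  let ?M2 = "four_block_mat (0\<^sub>m m m) (0\<^sub>m m n) B (B * A)"
  let ?P = "four_block_mat (1\<^sub>m m) A (0\<^sub>m n m) (1\<^sub>m n)"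
  let ?Q = "four_block_mat (1\<^sub>m m) (- A) (0\<^sub>m n m) (1\<^sub>m n)"
  have AB: "A * B \<in> carrier_mat m m" and BA: "B * A \<in> carrier_mat n n" using A B by auto
  have mul: "four_block_mat A1 A2 A3 A4 * four_block_mat B1 B2 B3 B4 =
      four_block_mat (A1 * B1 + A2 * B3) (A1 * B2 + A2 * B4) (A3 * B1 + A4 * B3) (A3 * B2 + A4 * B4)"
    if "A1 \<in> carrier_mat m m" "A2 \<in> carrier_mat m n" "A3 \<in> carrier_mat n m" "A4 \<in> carrier_mat n n"
       "B1 \<in> carrier_mat m m" "B2 \<in> carrier_mat m n" "B3 \<in> carrier_mat n m" "B4 \<in> carrier_mat n n"
    for A1 A2 A3 A4 B1 B2 B3 B4 :: "complex mat"
    using mult_four_block_mat that by blast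
  have neg: "- A \<in> carrier_mat m n" using A by simp
  have cancel: "A + - A = 0\<^sub>m m n"
    using A by (auto intro!: eq_matI)
  have PQ: "?P * ?Q = 1\<^sub>m (m + n)"
    unfolding mul[OF one_carrier_mat A zero_carrier_mat one_carrier_mat one_carrier_mat neg zero_carrier_mat one_carrier_mat]
      left_mult_zero_mat[OF neg]
    using A neg cancel by simp
  have PM: "?P * ?M2 = four_block_mat (A * B) (A * (B * A)) B (B * A)"
    unfolding mul[OF one_carrier_mat A zero_carrier_mat one_carrier_mat zero_carrier_mat zero_carrier_mat B BA]
    using A B AB BA by simp
  have MP: "?M1 * ?P = four_block_mat (A * B) (A * (B * A)) B (B * A)"
    unfolding mul[OF AB zero_carrier_mat B zero_carrier_mat one_carrier_mat A zero_carrier_mat one_carrier_mat]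
    using A B AB BA by simp
  have carr: "?M1 \<in> carrier_mat (m+n) (m+n)" "?M2 \<in> carrier_mat (m+n) (m+n)"
    "?P \<in> carrier_mat (m+n) (m+n)" "?Q \<in> carrier_mat (m+n) (m+n)"
    using A B AB BA by auto
  have QP: "?Q * ?P = 1\<^sub>m (m + n)" by (rule mat_mult_left_right_inverse[OF carr(3,4) PQ])
  have "?P * ?M2 * ?Q = ?M1 * ?P * ?Q" unfolding PM MP ..
  also have "\<dots> = ?M1 * (?P * ?Q)" using carr by (intro assoc_mult_mat)
  also have "\<dots> = ?M1" unfolding PQ by (rule right_mult_one_mat[OF carr(1)])
  finally have eq: "?M1 = ?P * ?M2 * ?Q" ..
  have "similar_mat ?M1 ?M2"
    unfolding similar_mat_def
    by (intro exI, rule similar_mat_witI[OF PQ QP eq]) (use carr in auto)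
  then have *: "char_poly ?M1 = char_poly ?M2" by (rule char_poly_similar)
  have fac: "\<exists>as. char_poly C = (\<Prod>a\<leftarrow>as. [:- a, 1:])" if "C \<in> carrier_mat k k" for C :: "complex mat" and k
    using char_poly_factorized[OF that] by blast
  have "char_poly ?M1 = char_poly (A * B) * char_poly (0\<^sub>m n n)"
    by (rule char_poly_0_block'[OF refl fac[OF AB] fac[OF zero_carrier_mat] AB B]) (use AB in auto)
  moreover have "char_poly ?M2 = char_poly (0\<^sub>m m m) * char_poly (B * A)"
    by (rule char_poly_0_block'[OF refl fac[OF zero_carrier_mat] fac[OF BA] _ B BA]) (use BA in auto)
  ultimately show ?thesis using * by simp
qed

lemma eigs:
  assumes "A \<in> carrier_mat n n"
  shows "char_poly A = (\<Prod>a\<leftarrow>eigs A. [:- a, 1:])" "length (eigs A) = n"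
  using someI_ex[OF char_poly_factorized[OF assms]] assms unfolding eigs_def by auto

text \<open>Zero eigenvalues add nothing to the entropy, so spectra may be padded; this lets
  matrices of different sizes be compared.\<close>

lemma vn_entropy_factors:
  assumes A: "A \<in> carrier_mat n n"
    and cp: "char_poly A * (\<Prod>a\<leftarrow>replicate k 0. [:- a, 1:]) = (\<Prod>a\<leftarrow>as. [:- a, 1:])"
  shows "vn_entropy A = - (\<Sum>l\<leftarrow>as. ent_term (Re l))"
proof -
  have "mset (eigs A @ replicate k 0) = mset as"
    using cp unfolding eigs(1)[OF A] by (intro linear_factors_unique) simp
  then have "(\<Sum>l\<leftarrow>eigs A @ replicate k 0. ent_term (Re l)) = (\<Sum>l\<leftarrow>as. ent_term (Re l))"
    unfolding sum_mset_sum_list[symmetric] mset_map by simp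
  moreover have "(\<Sum>l\<leftarrow>replicate k 0. ent_term (Re l)) = 0"
    by (induction k) (auto simp: ent_term_def)
  ultimately show ?thesis unfolding vn_entropy_def by simp
qed

lemma vn_entropy_mult_commute:
  assumes A: "A \<in> carrier_mat m n" and B: "B \<in> carrier_mat n m"
  shows "vn_entropy (A * B) = vn_entropy (B * A)"
proof -
  have AB: "A * B \<in> carrier_mat m m" and BA: "B * A \<in> carrier_mat n n" using A B by auto
  have "vn_entropy (A * B) = - (\<Sum>l\<leftarrow>replicate m 0 @ eigs (B * A). ent_term (Re l))"
    using char_poly_mult_commute[OF A B] AB unfolding char_poly_zero_mat eigs(1)[OF BA]
    by (intro vn_entropy_factors) auto
  moreover have "(\<Sum>l\<leftarrow>replicate m 0. ent_term (Re l)) = 0"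
    by (induction m) (auto simp: ent_term_def)
  ultimately show ?thesis unfolding vn_entropy_def by simp
qed

section \<open>Spectral theorem\<close>

lemma dim_adj [simp]: "dim_row (adj A) = dim_col A" "dim_col (adj A) = dim_row A"
  by (simp_all add: adj_def)

lemma adj_carrier [simp]: "A \<in> carrier_mat m n \<Longrightarrow> adj A \<in> carrier_mat n m"
  by (simp add: adj_def)

lemma adj_index [simp]: "i < dim_col A \<Longrightarrow> j < dim_row A \<Longrightarrow> adj A $$ (i, j) = cnj (A $$ (j, i))"
  by (simp add: adj_def)

lemma adj_adj [simp]: "adj (adj A) = A"
  by (rule eq_matI) auto

lemma adj_one [simp]: "adj (1\<^sub>m n) = 1\<^sub>m n"
  by (rule eq_matI) auto

lemma mult_carrier_square:
  "A \<in> carrier_mat n n \<Longrightarrow> B \<in> carrier_mat n n \<Longrightarrow> A * B \<in> carrier_mat n n"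
  by simp

lemma mult_mat_index_sum:
  fixes A B :: "'a :: semiring_0 mat"
  assumes "A \<in> carrier_mat m n" "B \<in> carrier_mat n k" "i < m" "j < k"
  shows "(A * B) $$ (i, j) = (\<Sum>l<n. A $$ (i, l) * B $$ (l, j))"
  using assms by (auto simp: scalar_prod_def atLeast0LessThan intro!: sum.cong)

lemma adj_mult:
  assumes A: "A \<in> carrier_mat m n" and B: "B \<in> carrier_mat n k"
  shows "adj (A * B) = adj B * adj A"
proof (rule eq_matI)
  fix i j assume "i < dim_row (adj B * adj A)" "j < dim_col (adj B * adj A)"
  then have ij: "i < k" "j < m" using A B by auto
  have "adj (A * B) $$ (i, j) = cnj ((A * B) $$ (j, i))"
    using A B ij by (intro adj_index) auto
  also have "\<dots> = (\<Sum>l<n. cnj (A $$ (j, l)) * cnj (B $$ (l, i)))"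
    using ij by (simp only: mult_mat_index_sum[OF A B] cnj_sum complex_cnj_mult)
  also have "\<dots> = (\<Sum>l<n. adj B $$ (i, l) * adj A $$ (l, j))"
    using A B ij by (intro sum.cong refl) (simp add: mult.commute)
  also have "\<dots> = (adj B * adj A) $$ (i, j)"
    using ij by (simp only: mult_mat_index_sum[OF adj_carrier[OF B] adj_carrier[OF A]])
  finally show "adj (A * B) $$ (i, j) = (adj B * adj A) $$ (i, j)" .
qed (use A B in auto)

lemma unitary_right_inverse:
  assumes "U \<in> carrier_mat n n" "adj U * U = 1\<^sub>m n"
  shows "U * adj U = 1\<^sub>m n"
  using mat_mult_left_right_inverse[of "adj U" n U] assms by simp

lemma unitary_with_first_column:
  fixes v :: "complex vec"
  assumes v: "v \<in> carrier_vec n" and v0: "v \<noteq> 0\<^sub>v n" and n: "n > 0"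
  shows "\<exists>W c. W \<in> carrier_mat n n \<and> adj W * W = 1\<^sub>m n \<and> col W 0 = c \<cdot>\<^sub>v v"
proof -
  interpret cof_vec_space n "TYPE(complex)" .
  define b where "b = basis_completion v"
  define ws where "ws = gram_schmidt n b"
  from basis_completion[OF v v0, folded b_def]
  have dist_b: "distinct b" and indep: "\<not> lin_dep (set b)" and b: "set b \<subseteq> carrier_vec n"
    and hdb: "hd b = v" and len_b: "length b = n" by auto
  from hdb len_b n obtain vs where bv: "b = v # vs" by (cases b) auto
  from gram_schmidt_result[OF b dist_b indep refl, folded ws_def]
  have ws: "set ws \<subseteq> carrier_vec n" "corthogonal ws" "length ws = n"
    by (auto simp: len_b)
  have "hd ws = v" unfolding ws_def bv using v by (intro gram_schmidt_hd) (use b bv in auto)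
  then have ws0: "ws ! 0 = v" using ws(3) n by (cases ws) auto
  have wsc: "ws ! i \<in> carrier_vec n" if "i < n" for i using ws that by auto
  \<comment> \<open>Gram-Schmidt yields orthogonal vectors of arbitrary length. Dividing by
    \<open>N\<close> normalises them, so the first column is only a scalar multiple of
    \<open>v\<close>.\<close>
  define N where "N i = sqrt (Re (ws ! i \<bullet>c ws ! i))" for i
  define W where "W = mat n n (\<lambda>(i, j). ws ! j $ i / complex_of_real (N j))"
  have N: "complex_of_real (N i) * complex_of_real (N i) = ws ! i \<bullet>c ws ! i" "N i \<noteq> 0" if "i < n" for i
  proof -
    have ge: "ws ! i \<bullet>c ws ! i \<ge> 0" using conjugate_square_ge_0_vec .
    have "ws ! i \<bullet>c ws ! i \<noteq> 0"
      using ws(2) ws(3) that unfolding corthogonal_def by auto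
    then show "complex_of_real (N i) * complex_of_real (N i) = ws ! i \<bullet>c ws ! i" "N i \<noteq> 0"
      using ge unfolding N_def of_real_mult[symmetric]
      by (auto simp: less_eq_complex_def complex_eq_iff)
  qed
  have W: "W \<in> carrier_mat n n" by (simp add: W_def)
  have "(adj W * W) $$ (i, j) = 1\<^sub>m n $$ (i, j)" if "i < n" "j < n" for i j
  proof -
    have "(adj W * W) $$ (i, j) = (\<Sum>l<n. cnj (ws ! i $ l / complex_of_real (N i)) * (ws ! j $ l / complex_of_real (N j)))"
      using that unfolding mult_mat_index_sum[OF adj_carrier[OF W] W that]
      by (intro sum.cong refl) (simp add: W_def)
    also have "\<dots> = (\<Sum>l<n. ws ! j $ l * cnj (ws ! i $ l)) / (complex_of_real (N i) * complex_of_real (N j))"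
      unfolding sum_divide_distrib by (intro sum.cong refl) (simp add: mult.commute)
    also have "(\<Sum>l<n. ws ! j $ l * cnj (ws ! i $ l)) = ws ! j \<bullet>c ws ! i"
      using wsc[OF that(1)] wsc[OF that(2)]
      by (auto simp: scalar_prod_def atLeast0LessThan conjugate_complex_def intro!: sum.cong)
    finally have *: "(adj W * W) $$ (i, j) = ws ! j \<bullet>c ws ! i / (complex_of_real (N i) * complex_of_real (N j))" .
    show ?thesis
    proof (cases "i = j")
      case True
      have "ws ! j \<bullet>c ws ! j \<noteq> 0" using N[OF that(2)] by (metis mult_eq_0_iff of_real_eq_0_iff)
      then show ?thesis using * N(1)[OF that(1)] that True by simp
    next
      case False
      then have "ws ! j \<bullet>c ws ! i = 0"
        using ws(2,3) that unfolding corthogonal_def by auto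
      then show ?thesis using * False that by simp
    qed
  qed
  then have "adj W * W = 1\<^sub>m n" using W by (intro eq_matI) auto
  moreover have "col W 0 = (1 / complex_of_real (N 0)) \<cdot>\<^sub>v v"
    using n v by (auto simp: W_def ws0)
  ultimately show ?thesis using W by blast
qed

definition diagm :: "nat \<Rightarrow> (nat \<Rightarrow> real) \<Rightarrow> complex mat" where
  "diagm n p = mat n n (\<lambda>(i, j). if i = j then complex_of_real (p i) else 0)"

lemma diagm_carrier [simp]: "diagm n p \<in> carrier_mat n n"
  by (simp add: diagm_def)

lemma adj_conj:
  assumes "A \<in> carrier_mat n n" "W \<in> carrier_mat n n" "adj A = A"
  shows "adj (adj W * A * W) = adj W * A * W"
  using assms by (simp add: adj_mult[of _ n n _ n] assoc_mult_mat[of _ n n _ n _ n] mult_carrier_square)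

text \<open>Deflation: in a unitary basis that starts with an eigenvector, the first column vanishes
  below the diagonal, and hermiticity clears the first row too. The induction hypothesis
  diagonalises the remaining block.\<close>

theorem hermitian_spectral:
  assumes "A \<in> carrier_mat n n" "adj A = A"
  shows "\<exists>U p. U \<in> carrier_mat n n \<and> adj U * U = 1\<^sub>m n \<and> A = U * diagm n p * adj U"
  using assms
proof (induction n arbitrary: A)
  case 0
  then show ?case by (intro exI[of _ "1\<^sub>m 0"] exI[of _ "\<lambda>_. 0"]) auto
next
  case (Suc n)
  let ?N = "Suc n"
  note A = Suc.prems(1)
  obtain as where as: "char_poly A = (\<Prod>a\<leftarrow>as. [:- a, 1:])" "length as = ?N"
    using char_poly_factorized[OF A] by blast
  then obtain e es where "as = e # es" by (cases as) auto
  then have "eigenvalue A e" unfolding eigenvalue_root_char_poly[OF A] as(1) by simp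
  then obtain v where v: "v \<in> carrier_vec ?N" "v \<noteq> 0\<^sub>v ?N" "A *\<^sub>v v = e \<cdot>\<^sub>v v"
    using A unfolding eigenvalue_def eigenvector_def by auto
  obtain W c where W: "W \<in> carrier_mat ?N ?N" "adj W * W = 1\<^sub>m ?N" and c: "col W 0 = c \<cdot>\<^sub>v v"
    using unitary_with_first_column[OF v(1,2)] by blast
  note WW = unitary_right_inverse[OF W]
  define A' where "A' = adj W * A * W"
  have A': "A' \<in> carrier_mat ?N ?N" using A W unfolding A'_def by (intro mult_carrier_mat[of _ ?N ?N] adj_carrier)
  have hA': "adj A' = A'" unfolding A'_def using A W Suc.prems(2) by (intro adj_conj)
  have aW: "adj W \<in> carrier_mat ?N ?N" using W by simp
  have AW: "A * W \<in> carrier_mat ?N ?N" using A W by simp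
  have colA: "A' $$ (i, 0) = (if i = 0 then e else 0)" if i: "i < ?N" for i
  proof -
    have "A' $$ (i, 0) = (adj W * (A * W)) $$ (i, 0)"
      unfolding A'_def using A W by (simp add: assoc_mult_mat[of _ ?N ?N _ ?N _ ?N])
    also have "\<dots> = row (adj W) i \<bullet> col (A * W) 0"
      using i A W by (intro index_mult_mat(1)) auto
    also have "col (A * W) 0 = A *\<^sub>v col W 0"
      by (rule col_mult2[OF A W(1)]) simp
    also have "A *\<^sub>v col W 0 = e \<cdot>\<^sub>v col W 0"
      unfolding c using A v by (simp add: mult_mat_vec[of _ ?N ?N] smult_smult_assoc mult.commute)
    also have "row (adj W) i \<bullet> (e \<cdot>\<^sub>v col W 0) = e * (adj W * W) $$ (i, 0)"
    proof -
      have "(adj W * W) $$ (i, 0) = row (adj W) i \<bullet> col W 0"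
        by (rule index_mult_mat(1)) (use i W in auto)
      then show ?thesis using W aW i by (subst scalar_prod_smult_distrib[of _ ?N]) (auto intro!: carrier_vecI)
    qed
    finally show ?thesis using i W(2) by simp
  qed
  have rowA: "A' $$ (0, i) = (if i = 0 then cnj e else 0)" if i: "i < ?N" for i
  proof -
    have "A' $$ (0, i) = adj A' $$ (0, i)" by (simp add: hA')
    also have "\<dots> = cnj (A' $$ (i, 0))" using A' i by (intro adj_index) auto
    finally show ?thesis using colA[OF i] by simp
  qed
  \<comment> \<open>The corner entry is read once from the column and once from the row, so the
    eigenvalue equals its own conjugate.\<close>
  have ere: "e = complex_of_real (Re e)"
    using colA[of 0] rowA[of 0] by (simp add: complex_eq_iff)
  define A3 where "A3 = mat n n (\<lambda>(i, j). A' $$ (Suc i, Suc j))"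
  have A3: "A3 \<in> carrier_mat n n" by (simp add: A3_def)
  have "adj A3 = A3"
  proof (rule eq_matI)
    fix i j assume "i < dim_row A3" "j < dim_col A3"
    then have ij: "i < n" "j < n" using A3 by auto
    have "A' $$ (Suc i, Suc j) = adj A' $$ (Suc i, Suc j)" by (simp add: hA')
    also have "\<dots> = cnj (A' $$ (Suc j, Suc i))" using A' ij by (intro adj_index) auto
    finally show "adj A3 $$ (i, j) = A3 $$ (i, j)" using ij by (simp add: A3_def)
  qed (use A3 in auto)
  then obtain U p where U: "U \<in> carrier_mat n n" "adj U * U = 1\<^sub>m n" and A3U: "A3 = U * diagm n p * adj U"
    using Suc.IH[OF A3] by blast
  let ?B = "\<lambda>X Y. four_block_mat X (0\<^sub>m 1 n) (0\<^sub>m n 1) Y"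
  have mul: "?B X Y * ?B X' Y' = ?B (X * X') (Y * Y')"
    if "X \<in> carrier_mat 1 1" "X' \<in> carrier_mat 1 1" "Y \<in> carrier_mat n n" "Y' \<in> carrier_mat n n" for X X' Y Y'
    using that by (subst mult_four_block_mat[of _ 1 1 _ n _ n _ _ 1 _ n]) auto
  define V where "V = ?B (1\<^sub>m 1) U"
  define q where "q = (\<lambda>i. if i = 0 then Re e else p (i - 1))"
  have V: "V \<in> carrier_mat ?N ?N" using U by (auto simp: V_def)
  have aV: "adj V = ?B (1\<^sub>m 1) (adj U)"
    using U by (intro eq_matI) (auto simp: V_def)
  have VV: "adj V * V = 1\<^sub>m ?N"
    unfolding aV unfolding V_def using U by (subst mul) auto
  have dq: "diagm ?N q = ?B (diagm 1 (\<lambda>_. Re e)) (diagm n p)"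
    by (intro eq_matI) (auto simp: diagm_def q_def)
  have "V * diagm ?N q * adj V = ?B (diagm 1 (\<lambda>_. Re e)) (U * diagm n p * adj U)"
    unfolding aV dq unfolding V_def using U
    by (simp add: mul mult_carrier_square left_mult_one_mat[OF diagm_carrier] right_mult_one_mat[OF diagm_carrier] del: One_nat_def)
  also have "\<dots> = A'"
    unfolding A3U[symmetric]
  proof (rule eq_matI)
    fix i j assume "i < dim_row A'" "j < dim_col A'"
    then have ij: "i < ?N" "j < ?N" using A' by auto
    then show "?B (diagm 1 (\<lambda>_. Re e)) A3 $$ (i, j) = A' $$ (i, j)"
      using colA[of i] rowA[of j] ere A3
      by (cases i; cases j) (auto simp: diagm_def A3_def)
  qed (use A' A3 in \<open>auto simp: diagm_def\<close>)
  finally have A'V: "A' = V * diagm ?N q * adj V" ..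
  note assoc = assoc_mult_mat[of _ ?N ?N _ ?N _ ?N] mult_carrier_square
  have "A = (W * adj W) * A * (W * adj W)" unfolding WW using A by simp
  also have "\<dots> = W * A' * adj W"
    unfolding A'_def using A W by (simp add: assoc)
  also have "\<dots> = (W * V) * diagm ?N q * adj (W * V)"
    unfolding A'V adj_mult[OF W(1) V] using W V by (simp add: assoc)
  finally have "A = (W * V) * diagm ?N q * adj (W * V)" .
  moreover have "adj (W * V) * (W * V) = adj V * (adj W * W) * V"
    unfolding adj_mult[OF W(1) V] using W(1) V by (simp add: assoc)
  then have "adj (W * V) * (W * V) = 1\<^sub>m ?N" unfolding W(2) using V VV by simp
  ultimately show ?case using W V by (intro exI[of _ "W * V"] exI[of _ q]) auto
qed

section \<open>Traces and entropies in an eigenbasis\<close>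

lemma mtrace_mult:
  assumes "A \<in> carrier_mat m n" "B \<in> carrier_mat n m"
  shows "mtrace (A * B) = (\<Sum>i<m. \<Sum>j<n. A $$ (i, j) * B $$ (j, i))"
  unfolding mtrace_def using assms
  by (auto simp: mult_mat_index_sum[of A m n B m] simp del: index_mult_mat(1) intro!: sum.cong)

lemma mtrace_mult_commute:
  assumes "A \<in> carrier_mat m n" "B \<in> carrier_mat n m"
  shows "mtrace (A * B) = mtrace (B * A)"
  unfolding mtrace_mult[OF assms] mtrace_mult[OF assms(2,1)]
  by (subst sum.swap) (simp add: mult.commute)

lemma mtrace_add:
  assumes "A \<in> carrier_mat n n" "B \<in> carrier_mat n n"
  shows "mtrace (A + B) = mtrace A + mtrace B"
  using assms by (auto simp: mtrace_def sum.distrib)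

lemma mtrace_smult: "A \<in> carrier_mat n n \<Longrightarrow> mtrace (c \<cdot>\<^sub>m A) = c * mtrace A"
  by (auto simp: mtrace_def sum_distrib_left)

definition spectral :: "nat \<Rightarrow> complex mat \<Rightarrow> complex mat \<Rightarrow> (nat \<Rightarrow> real) \<Rightarrow> bool" where
  "spectral n A U p \<longleftrightarrow> U \<in> carrier_mat n n \<and> adj U * U = 1\<^sub>m n \<and> A = U * diagm n p * adj U"

lemma spectralD:
  assumes "spectral n A U p"
  shows "U \<in> carrier_mat n n" "adj U * U = 1\<^sub>m n" "U * adj U = 1\<^sub>m n"
    "A = U * diagm n p * adj U" "A \<in> carrier_mat n n"
  using assms unitary_right_inverse[of U n] unfolding spectral_def
  by (auto intro!: mult_carrier_mat[of _ n n])

lemma diagm_mult_index: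
  assumes "M \<in> carrier_mat n k" "i < n" "j < k"
  shows "(diagm n p * M) $$ (i, j) = complex_of_real (p i) * M $$ (i, j)"
proof -
  have "(diagm n p * M) $$ (i, j) = (\<Sum>l<n. if l = i then complex_of_real (p i) * M $$ (i, j) else 0)"
    unfolding mult_mat_index_sum[OF diagm_carrier assms]
    by (intro sum.cong refl) (auto simp: diagm_def assms)
  then show ?thesis using assms by simp
qed

lemma mtrace_diagm_mult:
  assumes "M \<in> carrier_mat n n"
  shows "mtrace (diagm n p * M) = (\<Sum>i<n. complex_of_real (p i) * M $$ (i, i))"
proof -
  have "dim_row (diagm n p * M) = n" by (simp add: diagm_def)
  then show ?thesis unfolding mtrace_def by (simp add: diagm_mult_index[OF assms] del: index_mult_mat(1))
qed

lemma conj_diagm_index: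
  assumes U: "U \<in> carrier_mat n n" and "i < n" "j < n"
  shows "(U * diagm n p * adj U) $$ (i, j) = (\<Sum>l<n. complex_of_real (p l) * (U $$ (i, l) * cnj (U $$ (j, l))))"
proof -
  have aU: "adj U \<in> carrier_mat n n" using U by simp
  have "U * diagm n p * adj U = U * (diagm n p * adj U)"
    using U by (simp add: assoc_mult_mat[of _ n n _ n _ n])
  then have "(U * diagm n p * adj U) $$ (i, j) = (\<Sum>l<n. U $$ (i, l) * (diagm n p * adj U) $$ (l, j))"
    using mult_mat_index_sum[OF U mult_carrier_mat[OF diagm_carrier aU] assms(2,3)] by simp
  also have "\<dots> = (\<Sum>l<n. complex_of_real (p l) * (U $$ (i, l) * cnj (U $$ (j, l))))"
    using U assms by (intro sum.cong refl) (simp add: diagm_mult_index[OF aU])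
  finally show ?thesis .
qed

lemma spectral_index:
  assumes "spectral n A U p" "i < n" "j < n"
  shows "A $$ (i, j) = (\<Sum>l<n. complex_of_real (p l) * (U $$ (i, l) * cnj (U $$ (j, l))))"
  using conj_diagm_index[OF spectralD(1)[OF assms(1)] assms(2,3)] spectralD(4)[OF assms(1)] by metis

lemma vn_entropy_spectral:
  assumes "spectral n A U p"
  shows "vn_entropy A = - (\<Sum>i<n. ent_term (p i))"
proof -
  note U = spectralD[OF assms(1)]
  have "similar_mat A (diagm n p)"
    unfolding similar_mat_def
    by (intro exI, rule similar_mat_witI[OF U(3,2,4)]) (use U in auto)
  then have "char_poly A = char_poly (diagm n p)" by (rule char_poly_similar)
  also have "\<dots> = (\<Prod>a\<leftarrow>diag_mat (diagm n p). [:- a, 1:])"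
    by (rule char_poly_upper_triangular[of _ n]) (auto simp: diagm_def)
  also have "diag_mat (diagm n p) = map (\<lambda>i. complex_of_real (p i)) [0..<n]"
    by (auto simp: diag_mat_def diagm_def)
  finally have "vn_entropy A = - (\<Sum>l\<leftarrow>map (\<lambda>i. complex_of_real (p i)) [0..<n]. ent_term (Re l))"
    using U by (intro vn_entropy_factors[of A n 0]) auto
  then show ?thesis
    by (simp add: o_def sum_list_distinct_conv_sum_set interv_sum_list_conv_sum_set_nat atLeast0LessThan)
qed

text \<open>For fixed \<open>X\<close> this functional is linear in the pair of states; its supremum over \<open>X\<close> is
  \<open>\<Sum>i j. \<bar>\<langle>a i, b j\<rangle>\<bar>\<^sup>2 p i\<^sup>2 / (s j + T p i)\<close>, the integrand of the relative entropy in the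
  integral representation of the logarithm. Hence the relative entropy is jointly convex.\<close>
definition varf :: "real \<Rightarrow> complex mat \<Rightarrow> complex mat \<Rightarrow> complex mat \<Rightarrow> real" where
  "varf T X \<rho> \<sigma> = 2 * Re (mtrace (\<rho> * X)) - Re (mtrace (\<sigma> * (X * adj X))) - T * Re (mtrace (\<rho> * (adj X * X)))"

definition overlap :: "complex mat \<Rightarrow> complex mat \<Rightarrow> nat \<Rightarrow> nat \<Rightarrow> real" where
  "overlap A B i j = (cmod ((adj A * B) $$ (i, j)))\<^sup>2"

text \<open>\<open>Y\<close> is the matrix of \<open>X\<close> between the two eigenbases. In these
  coordinates the functional decouples into one quadratic expression per entry of \<open>Y\<close>,
  so each entry can be optimised separately.\<close>

lemma varf_spectral:
  assumes \<rho>: "spectral n \<rho> A p" and \<sigma>: "spectral n \<sigma> B s" and Y: "Y \<in> carrier_mat n n"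
  shows "varf T (B * Y * adj A) \<rho> \<sigma> = (\<Sum>i<n. \<Sum>j<n. 2 * p i * Re ((adj A * B) $$ (i, j) * Y $$ (j, i))
      - (s j + T * p i) * (cmod (Y $$ (j, i)))\<^sup>2)"
proof -
  note A = spectralD[OF \<rho>] and B = spectralD[OF \<sigma>]
  note assoc = assoc_mult_mat[of _ n n _ n _ n] mult_carrier_square
  define X where "X = B * Y * adj A"
  have aA: "adj A \<in> carrier_mat n n" and aB: "adj B \<in> carrier_mat n n" and aY: "adj Y \<in> carrier_mat n n"
    using A B Y by auto
  have X: "X \<in> carrier_mat n n" using B(1) Y aA unfolding X_def by (intro mult_carrier_mat[of _ n n])
  have aX: "adj X = A * adj Y * adj B"
    unfolding X_def using A B Y aA by (simp add: adj_mult[of _ n n _ n] assoc)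
  let ?M = "adj A * B"
  have M: "?M \<in> carrier_mat n n" using aA B by simp
  have cancel: "adj A * (A * Z) = Z" "adj B * (B * Z) = Z" if "Z \<in> carrier_mat n n" for Z
    using that A B aA aB by (simp_all add: assoc_mult_mat[of _ n n _ n _ n, symmetric])
  have "mtrace (\<rho> * X) = mtrace (A * (diagm n p * (adj A * X)))"
    unfolding A(4) using A(1) X aA by (simp add: assoc)
  also have "\<dots> = mtrace ((diagm n p * (adj A * X)) * A)"
    using A(1) X aA by (intro mtrace_mult_commute[of _ n n] mult_carrier_square) auto
  also have "(diagm n p * (adj A * X)) * A = diagm n p * (?M * Y)"
    unfolding X_def using A B Y aA aB cancel A(2) by (simp add: assoc)
  also have "mtrace \<dots> = (\<Sum>i<n. complex_of_real (p i) * (?M * Y) $$ (i, i))"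
    using aA B(1) Y by (intro mtrace_diagm_mult mult_carrier_square)
  also have "\<dots> = (\<Sum>i<n. \<Sum>j<n. complex_of_real (p i) * (?M $$ (i, j) * Y $$ (j, i)))"
    by (intro sum.cong refl) (simp add: mult_mat_index_sum[OF M Y] sum_distrib_left)
  finally have t1: "Re (mtrace (\<rho> * X)) = (\<Sum>i<n. \<Sum>j<n. p i * Re (?M $$ (i, j) * Y $$ (j, i)))"
    by simp
  have "mtrace (\<sigma> * (X * adj X)) = mtrace (B * (diagm n s * (adj B * (X * adj X))))"
    unfolding B(4) using B(1) X aB by (simp add: assoc)
  also have "\<dots> = mtrace ((diagm n s * (adj B * (X * adj X))) * B)"
    using B(1) X aB by (intro mtrace_mult_commute[of _ n n] mult_carrier_square) auto
  also have "(diagm n s * (adj B * (X * adj X))) * B = diagm n s * (Y * adj Y)"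
    unfolding aX unfolding X_def using A B Y aA aB aY cancel B(2) by (simp add: assoc)
  also have "mtrace \<dots> = (\<Sum>j<n. complex_of_real (s j) * (Y * adj Y) $$ (j, j))"
    using aY Y by (intro mtrace_diagm_mult mult_carrier_square)
  also have "\<dots> = (\<Sum>j<n. \<Sum>i<n. complex_of_real (s j * (cmod (Y $$ (j, i)))\<^sup>2))"
    using Y unfolding of_real_mult complex_norm_square sum_distrib_left[symmetric]
    by (auto simp: mult_mat_index_sum[OF Y aY] simp del: index_mult_mat(1) intro!: sum.cong)
  also have "\<dots> = (\<Sum>i<n. \<Sum>j<n. complex_of_real (s j * (cmod (Y $$ (j, i)))\<^sup>2))"
    by (rule sum.swap)
  finally have t2: "Re (mtrace (\<sigma> * (X * adj X))) = (\<Sum>i<n. \<Sum>j<n. s j * (cmod (Y $$ (j, i)))\<^sup>2)"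
    by simp
  have "mtrace (\<rho> * (adj X * X)) = mtrace (A * (diagm n p * (adj A * (adj X * X))))"
    unfolding A(4) using A(1) X aA by (simp add: assoc)
  also have "\<dots> = mtrace ((diagm n p * (adj A * (adj X * X))) * A)"
    using A(1) X aA by (intro mtrace_mult_commute[of _ n n] mult_carrier_square) auto
  also have "(diagm n p * (adj A * (adj X * X))) * A = diagm n p * (adj Y * Y)"
    unfolding aX unfolding X_def using A B Y aA aB aY cancel A(2) by (simp add: assoc)
  also have "mtrace \<dots> = (\<Sum>i<n. complex_of_real (p i) * (adj Y * Y) $$ (i, i))"
    using aY Y by (intro mtrace_diagm_mult mult_carrier_square)
  also have "\<dots> = (\<Sum>i<n. \<Sum>j<n. complex_of_real (p i * (cmod (Y $$ (j, i)))\<^sup>2))"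
    using Y unfolding of_real_mult complex_norm_square sum_distrib_left[symmetric]
    by (auto simp: mult_mat_index_sum[OF aY Y] mult.commute simp del: index_mult_mat(1) intro!: sum.cong)
  finally have t3: "Re (mtrace (\<rho> * (adj X * X))) = (\<Sum>i<n. \<Sum>j<n. p i * (cmod (Y $$ (j, i)))\<^sup>2)"
    by simp
  show ?thesis
    unfolding varf_def X_def[symmetric] t1 t2 t3
    by (simp add: sum_distrib_left sum_subtractf[symmetric] algebra_simps sum.distrib)
qed

lemma varf_upper:
  assumes \<rho>: "spectral n \<rho> A p" and \<sigma>: "spectral n \<sigma> B s" and X: "X \<in> carrier_mat n n"
    and T: "T \<ge> 0" and p: "\<And>i. i < n \<Longrightarrow> p i \<ge> 0" and s: "\<And>j. j < n \<Longrightarrow> s j > 0"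
  shows "varf T X \<rho> \<sigma> \<le> (\<Sum>i<n. \<Sum>j<n. overlap A B i j * (p i)\<^sup>2 / (s j + T * p i))"
proof -
  note A = spectralD[OF \<rho>] and B = spectralD[OF \<sigma>]
  note assoc = assoc_mult_mat[of _ n n _ n _ n] mult_carrier_square
  define Y where "Y = adj B * X * A"
  have aB: "adj B \<in> carrier_mat n n" and aA: "adj A \<in> carrier_mat n n" using A B by auto
  have Y: "Y \<in> carrier_mat n n" using A(1) aB X unfolding Y_def by (intro mult_carrier_mat[of _ n n])
  have cancel: "B * (adj B * Z) = Z" if "Z \<in> carrier_mat n n" for Z
    using that B aB by (simp add: assoc_mult_mat[of _ n n _ n _ n, symmetric])
  have XY: "X = B * Y * adj A"
    unfolding Y_def using A B X aA aB cancel by (simp add: assoc)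
  show ?thesis
    unfolding XY varf_spectral[OF \<rho> \<sigma> Y]
  proof (intro sum_mono)
    fix i j assume "i \<in> {..<n}" "j \<in> {..<n}"
    then have d: "s j + T * p i > 0" using T p s by (intro add_pos_nonneg) auto
    let ?m = "(adj A * B) $$ (i, j)" and ?y = "Y $$ (j, i)" and ?d = "s j + T * p i"
    have "Re (?m * ?y) \<le> cmod ?m * cmod ?y" by (metis complex_Re_le_cmod norm_mult)
    then have "2 * p i * Re (?m * ?y) \<le> 2 * p i * (cmod ?m * cmod ?y)"
      using p \<open>i \<in> {..<n}\<close> by (intro mult_left_mono) auto
    \<comment> \<open>Completing the square in \<open>cmod ?y\<close> bounds the quadratic by its
      maximum.\<close>
    moreover have "0 \<le> (p i * cmod ?m - ?d * cmod ?y)\<^sup>2 / ?d" using d by simp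
    then have "2 * p i * (cmod ?m * cmod ?y) - ?d * (cmod ?y)\<^sup>2 \<le> (cmod ?m)\<^sup>2 * (p i)\<^sup>2 / ?d"
      using d by (simp add: field_simps power2_eq_square)
    ultimately show "2 * p i * Re (?m * ?y) - ?d * (cmod ?y)\<^sup>2 \<le> overlap A B i j * (p i)\<^sup>2 / ?d"
      unfolding overlap_def by linarith
  qed
qed

lemma varf_attained:
  assumes \<rho>: "spectral n \<rho> A p" and \<sigma>: "spectral n \<sigma> B s"
    and T: "T \<ge> 0" and p: "\<And>i. i < n \<Longrightarrow> p i \<ge> 0" and s: "\<And>j. j < n \<Longrightarrow> s j > 0"
  shows "\<exists>X \<in> carrier_mat n n. varf T X \<rho> \<sigma> = (\<Sum>i<n. \<Sum>j<n. overlap A B i j * (p i)\<^sup>2 / (s j + T * p i))"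
proof -
  note A = spectralD[OF \<rho>] and B = spectralD[OF \<sigma>]
  \<comment> \<open>The maximiser of every quadratic: the phase cancels that of the entry of
    \<open>adj A * B\<close>, and the modulus is the vertex of the parabola.\<close>
  define Y where "Y = mat n n (\<lambda>(j, i). complex_of_real (p i / (s j + T * p i)) * cnj ((adj A * B) $$ (i, j)))"
  have Y: "Y \<in> carrier_mat n n" by (simp add: Y_def)
  have "varf T (B * Y * adj A) \<rho> \<sigma> = (\<Sum>i<n. \<Sum>j<n. overlap A B i j * (p i)\<^sup>2 / (s j + T * p i))"
    unfolding varf_spectral[OF \<rho> \<sigma> Y]
  proof (intro sum.cong refl)
    fix i j assume ij: "i \<in> {..<n}" "j \<in> {..<n}"
    then have d: "s j + T * p i > 0" using T p s by (intro add_pos_nonneg) auto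
    let ?m = "(adj A * B) $$ (i, j)" and ?y = "Y $$ (j, i)" and ?d = "s j + T * p i"
    have y: "?y = complex_of_real (p i / ?d) * cnj ?m" using ij by (simp add: Y_def)
    have "?m * ?y = complex_of_real (p i / ?d * (cmod ?m)\<^sup>2)"
      unfolding y of_real_mult complex_norm_square by (simp only: mult_ac)
    moreover have "(cmod ?y)\<^sup>2 = (p i / ?d)\<^sup>2 * (cmod ?m)\<^sup>2"
      unfolding y by (simp only: norm_mult norm_of_real complex_mod_cnj power_mult_distrib power2_abs)
    moreover have "2 * p i * (p i / d * c) - d * ((p i / d)\<^sup>2 * c) = c * (p i)\<^sup>2 / d" if "d > 0" for c d :: real
      using that by (simp add: field_simps power2_eq_square)
    ultimately show "2 * p i * Re (?m * ?y) - ?d * (cmod ?y)\<^sup>2 = overlap A B i j * (p i)\<^sup>2 / ?d"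
      unfolding overlap_def using d by (simp only: Re_complex_of_real)
  qed
  moreover have "B * Y * adj A \<in> carrier_mat n n"
    using A B Y by (intro mult_carrier_mat[of _ n n]) auto
  ultimately show ?thesis by blast
qed

section \<open>Relative entropy\<close>

lemma ent_term_0 [simp]: "ent_term 0 = 0"
  by (simp add: ent_term_def)

lemma ent_term_eq: "ent_term p = p * log 2 p"
  by (simp add: ent_term_def)

text \<open>Both parts come down to \<open>ln x \<le> x - 1\<close>, with equality only at 1, for
  \<open>x = q / p\<close>; hence \<open>p = 0\<close> is treated apart.\<close>

lemma ent_term_tangent:
  assumes p: "p \<ge> 0" and q: "q > 0"
  shows "ent_term q + (p - q) * (log 2 q + 1 / ln 2) \<le> ent_term p"
    and "p \<noteq> q \<Longrightarrow> ent_term q + (p - q) * (log 2 q + 1 / ln 2) < ent_term p"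
proof -
  have key: "ent_term p - ent_term q - (p - q) * (log 2 q + 1 / ln 2) = (p * (ln p - ln q) - (p - q)) / ln 2"
    unfolding ent_term_eq log_def by (simp add: field_simps)
  have "p * (ln p - ln q) - (p - q) \<ge> 0 \<and> (p \<noteq> q \<longrightarrow> p * (ln p - ln q) - (p - q) > 0)"
  proof (cases "p = 0")
    case True
    then show ?thesis using q by simp
  next
    case False
    then have p: "p > 0" using p by simp
    have ln: "ln p - ln q = - ln (q / p)" using p q by (simp add: ln_div)
    have "p * ln (q / p) \<le> p * (q / p - 1)"
      using p q by (intro mult_left_mono ln_le_minus_one) auto
    moreover have "p * (q / p - 1) = q - p" using p by (simp add: field_simps)
    moreover have "p * ln (q / p) \<noteq> p * (q / p - 1)" if "p \<noteq> q"
      using ln_eq_minus_one[of "q / p"] p q that by auto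
    ultimately show ?thesis unfolding ln by fastforce
  qed
  then have "(p * (ln p - ln q) - (p - q)) / ln 2 \<ge> 0"
    "p \<noteq> q \<Longrightarrow> (p * (ln p - ln q) - (p - q)) / ln 2 > 0" by auto
  then show "ent_term q + (p - q) * (log 2 q + 1 / ln 2) \<le> ent_term p"
    "p \<noteq> q \<Longrightarrow> ent_term q + (p - q) * (log 2 q + 1 / ln 2) < ent_term p"
    unfolding key[symmetric] by auto
qed

text \<open>The tangent inequality rearranged. Summed over two probability vectors, the correction
  \<open>(p - q) / ln 2\<close> vanishes and Gibbs' inequality remains.\<close>

lemma ent_term_gibbs:
  assumes "p \<ge> 0" "q \<ge> 0" "q = 0 \<Longrightarrow> p = 0"
  shows "p * log 2 q + (p - q) / ln 2 \<le> ent_term p"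
proof (cases "q = 0")
  case False
  then show ?thesis using ent_term_tangent(1)[of p q] assms by (simp add: ent_term_eq algebra_simps)
qed (use assms in simp)

lemma ent_term_jensen:
  assumes fin: "finite I" and w: "\<And>i. i \<in> I \<Longrightarrow> w i \<ge> 0" "sum w I = 1" and x: "\<And>i. i \<in> I \<Longrightarrow> x i \<ge> 0"
  shows "ent_term (\<Sum>i\<in>I. w i * x i) \<le> (\<Sum>i\<in>I. w i * ent_term (x i))"
    and "ent_term (\<Sum>i\<in>I. w i * x i) = (\<Sum>i\<in>I. w i * ent_term (x i)) \<Longrightarrow>
      i \<in> I \<Longrightarrow> w i > 0 \<Longrightarrow> x i = (\<Sum>i\<in>I. w i * x i)"
proof -
  define r where "r = (\<Sum>i\<in>I. w i * x i)"
  have r0: "r \<ge> 0" unfolding r_def using w x by (intro sum_nonneg) auto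
  have "ent_term r \<le> (\<Sum>i\<in>I. w i * ent_term (x i)) \<and>
    (ent_term r = (\<Sum>i\<in>I. w i * ent_term (x i)) \<longrightarrow> (\<forall>i\<in>I. w i > 0 \<longrightarrow> x i = r))"
  proof (cases "r = 0")
    \<comment> \<open>At mean zero the tangent is vertical. Instead, every point of positive weight
      is then itself zero.\<close>
    case True
    then have z: "w i * x i = 0" if "i \<in> I" for i
      using sum_nonneg_eq_0_iff[OF fin, of "\<lambda>i. w i * x i"] w x that unfolding r_def by auto
    then have "w i * ent_term (x i) = 0" if "i \<in> I" for i
      using that by fastforce
    then show ?thesis using z True by fastforce
  next
    case False
    then have r: "r > 0" using r0 by simp
    let ?m = "log 2 r + 1 / ln 2"
    let ?d = "\<lambda>i. w i * (ent_term (x i) - ent_term r - (x i - r) * ?m)"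
    have d: "?d i \<ge> 0" if "i \<in> I" for i
      using ent_term_tangent(1)[OF x[OF that] r] w(1)[OF that] by simp
    have "(\<Sum>i\<in>I. w i * (x i - r)) = 0"
      unfolding right_diff_distrib sum_subtractf r_def[symmetric] sum_distrib_right[symmetric] w(2) by simp
    then have "(\<Sum>i\<in>I. w i * ((x i - r) * ?m)) = 0"
      by (simp only: mult.assoc[symmetric] sum_distrib_right[symmetric])
    then have s: "sum ?d I = (\<Sum>i\<in>I. w i * ent_term (x i)) - ent_term r"
      unfolding right_diff_distrib[of "w _"] sum_subtractf sum_distrib_right[symmetric] w(2) by simp
    have eq: "\<forall>i\<in>I. w i > 0 \<longrightarrow> x i = r" if "sum ?d I = 0"
    proof (intro ballI impI)
      fix i assume i: "i \<in> I" "w i > 0"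
      have "?d i = 0" using sum_nonneg_eq_0_iff[OF fin, of ?d, THEN iffD1, OF d that] i(1) by (rule bspec)
      then have "ent_term (x i) - ent_term r - (x i - r) * ?m = 0" using i(2) by (simp only: mult_eq_0_iff) simp
      then show "x i = r" using ent_term_tangent(2)[OF x[OF i(1)] r] by linarith
    qed
    have "sum ?d I \<ge> 0" by (rule sum_nonneg) (rule d)
    then have "ent_term r \<le> (\<Sum>i\<in>I. w i * ent_term (x i))" unfolding s by linarith
    moreover have "\<forall>i\<in>I. w i > 0 \<longrightarrow> x i = r" if "ent_term r = (\<Sum>i\<in>I. w i * ent_term (x i))"
      by (rule eq) (unfold s, use that in linarith)
    ultimately show ?thesis by blast
  qed
  then show "ent_term (\<Sum>i\<in>I. w i * x i) \<le> (\<Sum>i\<in>I. w i * ent_term (x i))"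
    "ent_term (\<Sum>i\<in>I. w i * x i) = (\<Sum>i\<in>I. w i * ent_term (x i)) \<Longrightarrow>
      i \<in> I \<Longrightarrow> w i > 0 \<Longrightarrow> x i = (\<Sum>i\<in>I. w i * x i)"
    unfolding r_def by blast+
qed

section \<open>Monotonicity of the relative entropy under pinching\<close>

lemma mtrace_conj:
  assumes "Z \<in> carrier_mat n n" "\<rho> \<in> carrier_mat n n" "Y \<in> carrier_mat n n"
  shows "mtrace (Z * \<rho> * adj Z * Y) = mtrace (\<rho> * (adj Z * Y * Z))"
proof -
  note assoc = assoc_mult_mat[of _ n n _ n _ n] mult_carrier_square
  have "mtrace (Z * \<rho> * adj Z * Y) = mtrace (Z * (\<rho> * adj Z * Y))" using assms by (simp add: assoc)
  also have "\<dots> = mtrace (\<rho> * adj Z * Y * Z)"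
    using assms by (intro mtrace_mult_commute[of _ n n] mult_carrier_square adj_carrier)
  also have "\<rho> * adj Z * Y * Z = \<rho> * (adj Z * Y * Z)" using assms by (simp add: assoc)
  finally show ?thesis .
qed

text \<open>A unitary conjugation of both states can be moved into \<open>X\<close>, so the supremum
  over \<open>X\<close> does not notice it.\<close>

lemma varf_conj:
  assumes Z: "Z \<in> carrier_mat n n" "adj Z * Z = 1\<^sub>m n" and \<rho>: "\<rho> \<in> carrier_mat n n"
    and \<sigma>: "\<sigma> \<in> carrier_mat n n" and X: "X \<in> carrier_mat n n"
  shows "varf T X (Z * \<rho> * adj Z) (Z * \<sigma> * adj Z) = varf T (adj Z * X * Z) \<rho> \<sigma>"
proof -
  note assoc = assoc_mult_mat[of _ n n _ n _ n] mult_carrier_square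
  have aX: "adj X \<in> carrier_mat n n" and aZ: "adj Z \<in> carrier_mat n n" using X Z by auto
  have cancel: "Z * (adj Z * M) = M" if "M \<in> carrier_mat n n" for M
    using that Z aZ unitary_right_inverse[OF Z] by (simp add: assoc_mult_mat[of _ n n _ n _ n, symmetric])
  have ad: "adj (adj Z * X * Z) = adj Z * adj X * Z"
    using X Z by (simp add: adj_mult[of _ n n _ n] assoc)
  have 1: "(adj Z * X * Z) * adj (adj Z * X * Z) = adj Z * (X * adj X) * Z"
    unfolding ad using X Z aX aZ cancel by (simp add: assoc)
  have 2: "adj (adj Z * X * Z) * (adj Z * X * Z) = adj Z * (adj X * X) * Z"
    unfolding ad using X Z aX aZ cancel by (simp add: assoc)
  show ?thesis
    unfolding varf_def 1 2
    using X aX by (simp add: mtrace_conj[OF Z(1) \<rho>] mtrace_conj[OF Z(1) \<sigma>] mult_carrier_square)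
qed

lemma varf_average:
  assumes "\<rho> \<in> carrier_mat n n" "\<rho>' \<in> carrier_mat n n" "\<sigma> \<in> carrier_mat n n" "\<sigma>' \<in> carrier_mat n n"
    "X \<in> carrier_mat n n"
  shows "varf T X ((1/2) \<cdot>\<^sub>m (\<rho> + \<rho>')) ((1/2) \<cdot>\<^sub>m (\<sigma> + \<sigma>')) = (varf T X \<rho> \<sigma> + varf T X \<rho>' \<sigma>') / 2"
proof -
  have tr: "mtrace (((1/2) \<cdot>\<^sub>m (M + M')) * Y) = (mtrace (M * Y) + mtrace (M' * Y)) / 2"
    if "M \<in> carrier_mat n n" "M' \<in> carrier_mat n n" "Y \<in> carrier_mat n n" for M M' Y
  proof -
    have MM: "M + M' \<in> carrier_mat n n" using that by simp
    have "((1/2) \<cdot>\<^sub>m (M + M')) * Y = (1/2) \<cdot>\<^sub>m (M * Y + M' * Y)"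
      unfolding mult_smult_assoc_mat[OF MM that(3)] add_mult_distrib_mat[OF that] ..
    moreover have "mtrace ((1/2) \<cdot>\<^sub>m (M * Y + M' * Y)) = (mtrace (M * Y) + mtrace (M' * Y)) / 2"
      using that mtrace_smult[of "M * Y + M' * Y" n "1/2"]
      by (simp add: mtrace_add[of _ n] mult_carrier_square)
    ultimately show ?thesis by simp
  qed
  have c: "X * adj X \<in> carrier_mat n n" "adj X * X \<in> carrier_mat n n" using assms by (auto intro!: mult_carrier_square)
  show ?thesis
    unfolding varf_def tr[OF assms(1,2) assms(5)] tr[OF assms(3,4) c(1)] tr[OF assms(1,2) c(2)]
    by (simp add: field_simps)
qed

lemma overlap_sum:
  assumes A: "A \<in> carrier_mat n n" "adj A * A = 1\<^sub>m n" and B: "B \<in> carrier_mat n n" "adj B * B = 1\<^sub>m n"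
    and i: "i < n"
  shows "(\<Sum>j<n. overlap A B i j) = 1"
proof -
  note assoc = assoc_mult_mat[of _ n n _ n _ n] mult_carrier_square
  let ?M = "adj A * B"
  have M: "?M \<in> carrier_mat n n" using A B by (intro mult_carrier_square) auto
  have "?M * adj ?M = adj A * ((B * adj B) * A)"
    using A B by (simp add: adj_mult[of _ n n _ n] assoc)
  then have "?M * adj ?M = 1\<^sub>m n" using A B unitary_right_inverse[OF B] by simp
  then have "1 = (?M * adj ?M) $$ (i, i)" using i by simp
  also have "\<dots> = (\<Sum>j<n. ?M $$ (i, j) * adj ?M $$ (j, i))"
    by (rule mult_mat_index_sum[OF M adj_carrier[OF M] i i])
  also have "\<dots> = (\<Sum>j<n. complex_of_real (overlap A B i j))"
    unfolding overlap_def complex_norm_square using i M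
    by (intro sum.cong refl arg_cong2[of _ _ _ _ "(*)"] adj_index) auto
  finally show ?thesis by (metis of_real_1 of_real_eq_iff of_real_sum)
qed

lemma spectral_trace:
  assumes "spectral n \<rho> A p"
  shows "mtrace \<rho> = complex_of_real (\<Sum>i<n. p i)"
proof -
  note A = spectralD[OF assms]
  have "mtrace \<rho> = mtrace (A * (diagm n p * adj A))"
    unfolding A(4) using A(1) by (simp add: assoc_mult_mat[of _ n n _ n _ n])
  also have "\<dots> = mtrace (diagm n p * adj A * A)"
    using A(1) by (intro mtrace_mult_commute[of _ n n] mult_carrier_square) auto
  also have "diagm n p * adj A * A = diagm n p * (1\<^sub>m n)"
    using A(1,2) by (simp add: assoc_mult_mat[of _ n n _ n _ n])
  finally show ?thesis by (simp add: mtrace_diagm_mult)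
qed

text \<open>An antiderivative in \<open>T\<close> of the supremum described at \<open>varf\<close>.
  With overlaps as weights, its value at \<open>T = 0\<close> is minus the relative entropy.\<close>

definition lnfun :: "nat \<Rightarrow> (nat \<Rightarrow> nat \<Rightarrow> real) \<Rightarrow> (nat \<Rightarrow> real) \<Rightarrow> (nat \<Rightarrow> real) \<Rightarrow> real \<Rightarrow> real" where
  "lnfun n w p s T = (\<Sum>i<n. \<Sum>j<n. w i j * (p i * (ln (s j + T * p i) - ln (p i))))"

lemma lnfun_deriv:
  assumes "T \<ge> 0" "\<And>i. i < n \<Longrightarrow> p i \<ge> 0" "\<And>j. j < n \<Longrightarrow> s j > 0"
  shows "(lnfun n w p s has_real_derivative (\<Sum>i<n. \<Sum>j<n. w i j * (p i)\<^sup>2 / (s j + T * p i))) (at T)"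
proof -
  have "((\<lambda>T. w i j * (p i * (ln (s j + T * p i) - ln (p i)))) has_real_derivative
      w i j * (p i)\<^sup>2 / (s j + T * p i)) (at T)" if "i < n" "j < n" for i j
  proof -
    have "s j + T * p i > 0" using that assms by (intro add_pos_nonneg) auto
    then show ?thesis
      by (auto intro!: derivative_eq_intros simp: power2_eq_square field_simps)
  qed
  then show ?thesis unfolding lnfun_def[abs_def] by (intro DERIV_sum) auto
qed

text \<open>The terms with index \<open>i\<close> together grow like \<open>p i * ln T\<close>,
  whatever \<open>s\<close> and the weights are. The divergence thus depends on the trace only and
  cancels between states of equal trace.\<close>

lemma lnfun_limit:
  assumes p: "\<And>i. i < n \<Longrightarrow> p i \<ge> 0" and s: "\<And>j. j < n \<Longrightarrow> s j > 0"
    and w: "\<And>i. i < n \<Longrightarrow> (\<Sum>j<n. w i j) = 1"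
  shows "((\<lambda>T. lnfun n w p s T - (\<Sum>i<n. p i) * ln T) \<longlongrightarrow> 0) at_top"
proof -
  have lim1: "((\<lambda>T. w i j * (p i * (ln (s j + T * p i) - ln (p i) - ln T))) \<longlongrightarrow> 0) at_top"
    if "i < n" "j < n" for i j
  proof (cases "p i = 0")
    case False
    then have pi: "p i > 0" using p[OF that(1)] by simp
    have "((\<lambda>T. ln (1 + (s j / p i) / T)) \<longlongrightarrow> ln (1 + 0)) at_top"
      by (intro tendsto_intros tendsto_divide_0[OF tendsto_const] filterlim_at_top_imp_at_infinity filterlim_ident) simp
    then have "((\<lambda>T. w i j * (p i * ln (1 + (s j / p i) / T))) \<longlongrightarrow> w i j * (p i * ln (1 + 0))) at_top"
      by (rule tendsto_mult[OF tendsto_const tendsto_mult[OF tendsto_const]])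
    moreover have "eventually (\<lambda>T. w i j * (p i * ln (1 + (s j / p i) / T)) =
        w i j * (p i * (ln (s j + T * p i) - ln (p i) - ln T))) at_top"
      using eventually_gt_at_top[of 0]
    proof eventually_elim
      case (elim T)
      have "s j + T * p i = (1 + (s j / p i) / T) * (p i * T)" using elim pi by (simp add: field_simps)
      moreover have "1 + (s j / p i) / T > 0" using elim pi s[OF that(2)] by (intro add_pos_pos) auto
      ultimately show ?case using elim pi by (simp add: ln_mult)
    qed
    ultimately show ?thesis by (simp add: Lim_transform_eventually)
  qed simp
  have "((\<lambda>T. \<Sum>i<n. \<Sum>j<n. w i j * (p i * (ln (s j + T * p i) - ln (p i) - ln T))) \<longlongrightarrow> (\<Sum>i<n. \<Sum>j<n. 0)) at_top"
    by (intro tendsto_sum lim1) auto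
  moreover have "(\<Sum>i<n. \<Sum>j<n. w i j * (p i * (ln (s j + T * p i) - ln (p i) - ln T))) =
      lnfun n w p s T - (\<Sum>i<n. p i) * ln T" for T
  proof -
    have "(\<Sum>i<n. \<Sum>j<n. w i j * (p i * ln T)) = (\<Sum>i<n. p i) * ln T"
      by (simp add: sum_distrib_right[symmetric] w)
    then show ?thesis
      unfolding lnfun_def by (simp add: right_diff_distrib sum_subtractf)
  qed
  ultimately show ?thesis by simp
qed

definition rel_ent :: "nat \<Rightarrow> complex mat \<Rightarrow> complex mat \<Rightarrow> (nat \<Rightarrow> real) \<Rightarrow> (nat \<Rightarrow> real) \<Rightarrow> real" where
  "rel_ent n A B p s = (\<Sum>i<n. \<Sum>j<n. overlap A B i j * (p i * (ln (p i) - ln (s j))))"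

text \<open>At every \<open>T \<ge> 0\<close> the integrand of the pinched pair is at most that of
  the original pair, so the difference \<open>?G\<close> of antiderivatives is nondecreasing. It
  tends to 0 at infinity because pinching preserves the trace. Hence \<open>?G 0 \<le> 0\<close>,
  which is the claim after a change of sign.\<close>

theorem rel_ent_pinching:
  assumes \<rho>: "spectral n \<rho> A p" and \<sigma>: "spectral n \<sigma> B s"
    and \<rho>': "spectral n \<rho>' A' p'" and \<sigma>': "spectral n \<sigma>' B' s'"
    and p: "\<And>i. i < n \<Longrightarrow> p i \<ge> 0" and s: "\<And>j. j < n \<Longrightarrow> s j > 0"
    and p': "\<And>i. i < n \<Longrightarrow> p' i \<ge> 0" and s': "\<And>j. j < n \<Longrightarrow> s' j > 0"
    and Z: "Z \<in> carrier_mat n n" "adj Z * Z = 1\<^sub>m n"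
    and \<rho>eq: "\<rho>' = (1/2) \<cdot>\<^sub>m (\<rho> + Z * \<rho> * adj Z)" and \<sigma>eq: "\<sigma>' = (1/2) \<cdot>\<^sub>m (\<sigma> + Z * \<sigma> * adj Z)"
  shows "rel_ent n A' B' p' s' \<le> rel_ent n A B p s"
proof -
  note A = spectralD[OF \<rho>] and B = spectralD[OF \<sigma>] and A' = spectralD[OF \<rho>'] and B' = spectralD[OF \<sigma>']
  have c: "Z * \<rho> * adj Z \<in> carrier_mat n n" "Z * \<sigma> * adj Z \<in> carrier_mat n n"
    using Z A(5) B(5) by (auto intro!: mult_carrier_square)
  let ?F = "\<lambda>T. \<Sum>i<n. \<Sum>j<n. overlap A B i j * (p i)\<^sup>2 / (s j + T * p i)"
  let ?F' = "\<lambda>T. \<Sum>i<n. \<Sum>j<n. overlap A' B' i j * (p' i)\<^sup>2 / (s' j + T * p' i)"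
  have F: "?F' T \<le> ?F T" if T: "T \<ge> 0" for T
  proof -
    \<comment> \<open>The \<open>X\<close> that is optimal for the pinched pair is tested on the
      original pair, once as it is and once conjugated by \<open>Z\<close>; neither value exceeds
      the original supremum.\<close>
    obtain X where X: "X \<in> carrier_mat n n" "varf T X \<rho>' \<sigma>' = ?F' T"
      using varf_attained[OF \<rho>' \<sigma>' T p' s'] by blast
    have XZ: "adj Z * X * Z \<in> carrier_mat n n" using Z X by (intro mult_carrier_square adj_carrier)
    have "varf T X \<rho>' \<sigma>' = (varf T X \<rho> \<sigma> + varf T (adj Z * X * Z) \<rho> \<sigma>) / 2"
      unfolding \<rho>eq \<sigma>eq varf_average[OF A(5) c(1) B(5) c(2) X(1)] varf_conj[OF Z A(5) B(5) X(1)] ..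
    also have "\<dots> \<le> (?F T + ?F T) / 2"
      by (intro divide_right_mono add_mono varf_upper[OF \<rho> \<sigma> _ T p s] X XZ) auto
    finally show ?thesis unfolding X(2) by simp
  qed
  let ?G = "\<lambda>T. lnfun n (overlap A B) p s T - lnfun n (overlap A' B') p' s' T"
  have mono: "?G 0 \<le> ?G T" if "T \<ge> 0" for T
  proof (rule DERIV_nonneg_imp_nondecreasing[OF that])
    fix x :: real assume x: "0 \<le> x" "x \<le> T"
    show "\<exists>y. (?G has_real_derivative y) (at x) \<and> 0 \<le> y"
      using lnfun_deriv[OF x(1) p s] lnfun_deriv[OF x(1) p' s'] F[OF x(1)]
      by (intro exI[of _ "?F x - ?F' x"] conjI DERIV_diff) auto
  qed
  have "mtrace \<rho>' = mtrace \<rho>"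
  proof -
    have "mtrace (Z * \<rho> * adj Z) = mtrace (Z * (\<rho> * adj Z))"
      using Z A(5) by (simp add: assoc_mult_mat[of _ n n _ n _ n])
    also have "\<dots> = mtrace (\<rho> * adj Z * Z)"
      using Z A(5) by (intro mtrace_mult_commute[of _ n n] mult_carrier_square adj_carrier)
    also have "\<rho> * adj Z * Z = \<rho>" using Z A(5) by (simp add: assoc_mult_mat[of _ n n _ n _ n])
    finally show ?thesis
      unfolding \<rho>eq using mtrace_smult[of "\<rho> + Z * \<rho> * adj Z" n "1/2"] mtrace_add[OF A(5) c(1)] c(1) A(5)
      by simp
  qed
  then have tr: "(\<Sum>i<n. p' i) = (\<Sum>i<n. p i)"
    unfolding spectral_trace[OF \<rho>] spectral_trace[OF \<rho>'] by (simp only: of_real_eq_iff)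
  have l: "((\<lambda>T. lnfun n (overlap A B) p s T - (\<Sum>i<n. p i) * ln T) \<longlongrightarrow> 0) at_top"
    by (rule lnfun_limit[OF p s overlap_sum[OF A(1,2) B(1,2)]])
  have l': "((\<lambda>T. lnfun n (overlap A' B') p' s' T - (\<Sum>i<n. p' i) * ln T) \<longlongrightarrow> 0) at_top"
    by (rule lnfun_limit[OF p' s' overlap_sum[OF A'(1,2) B'(1,2)]])
  have "(?G \<longlongrightarrow> 0 - 0) at_top"
    using tendsto_diff[OF l l'] unfolding tr by simp
  then have "?G 0 \<le> 0"
    using mono by (intro tendsto_lowerbound[of ?G 0 at_top]) (auto intro: eventually_at_top_linorderI[of 0])
  moreover have "rel_ent n A B p s = - lnfun n (overlap A B) p s 0" for A B p s
    unfolding rel_ent_def lnfun_def sum_negf[symmetric] by (intro sum.cong refl) (simp add: algebra_simps)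
  ultimately show ?thesis by simp
qed

text \<open>The expectation of \<open>\<rho>\<close> in the \<open>j\<close>-th column of
  \<open>B\<close>. It is computed from entries, is linear in \<open>\<rho>\<close> and calls for no
  diagonalisation of \<open>\<rho>\<close>.\<close>

definition qform :: "nat \<Rightarrow> complex mat \<Rightarrow> complex mat \<Rightarrow> nat \<Rightarrow> real" where
  "qform n \<rho> B j = Re (\<Sum>k<n. \<Sum>l<n. cnj (B $$ (k, j)) * \<rho> $$ (k, l) * B $$ (l, j))"

lemma qform_spectral:
  assumes \<rho>: "spectral n \<rho> A p" and B: "B \<in> carrier_mat n n" and j: "j < n"
  shows "qform n \<rho> B j = (\<Sum>i<n. p i * overlap A B i j)"
proof -
  note A = spectralD[OF \<rho>]
  have ov: "complex_of_real (overlap A B i j) =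
      (\<Sum>k<n. \<Sum>l<n. (cnj (B $$ (k, j)) * A $$ (k, i)) * (cnj (A $$ (l, i)) * B $$ (l, j)))" if i: "i < n" for i
  proof -
    have m: "(adj A * B) $$ (i, j) = (\<Sum>l<n. cnj (A $$ (l, i)) * B $$ (l, j))"
      unfolding mult_mat_index_sum[OF adj_carrier[OF A(1)] B i j]
      using A(1) i by (intro sum.cong refl) auto
    show ?thesis
      unfolding overlap_def complex_norm_square m cnj_sum
      by (subst mult.commute) (simp add: sum_product mult_ac)
  qed
  have "(\<Sum>k<n. \<Sum>l<n. cnj (B $$ (k, j)) * \<rho> $$ (k, l) * B $$ (l, j)) =
     (\<Sum>k<n. \<Sum>l<n. \<Sum>i<n. complex_of_real (p i) * ((cnj (B $$ (k, j)) * A $$ (k, i)) * (cnj (A $$ (l, i)) * B $$ (l, j))))"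
    by (intro sum.cong refl) (simp add: spectral_index[OF \<rho>] sum_distrib_left sum_distrib_right mult_ac)
  also have "\<dots> = (\<Sum>k<n. \<Sum>i<n. \<Sum>l<n. complex_of_real (p i) * ((cnj (B $$ (k, j)) * A $$ (k, i)) * (cnj (A $$ (l, i)) * B $$ (l, j))))"
    by (rule sum.cong[OF refl]) (rule sum.swap)
  also have "\<dots> = (\<Sum>i<n. \<Sum>k<n. \<Sum>l<n. complex_of_real (p i) * ((cnj (B $$ (k, j)) * A $$ (k, i)) * (cnj (A $$ (l, i)) * B $$ (l, j))))"
    by (rule sum.swap)
  also have "\<dots> = (\<Sum>i<n. complex_of_real (p i * overlap A B i j))"
    by (intro sum.cong refl) (simp only: of_real_mult ov lessThan_iff sum_distrib_left)
  finally show ?thesis unfolding qform_def by simp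
qed

text \<open>The eigenvectors of \<open>\<rho>\<close> disappear from the cross term, which leaves
  the entropy as the only nonlinear part in \<open>\<rho>\<close>. The factor \<open>ln 2\<close>
  changes the base of the logarithm.\<close>

lemma rel_ent_eq:
  assumes \<rho>: "spectral n \<rho> A p" and \<sigma>: "spectral n \<sigma> B s"
  shows "rel_ent n A B p s = ln 2 * (- vn_entropy \<rho> - (\<Sum>j<n. qform n \<rho> B j * log 2 (s j)))"
proof -
  note A = spectralD[OF \<rho>] and B = spectralD[OF \<sigma>]
  have "rel_ent n A B p s = (\<Sum>i<n. (\<Sum>j<n. overlap A B i j) * (p i * ln (p i)))
      - (\<Sum>i<n. \<Sum>j<n. p i * overlap A B i j * ln (s j))"
    unfolding rel_ent_def by (simp add: right_diff_distrib sum_subtractf sum_distrib_left sum_distrib_right mult_ac)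
  also have "(\<Sum>i<n. (\<Sum>j<n. overlap A B i j) * (p i * ln (p i))) = ln 2 * (- vn_entropy \<rho>)"
    unfolding vn_entropy_spectral[OF \<rho>]
    by (simp add: overlap_sum[OF A(1,2) B(1,2)] ent_term_eq log_def sum_distrib_left)
  also have "(\<Sum>i<n. \<Sum>j<n. p i * overlap A B i j * ln (s j)) = (\<Sum>j<n. qform n \<rho> B j * ln (s j))"
    by (subst sum.swap) (simp add: qform_spectral[OF \<rho> B(1)] sum_distrib_right)
  also have "\<dots> = ln 2 * (\<Sum>j<n. qform n \<rho> B j * log 2 (s j))"
    by (simp add: sum_distrib_left log_def)
  finally show ?thesis by (simp add: right_diff_distrib)
qed

text \<open>The eigenvalues are squared row norms of \<open>adj A * W\<close>. Positivity of Choi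
  states is supplied in this form, with the Kraus operators stored in \<open>W\<close>.\<close>

lemma gram_spectral:
  assumes W: "W \<in> carrier_mat n m" and \<rho>: "\<rho> = W * adj W"
  obtains A p where "spectral n \<rho> A p" "\<And>i. i < n \<Longrightarrow> p i \<ge> 0"
proof -
  have c: "\<rho> \<in> carrier_mat n n" using W \<rho> by auto
  have "adj \<rho> = \<rho>" unfolding \<rho> using W by (simp add: adj_mult[of _ n m _ n])
  from hermitian_spectral[OF c this] obtain A p where sp: "spectral n \<rho> A p"
    unfolding spectral_def by blast
  note A = spectralD[OF sp]
  have "p i \<ge> 0" if i: "i < n" for i
  proof -
    have aA: "adj A \<in> carrier_mat n n" using A by simp
    have "adj A * \<rho> * A = adj A * (A * diagm n p * adj A) * A" using A(4) by simp
    also have "\<dots> = (adj A * A) * diagm n p * (adj A * A)"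
      using A(1) by (simp add: assoc_mult_mat[of _ n n _ n _ n] mult_carrier_square)
    also have "\<dots> = diagm n p"
      unfolding A(2) by (simp add: left_mult_one_mat[OF diagm_carrier] right_mult_one_mat[OF diagm_carrier])
    finally have 1: "adj A * \<rho> * A = diagm n p" .
    let ?M = "adj A * W"
    have M: "?M \<in> carrier_mat n m" using aA W by simp
    have "adj A * \<rho> * A = adj A * (W * (adj W * A))"
      unfolding \<rho> using aA W A(1) by (simp add: assoc_mult_mat[of _ n n _ n _ n] assoc_mult_mat[of _ n m _ n _ n])
    also have "\<dots> = ?M * (adj W * A)"
      using aA W A(1) by (intro assoc_mult_mat[of _ n n _ m _ n, symmetric]) auto
    also have "adj W * A = adj ?M" using A(1) W by (simp add: adj_mult[of _ n n _ m])
    finally have "diagm n p $$ (i, i) = (?M * adj ?M) $$ (i, i)" using 1 by simp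
    also have "\<dots> = (\<Sum>l<m. ?M $$ (i, l) * adj ?M $$ (l, i))"
      by (rule mult_mat_index_sum[OF M adj_carrier[OF M] i i])
    also have "\<dots> = (\<Sum>l<m. complex_of_real ((cmod (?M $$ (i, l)))\<^sup>2))"
      unfolding complex_norm_square using i M
      by (intro sum.cong refl arg_cong2[of _ _ _ _ "(*)"] adj_index) auto
    finally have "p i = (\<Sum>l<m. (cmod (?M $$ (i, l)))\<^sup>2)"
      using i unfolding of_real_sum[symmetric] by (simp add: diagm_def del: of_real_sum)
    then show ?thesis by (simp add: sum_nonneg)
  qed
  with sp show ?thesis by (rule that)
qed

theorem entropy_gain_pinching:
  assumes W: "W \<in> carrier_mat n m" "\<rho> = W * adj W" and W': "W' \<in> carrier_mat n m'" "\<rho>' = W' * adj W'"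
    and \<sigma>: "spectral n \<sigma> B s" and \<sigma>': "spectral n \<sigma>' B' s'"
    and s: "\<And>j. j < n \<Longrightarrow> s j > 0" and s': "\<And>j. j < n \<Longrightarrow> s' j > 0"
    and Z: "Z \<in> carrier_mat n n" "adj Z * Z = 1\<^sub>m n"
    and eq: "\<rho>' = (1/2) \<cdot>\<^sub>m (\<rho> + Z * \<rho> * adj Z)" "\<sigma>' = (1/2) \<cdot>\<^sub>m (\<sigma> + Z * \<sigma> * adj Z)"
  shows "(\<Sum>j<n. qform n \<rho> B j * log 2 (s j)) - (\<Sum>j<n. qform n \<rho>' B' j * log 2 (s' j))
    \<le> vn_entropy \<rho>' - vn_entropy \<rho>"
proof -
  obtain A p where A: "spectral n \<rho> A p" "\<And>i. i < n \<Longrightarrow> p i \<ge> 0" using gram_spectral[OF W] by blast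
  obtain A' p' where A': "spectral n \<rho>' A' p'" "\<And>i. i < n \<Longrightarrow> p' i \<ge> 0" using gram_spectral[OF W'] by blast
  have "rel_ent n A' B' p' s' \<le> rel_ent n A B p s"
    by (rule rel_ent_pinching[OF A(1) \<sigma> A'(1) \<sigma>' A(2) s A'(2) s' Z eq])
  then show ?thesis
    unfolding rel_ent_eq[OF A(1) \<sigma>] rel_ent_eq[OF A'(1) \<sigma>'] by simp
qed

lemma qform_nonneg:
  assumes W: "W \<in> carrier_mat n m" "\<rho> = W * adj W" and B: "B \<in> carrier_mat n n" and j: "j < n"
  shows "qform n \<rho> B j \<ge> 0"
proof -
  obtain A p where A: "spectral n \<rho> A p" "\<And>i. i < n \<Longrightarrow> p i \<ge> 0" using gram_spectral[OF W] by blast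
  show ?thesis
    unfolding qform_spectral[OF A(1) B j] by (intro sum_nonneg mult_nonneg_nonneg A) (auto simp: overlap_def)
qed

text \<open>The diagonal is the image of the spectrum under the doubly stochastic matrix of squared
  moduli of \<open>A\<close>. Row sums permit Jensen's inequality, column sums restore the entropy
  of the spectrum.\<close>

lemma vn_entropy_le_diag:
  assumes W: "W \<in> carrier_mat n m" "\<rho> = W * adj W"
  shows "vn_entropy \<rho> \<le> - (\<Sum>k<n. ent_term (Re (\<rho> $$ (k, k))))"
proof -
  obtain A p where A: "spectral n \<rho> A p" "\<And>i. i < n \<Longrightarrow> p i \<ge> 0" using gram_spectral[OF W] by blast
  note U = spectralD[OF A(1)]
  have row: "(\<Sum>i<n. (cmod (A $$ (k, i)))\<^sup>2) = 1" and col: "(\<Sum>i<n. (cmod (A $$ (i, k)))\<^sup>2) = 1" if k: "k < n" for k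
  proof -
    have "complex_of_real (\<Sum>i<n. (cmod (A $$ (k, i)))\<^sup>2) = (A * adj A) $$ (k, k)"
      unfolding mult_mat_index_sum[OF U(1) adj_carrier[OF U(1)] k k] of_real_sum complex_norm_square
      using U(1) k by (intro sum.cong refl) auto
    then show "(\<Sum>i<n. (cmod (A $$ (k, i)))\<^sup>2) = 1" unfolding U(3) using k by (simp del: of_real_sum)
    have "complex_of_real (\<Sum>i<n. (cmod (A $$ (i, k)))\<^sup>2) = (adj A * A) $$ (k, k)"
      unfolding mult_mat_index_sum[OF adj_carrier[OF U(1)] U(1) k k] of_real_sum complex_norm_square
      using U(1) k by (intro sum.cong refl) auto
    then show "(\<Sum>i<n. (cmod (A $$ (i, k)))\<^sup>2) = 1" unfolding U(2) using k by (simp del: of_real_sum)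
  qed
  have "Re (\<rho> $$ (k, k)) = (\<Sum>i<n. (cmod (A $$ (k, i)))\<^sup>2 * p i)" if k: "k < n" for k
  proof -
    have "\<rho> $$ (k, k) = complex_of_real (\<Sum>i<n. (cmod (A $$ (k, i)))\<^sup>2 * p i)"
      unfolding spectral_index[OF A(1) k k] of_real_sum of_real_mult complex_norm_square
      by (intro sum.cong refl) (simp add: mult_ac)
    then show ?thesis by simp
  qed
  then have "(\<Sum>k<n. ent_term (Re (\<rho> $$ (k, k)))) \<le> (\<Sum>k<n. \<Sum>i<n. (cmod (A $$ (k, i)))\<^sup>2 * ent_term (p i))"
    by (intro sum_mono) (auto intro!: ent_term_jensen(1) row A)
  also have "\<dots> = (\<Sum>i<n. (\<Sum>k<n. (cmod (A $$ (k, i)))\<^sup>2) * ent_term (p i))"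
    by (subst sum.swap) (simp add: sum_distrib_right)
  also have "\<dots> = - vn_entropy \<rho>" unfolding vn_entropy_spectral[OF A(1)] by (simp add: col)
  finally show ?thesis by simp
qed

section \<open>Choi states\<close>

lemma sum_lessThan_4: "(\<Sum>i<(4::nat). f i) = f 0 + f 1 + f 2 + (f 3 :: 'a :: comm_monoid_add)"
  by (simp add: eval_nat_numeral ac_simps)

lemma less_4_cases: "a < (4::nat) \<Longrightarrow> a = 0 \<or> a = 1 \<or> a = 2 \<or> a = 3"
  by auto

lemma pauli_carrier [simp]: "pauli a \<in> carrier_mat 2 2"
  by (auto simp: pauli_def mat_of_rows_list_def)

text \<open>The \<open>a\<close>-th Bloch coordinate of the image of \<open>X\<close>. It is complex
  because \<open>X\<close> also ranges over matrix units, which need not be hermitian; the factor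
  \<i> comes from the trace against \<open>pauli 2\<close>.\<close>

definition stokes_coord :: "real mat \<Rightarrow> real vec \<Rightarrow> complex mat \<Rightarrow> nat \<Rightarrow> complex" where
  "stokes_coord R t X a = complex_of_real (t $ a) * (X $$ (0, 0) + X $$ (1, 1))
     + complex_of_real (R $$ (a, 0)) * (X $$ (0, 0) - X $$ (1, 1))
     + complex_of_real (R $$ (a, 1)) * (X $$ (0, 1) + X $$ (1, 0))
     + complex_of_real (R $$ (a, 2)) * (\<i> * (X $$ (0, 1) - X $$ (1, 0)))"

lemma sum_lessThan_2: "(\<Sum>i<(2::nat). f i) = f 0 + (f 1 :: 'a :: comm_monoid_add)"
  by (simp add: eval_nat_numeral ac_simps)

lemma sum_lessThan_3: "(\<Sum>i<(3::nat). f i) = f 0 + f 1 + (f 2 :: 'a :: comm_monoid_add)"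
  by (simp add: eval_nat_numeral ac_simps)

lemma pauli_index:
  "pauli 0 $$ (0, 0) = 1" "pauli 0 $$ (0, 1) = 0" "pauli 0 $$ (1, 0) = 0" "pauli 0 $$ (1, 1) = -1"
  "pauli 1 $$ (0, 0) = 0" "pauli 1 $$ (0, 1) = 1" "pauli 1 $$ (1, 0) = 1" "pauli 1 $$ (1, 1) = 0"
  "pauli 2 $$ (0, 0) = 0" "pauli 2 $$ (0, 1) = - \<i>" "pauli 2 $$ (1, 0) = \<i>" "pauli 2 $$ (1, 1) = 0"
  by (simp_all add: pauli_def mat_of_rows_list_def)

lemma stokes_map_carrier [simp]: "stokes_map R t X \<in> carrier_mat 2 2"
  using carrier_matD[OF pauli_carrier] by (auto simp: stokes_map_def Let_def)

lemma stokes_map_index: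
  assumes X: "X \<in> carrier_mat 2 2"
  shows "stokes_map R t X $$ (0, 0) = (X $$ (0, 0) + X $$ (1, 1) + stokes_coord R t X 0) / 2"
    "stokes_map R t X $$ (1, 1) = (X $$ (0, 0) + X $$ (1, 1) - stokes_coord R t X 0) / 2"
    "stokes_map R t X $$ (0, 1) = (stokes_coord R t X 1 - \<i> * stokes_coord R t X 2) / 2"
    "stokes_map R t X $$ (1, 0) = (stokes_coord R t X 1 + \<i> * stokes_coord R t X 2) / 2"
proof -
  have T: "mtrace X = X $$ (0, 0) + X $$ (1, 1)" using X by (simp add: mtrace_def sum_lessThan_2)
  have tp: "mtrace (X * pauli 0) = X $$ (0, 0) - X $$ (1, 1)"
    "mtrace (X * pauli 1) = X $$ (0, 1) + X $$ (1, 0)"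
    "mtrace (X * pauli 2) = \<i> * (X $$ (0, 1) - X $$ (1, 0))"
    unfolding mtrace_mult[OF X pauli_carrier] sum_lessThan_2 pauli_index by (simp_all add: algebra_simps)
  have c: "complex_of_real (t $ a) * mtrace X + (\<Sum>b<3. complex_of_real (R $$ (a, b)) * mtrace (X * pauli b))
      = stokes_coord R t X a" for a
    unfolding sum_lessThan_3 tp T stokes_coord_def by simp
  note d = carrier_matD[OF pauli_carrier]
  show "stokes_map R t X $$ (0, 0) = (X $$ (0, 0) + X $$ (1, 1) + stokes_coord R t X 0) / 2"
    "stokes_map R t X $$ (1, 1) = (X $$ (0, 0) + X $$ (1, 1) - stokes_coord R t X 0) / 2"
    "stokes_map R t X $$ (0, 1) = (stokes_coord R t X 1 - \<i> * stokes_coord R t X 2) / 2"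
    "stokes_map R t X $$ (1, 0) = (stokes_coord R t X 1 + \<i> * stokes_coord R t X 2) / 2"
    unfolding stokes_map_def Let_def c unfolding T
    by (simp_all add: d pauli_index[simplified])
qed

definition munit :: "nat \<Rightarrow> nat \<Rightarrow> complex mat" where
  "munit x y = mat 2 2 (\<lambda>(i, j). if i = x \<and> j = y then 1 else 0)"

lemma munit_carrier [simp]: "munit x y \<in> carrier_mat 2 2"
  by (simp add: munit_def)

lemma proj_eq_munit: "proj 0 = munit 0 0" "proj 1 = munit 1 1"
  by (auto simp: proj_def munit_def mat_of_rows_list_def less_2_cases_iff intro!: eq_matI)

lemma sandwich_munit:
  assumes K: "K \<in> carrier_mat 2 2" and L: "L \<in> carrier_mat 2 2" and "i < 2" "j < 2" "x < 2" "y < 2"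
  shows "(K * munit x y * adj L) $$ (i, j) = K $$ (i, x) * cnj (L $$ (j, y))"
proof -
  have KX: "K * munit x y \<in> carrier_mat 2 2" using K by simp
  have row: "(K * munit x y) $$ (i, l) = (if l = y then K $$ (i, x) else 0)" if "l < 2" for l
    unfolding mult_mat_index_sum[OF K munit_carrier \<open>i < 2\<close> that]
    using that assms by (auto simp: munit_def sum_lessThan_2 less_2_cases_iff)
  show ?thesis
    unfolding mult_mat_index_sum[OF KX adj_carrier[OF L] \<open>i < 2\<close> \<open>j < 2\<close>]
    using assms by (auto simp: sum_lessThan_2 row less_2_cases_iff simp del: index_mult_mat(1))
qed

lemma kraus_sum_index:
  assumes "\<forall>K\<in>set Ks. K \<in> carrier_mat 2 2" "X \<in> carrier_mat 2 2"
  shows "kraus_sum Ks X \<in> carrier_mat 2 2"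
    and "i < 2 \<Longrightarrow> j < 2 \<Longrightarrow> kraus_sum Ks X $$ (i, j) = (\<Sum>K\<leftarrow>Ks. (K * X * adj K) $$ (i, j))"
proof -
  have "kraus_sum Ks X \<in> carrier_mat 2 2 \<and>
     (\<forall>i<2. \<forall>j<2. kraus_sum Ks X $$ (i, j) = (\<Sum>K\<leftarrow>Ks. (K * X * adj K) $$ (i, j)))"
    using assms(1)
  proof (induction Ks)
    case Nil
    then show ?case by (simp add: kraus_sum_def)
  next
    case (Cons K Ks)
    have eq: "kraus_sum (K # Ks) X = K * X * adj K + kraus_sum Ks X"
      by (simp add: kraus_sum_def)
    have KX: "K * X * adj K \<in> carrier_mat 2 2"
      using Cons.prems assms(2) by (auto intro!: mult_carrier_square)
    show ?case unfolding eq using Cons KX by (auto simp del: index_mult_mat(1))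
  qed
  then show "kraus_sum Ks X \<in> carrier_mat 2 2"
    "i < 2 \<Longrightarrow> j < 2 \<Longrightarrow> kraus_sum Ks X $$ (i, j) = (\<Sum>K\<leftarrow>Ks. (K * X * adj K) $$ (i, j))" by auto
qed

text \<open>The index \<open>2 * x + i\<close> stands for input \<open>x\<close> and output \<open>i\<close>.\<close>
definition choi :: "real mat \<Rightarrow> real vec \<Rightarrow> complex mat" where
  "choi R t = mat 4 4 (\<lambda>(a, b). stokes_map R t (munit (a div 2) (b div 2)) $$ (a mod 2, b mod 2) / 2)"

definition pinch :: "complex mat \<Rightarrow> complex mat" where
  "pinch A = mat 4 4 (\<lambda>(a, b). if a < 2 \<longleftrightarrow> b < 2 then A $$ (a, b) else 0)"

text \<open>The columns are the vectorised Kraus operators; \<open>1 / sqrt 2\<close> normalises the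
  maximally entangled input, so that the Choi state has trace 1.\<close>

definition kraus_vecs :: "complex mat list \<Rightarrow> complex mat" where
  "kraus_vecs Ks = mat 4 (length Ks) (\<lambda>(a, k). complex_of_real (1 / sqrt 2) * Ks ! k $$ (a mod 2, a div 2))"

text \<open>The rows belonging to the two inputs are moved to disjoint sets of columns. This erases
  the cross terms in \<open>W W\<^sup>\<dagger>\<close>, which is the pinching, while
  \<open>W\<^sup>\<dagger> W\<close> becomes block diagonal like the joint state of X and E.\<close>

definition kraus_blocks :: "complex mat list \<Rightarrow> complex mat" where
  "kraus_blocks Ks = mat 4 (length Ks + length Ks) (\<lambda>(a, k).
     if a < 2 \<and> k < length Ks then kraus_vecs Ks $$ (a, k)
     else if \<not> a < 2 \<and> \<not> k < length Ks then kraus_vecs Ks $$ (a, k - length Ks) else 0)"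

lemma kraus_vecs_carrier [simp]: "kraus_vecs Ks \<in> carrier_mat 4 (length Ks)"
  by (simp add: kraus_vecs_def)

lemma kraus_blocks_carrier [simp]: "kraus_blocks Ks \<in> carrier_mat 4 (length Ks + length Ks)"
  by (simp add: kraus_blocks_def)

lemma inv_sqrt2_mult: "complex_of_real (1 / sqrt 2) * x * (complex_of_real (1 / sqrt 2) * y) = x * y / 2"
proof -
  have "complex_of_real (1 / sqrt 2) * complex_of_real (1 / sqrt 2) = 1 / 2"
    unfolding of_real_mult[symmetric] by (simp add: complex_eq_iff)
  moreover have "complex_of_real (1 / sqrt 2) * x * (complex_of_real (1 / sqrt 2) * y) =
      (complex_of_real (1 / sqrt 2) * complex_of_real (1 / sqrt 2)) * (x * y)" by (simp only: mult_ac)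
  ultimately show ?thesis by simp
qed

lemma kraus_vecs_gram:
  assumes "is_kraus R t Ks"
  shows "choi R t = kraus_vecs Ks * adj (kraus_vecs Ks)"
proof (rule eq_matI)
  let ?W = "kraus_vecs Ks"
  fix a b assume "a < dim_row (?W * adj ?W)" "b < dim_col (?W * adj ?W)"
  then have ab: "a < 4" "b < 4" by (auto simp: kraus_vecs_def)
  have m: "a mod 2 < 2" "b mod 2 < 2" "a div 2 < 2" "b div 2 < 2" using ab by auto
  have Ks: "\<forall>K\<in>set Ks. K \<in> carrier_mat 2 2" using assms by (simp add: is_kraus_def)
  have "choi R t $$ (a, b) = kraus_sum Ks (munit (a div 2) (b div 2)) $$ (a mod 2, b mod 2) / 2"
    using assms ab by (simp add: choi_def is_kraus_def)
  also have "kraus_sum Ks (munit (a div 2) (b div 2)) $$ (a mod 2, b mod 2) =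
      (\<Sum>K\<leftarrow>Ks. (K * munit (a div 2) (b div 2) * adj K) $$ (a mod 2, b mod 2))"
    using m by (intro kraus_sum_index(2)[OF Ks munit_carrier])
  also have "\<dots> = (\<Sum>K\<leftarrow>Ks. K $$ (a mod 2, a div 2) * cnj (K $$ (b mod 2, b div 2)))"
    using Ks m by (intro arg_cong[of _ _ sum_list] map_cong refl) (simp add: sandwich_munit del: index_mult_mat(1))
  also have "\<dots> = (\<Sum>k<length Ks. Ks ! k $$ (a mod 2, a div 2) * cnj (Ks ! k $$ (b mod 2, b div 2)))"
    by (simp add: sum_list_sum_nth atLeast0LessThan)
  also have "\<dots> / 2 = (\<Sum>k<length Ks. ?W $$ (a, k) * adj ?W $$ (k, b))"
    unfolding sum_divide_distrib
  proof (intro sum.cong refl)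
    fix k assume "k \<in> {..<length Ks}"
    then have "adj ?W $$ (k, b) = complex_of_real (1 / sqrt 2) * cnj (Ks ! k $$ (b mod 2, b div 2))"
      "?W $$ (a, k) = complex_of_real (1 / sqrt 2) * Ks ! k $$ (a mod 2, a div 2)"
      using ab by (simp_all add: kraus_vecs_def)
    then show "Ks ! k $$ (a mod 2, a div 2) * cnj (Ks ! k $$ (b mod 2, b div 2)) / 2 = ?W $$ (a, k) * adj ?W $$ (k, b)"
      by (simp only: inv_sqrt2_mult)
  qed
  also have "\<dots> = (?W * adj ?W) $$ (a, b)"
    using ab by (simp only: mult_mat_index_sum[OF kraus_vecs_carrier adj_carrier[OF kraus_vecs_carrier]])
  finally show "choi R t $$ (a, b) = (?W * adj ?W) $$ (a, b)" .
qed (auto simp: choi_def kraus_vecs_def)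

lemma sum_lessThan_add: "(\<Sum>k<n + m. f k) = (\<Sum>k<n. f k) + (\<Sum>k<m. f (k + n))"
  for n m :: nat and f :: "nat \<Rightarrow> 'a :: comm_monoid_add"
  by (induction m) (simp_all add: ac_simps)

lemma kraus_blocks_gram:
  "pinch (kraus_vecs Ks * adj (kraus_vecs Ks)) = kraus_blocks Ks * adj (kraus_blocks Ks)"
proof (rule eq_matI)
  let ?W = "kraus_vecs Ks" and ?V = "kraus_blocks Ks" and ?n = "length Ks"
  fix a b assume "a < dim_row (?V * adj ?V)" "b < dim_col (?V * adj ?V)"
  then have ab: "a < 4" "b < 4" by (auto simp: kraus_blocks_def)
  have "(?V * adj ?V) $$ (a, b) = (\<Sum>k<?n + ?n. ?V $$ (a, k) * adj ?V $$ (k, b))"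
    using ab by (simp only: mult_mat_index_sum[OF kraus_blocks_carrier adj_carrier[OF kraus_blocks_carrier]])
  also have "\<dots> = (\<Sum>k<?n. ?V $$ (a, k) * adj ?V $$ (k, b)) + (\<Sum>k<?n. ?V $$ (a, k + ?n) * adj ?V $$ (k + ?n, b))"
    by (rule sum_lessThan_add)
  also have "(\<Sum>k<?n. ?V $$ (a, k) * adj ?V $$ (k, b)) =
      (if a < 2 \<and> b < 2 then \<Sum>k<?n. ?W $$ (a, k) * adj ?W $$ (k, b) else 0)"
    using ab by (auto intro!: sum.cong sum.neutral simp: kraus_blocks_def kraus_vecs_def)
  also have "(\<Sum>k<?n. ?V $$ (a, k + ?n) * adj ?V $$ (k + ?n, b)) =
      (if \<not> a < 2 \<and> \<not> b < 2 then \<Sum>k<?n. ?W $$ (a, k) * adj ?W $$ (k, b) else 0)"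
    using ab by (auto intro!: sum.cong sum.neutral simp: kraus_blocks_def kraus_vecs_def)
  also have "(\<Sum>k<?n. ?W $$ (a, k) * adj ?W $$ (k, b)) = (?W * adj ?W) $$ (a, b)"
    using ab by (simp only: mult_mat_index_sum[OF kraus_vecs_carrier adj_carrier[OF kraus_vecs_carrier]])
  finally show "pinch (?W * adj ?W) $$ (a, b) = (?V * adj ?V) $$ (a, b)"
    using ab by (auto simp: pinch_def simp del: index_mult_mat(1))
qed (auto simp: pinch_def kraus_blocks_def)

lemma vn_entropy_transpose:
  assumes "A \<in> carrier_mat n n"
  shows "vn_entropy (transpose_mat A) = vn_entropy A"
  using assms by (simp add: vn_entropy_def eigs_def char_poly_transpose_mat[OF assms])

lemma mtrace_sandwich_munit:
  assumes K: "K \<in> carrier_mat 2 2" and L: "L \<in> carrier_mat 2 2" and x: "x < 2"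
  shows "mtrace (K * munit x x * adj L) = (\<Sum>i<2. K $$ (i, x) * cnj (L $$ (i, x)))"
proof -
  have "dim_row (K * munit x x * adj L) = 2" using K by simp
  then show ?thesis
    unfolding mtrace_def using x by (simp add: sandwich_munit[OF K L] del: index_mult_mat(1))
qed

lemma comp_chan_index:
  assumes Ks: "\<forall>K\<in>set Ks. K \<in> carrier_mat 2 2" and kl: "k < length Ks" "l < length Ks" and x: "x < 2"
  shows "comp_chan Ks (munit x x) $$ (k, l) = (\<Sum>i<2. Ks ! k $$ (i, x) * cnj (Ks ! l $$ (i, x)))"
  using Ks kl by (simp add: comp_chan_def mtrace_sandwich_munit[OF _ _ x])

text \<open>The transpose appears because \<open>comp_chan\<close> conjugates the operator of its
  second index, whereas \<open>adj W * W\<close> conjugates that of the first.\<close>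

lemma env_state_gram:
  assumes Ks: "\<forall>K\<in>set Ks. K \<in> carrier_mat 2 2"
  shows "(1/2) \<cdot>\<^sub>m (comp_chan Ks (munit 0 0) + comp_chan Ks (munit 1 1)) = transpose_mat (adj (kraus_vecs Ks) * kraus_vecs Ks)"
    (is "?L = transpose_mat (adj ?W * ?W)")
proof (rule eq_matI)
  fix k l assume "k < dim_row (transpose_mat (adj ?W * ?W))" "l < dim_col (transpose_mat (adj ?W * ?W))"
  then have kl: "k < length Ks" "l < length Ks" by (auto simp: kraus_vecs_def)
  have cc: "comp_chan Ks X \<in> carrier_mat (length Ks) (length Ks)" for X by (simp add: comp_chan_def)
  have "transpose_mat (adj ?W * ?W) $$ (k, l) = (adj ?W * ?W) $$ (l, k)"
    using kl by (intro index_transpose_mat) (auto simp: kraus_vecs_def)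
  also have "\<dots> = (\<Sum>a<4. adj ?W $$ (l, a) * ?W $$ (a, k))"
    using kl by (simp only: mult_mat_index_sum[OF adj_carrier[OF kraus_vecs_carrier] kraus_vecs_carrier])
  also have "\<dots> = (\<Sum>a<4. Ks ! k $$ (a mod 2, a div 2) * cnj (Ks ! l $$ (a mod 2, a div 2)) / 2)"
  proof (intro sum.cong refl)
    fix a assume "a \<in> {..<4::nat}"
    then have "adj ?W $$ (l, a) = complex_of_real (1 / sqrt 2) * cnj (Ks ! l $$ (a mod 2, a div 2))"
      "?W $$ (a, k) = complex_of_real (1 / sqrt 2) * Ks ! k $$ (a mod 2, a div 2)"
      using kl by (simp_all add: kraus_vecs_def)
    then show "adj ?W $$ (l, a) * ?W $$ (a, k) = Ks ! k $$ (a mod 2, a div 2) * cnj (Ks ! l $$ (a mod 2, a div 2)) / 2"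
      by (simp only: inv_sqrt2_mult mult.commute)
  qed
  also have "\<dots> = ?L $$ (k, l)"
    using kl cc[THEN carrier_matD(1)] cc[THEN carrier_matD(2)]
    by (simp add: comp_chan_index[OF Ks kl] sum_lessThan_4 sum_lessThan_2 field_simps)
  finally show "?L $$ (k, l) = transpose_mat (adj ?W * ?W) $$ (k, l)" ..
qed (auto simp: comp_chan_def kraus_vecs_def)

lemma env_blocks_gram:
  assumes Ks: "\<forall>K\<in>set Ks. K \<in> carrier_mat 2 2"
  defines "n \<equiv> length Ks"
  shows "(1/2) \<cdot>\<^sub>m four_block_mat (comp_chan Ks (munit 0 0)) (0\<^sub>m n n) (0\<^sub>m n n) (comp_chan Ks (munit 1 1))
    = transpose_mat (adj (kraus_blocks Ks) * kraus_blocks Ks)"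
    (is "?L = transpose_mat (adj ?V * ?V)")
proof (rule eq_matI)
  let ?W = "kraus_vecs Ks"
  fix k l assume "k < dim_row (transpose_mat (adj ?V * ?V))" "l < dim_col (transpose_mat (adj ?V * ?V))"
  then have kl: "k < n + n" "l < n + n" by (auto simp: kraus_blocks_def n_def)
  have cc: "comp_chan Ks X \<in> carrier_mat n n" for X by (simp add: comp_chan_def n_def)
  note ccd = carrier_matD[OF cc]
  have VV: "cnj (?W $$ (a, l)) * ?W $$ (a, k) = Ks ! k $$ (a mod 2, a div 2) * cnj (Ks ! l $$ (a mod 2, a div 2)) / 2"
    if "a < 4" "k < n" "l < n" for a k l
  proof -
    have "cnj (?W $$ (a, l)) = complex_of_real (1 / sqrt 2) * cnj (Ks ! l $$ (a mod 2, a div 2))"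
      "?W $$ (a, k) = complex_of_real (1 / sqrt 2) * Ks ! k $$ (a mod 2, a div 2)"
      using that by (simp_all add: kraus_vecs_def n_def)
    then show ?thesis by (simp only: inv_sqrt2_mult mult.commute)
  qed
  have "transpose_mat (adj ?V * ?V) $$ (k, l) = (adj ?V * ?V) $$ (l, k)"
    using kl by (intro index_transpose_mat) (auto simp: kraus_blocks_def n_def)
  also have "\<dots> = (\<Sum>a<4. adj ?V $$ (l, a) * ?V $$ (a, k))"
    using kl unfolding n_def by (simp only: mult_mat_index_sum[OF adj_carrier[OF kraus_blocks_carrier] kraus_blocks_carrier])
  also have "\<dots> = (\<Sum>a<4. cnj (?V $$ (a, l)) * ?V $$ (a, k))"
    using kl by (intro sum.cong refl arg_cong2[of _ _ _ _ "(*)"] adj_index) (auto simp: kraus_blocks_def n_def)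
  also have "\<dots> = ?L $$ (k, l)"
  proof -
    have V: "?V $$ (a, k) = (if a < 2 \<and> k < n then ?W $$ (a, k) else if \<not> a < 2 \<and> \<not> k < n then ?W $$ (a, k - n) else 0)"
      if "a < 4" "k < n + n" for a k
      using that by (simp add: kraus_blocks_def n_def)
    have L: "?L $$ (k, l) = (1/2) * four_block_mat (comp_chan Ks (munit 0 0)) (0\<^sub>m n n) (0\<^sub>m n n) (comp_chan Ks (munit 1 1)) $$ (k, l)"
      using kl ccd by (intro index_smult_mat) auto
    have F: "four_block_mat (comp_chan Ks (munit 0 0)) (0\<^sub>m n n) (0\<^sub>m n n) (comp_chan Ks (munit 1 1)) $$ (k, l) =
      (if k < n then if l < n then comp_chan Ks (munit 0 0) $$ (k, l) else 0
       else if l < n then 0 else comp_chan Ks (munit 1 1) $$ (k - n, l - n))"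
      using kl ccd by simp
    have kn: "k - n < length Ks" "l - n < length Ks" if "\<not> k < n" "\<not> l < n"
      using that kl unfolding n_def by auto
    show ?thesis
      unfolding L F sum_lessThan_4
      using kl kn VV[of 0 k l] VV[of 1 k l] VV[of 2 "k - n" "l - n"] VV[of 3 "k - n" "l - n"]
      by (auto simp: V comp_chan_index[OF Ks] sum_lessThan_2 n_def[symmetric] field_simps)
  qed
  finally show "?L $$ (k, l) = transpose_mat (adj ?V * ?V) $$ (k, l)" ..
qed (auto simp: comp_chan_def kraus_blocks_def n_def)

theorem H_XE_eq:
  assumes "qubit_channel R t"
  shows "H_XE R t = vn_entropy (pinch (choi R t)) - vn_entropy (choi R t)"
proof -
  define Ks where "Ks = kraus_of R t"
  have k: "is_kraus R t Ks"
    unfolding Ks_def kraus_of_def using assms unfolding qubit_channel_def by (metis someI_ex)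
  then have Ks: "\<forall>K\<in>set Ks. K \<in> carrier_mat 2 2" by (simp add: is_kraus_def)
  let ?W = "kraus_vecs Ks" and ?V = "kraus_blocks Ks"
  have "H_XE R t = vn_entropy (transpose_mat (adj ?V * ?V)) - vn_entropy (transpose_mat (adj ?W * ?W))"
    unfolding H_XE_def Let_def Ks_def[symmetric] proj_eq_munit env_state_gram[OF Ks] env_blocks_gram[OF Ks] ..
  also have "vn_entropy (transpose_mat (adj ?V * ?V)) = vn_entropy (adj ?V * ?V)"
    by (rule vn_entropy_transpose[OF mult_carrier_mat[OF adj_carrier[OF kraus_blocks_carrier] kraus_blocks_carrier]])
  also have "\<dots> = vn_entropy (?V * adj ?V)"
    by (rule vn_entropy_mult_commute[OF adj_carrier[OF kraus_blocks_carrier] kraus_blocks_carrier])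
  also have "vn_entropy (transpose_mat (adj ?W * ?W)) = vn_entropy (adj ?W * ?W)"
    by (rule vn_entropy_transpose[OF mult_carrier_mat[OF adj_carrier[OF kraus_vecs_carrier] kraus_vecs_carrier]])
  also have "\<dots> = vn_entropy (?W * adj ?W)"
    by (rule vn_entropy_mult_commute[OF adj_carrier[OF kraus_vecs_carrier] kraus_vecs_carrier])
  finally show ?thesis
    unfolding kraus_blocks_gram[symmetric] kraus_vecs_gram[OF k, symmetric] .
qed

lemma stokes_map_linear:
  assumes X: "X \<in> carrier_mat 2 2" and "i < 2" "j < 2"
  shows "stokes_map R t X $$ (i, j) = (\<Sum>x<2. \<Sum>y<2. X $$ (x, y) * stokes_map R t (munit x y) $$ (i, j))"
proof -
  have "i = 0 \<or> i = 1" "j = 0 \<or> j = 1" using assms by auto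
  then show ?thesis
    unfolding sum_lessThan_2
    by (elim disjE; hypsubst; unfold stokes_map_index[OF X] stokes_map_index[OF munit_carrier] stokes_coord_def)
       (simp_all add: munit_def field_simps)
qed

text \<open>The converse of \<open>kraus_vecs_gram\<close>, in the spirit of Choi's theorem. It
  shows that the extremal maps constructed from a spectrum are completely positive.\<close>

lemma qubit_channel_if_spectral:
  assumes R: "R \<in> carrier_mat 3 3" and t: "t \<in> carrier_vec 3"
    and sp: "spectral 4 (choi R t) B q" and q: "\<And>l. l < 4 \<Longrightarrow> q l \<ge> 0"
  shows "qubit_channel R t"
proof -
  \<comment> \<open>Each eigenvector is reshaped into a Kraus operator; the factor 2 under the root
    undoes the normalisation of the Choi state.\<close>
  define K where "K l = mat 2 2 (\<lambda>(i, x). complex_of_real (sqrt (2 * q l)) * B $$ (2 * x + i, l))" for l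
  define Ks where "Ks = map K [0..<4]"
  have K: "K l \<in> carrier_mat 2 2" for l by (simp add: K_def)
  have Ks: "\<forall>L\<in>set Ks. L \<in> carrier_mat 2 2" using K by (auto simp: Ks_def)
  have F: "stokes_map R t (munit x y) $$ (i, j) = (\<Sum>l<4. K l $$ (i, x) * cnj (K l $$ (j, y)))"
    if "i < 2" "j < 2" "x < 2" "y < 2" for i j x y
  proof -
    have lt: "2 * x + i < 4" "2 * y + j < 4" using that by auto
    have "stokes_map R t (munit x y) $$ (i, j) = 2 * choi R t $$ (2 * x + i, 2 * y + j)"
      using that lt by (simp add: choi_def)
    also have "\<dots> = (\<Sum>l<4. complex_of_real (2 * q l) * (B $$ (2 * x + i, l) * cnj (B $$ (2 * y + j, l))))"
      unfolding spectral_index[OF sp lt] by (simp add: sum_distrib_left mult_ac)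
    also have "\<dots> = (\<Sum>l<4. K l $$ (i, x) * cnj (K l $$ (j, y)))"
    proof (intro sum.cong refl)
      fix l assume "l \<in> {..<4::nat}"
      then have "complex_of_real (2 * q l) = complex_of_real (sqrt (2 * q l)) * complex_of_real (sqrt (2 * q l))"
        unfolding of_real_mult[symmetric] using q[of l] by simp
      then show "complex_of_real (2 * q l) * (B $$ (2 * x + i, l) * cnj (B $$ (2 * y + j, l))) =
          K l $$ (i, x) * cnj (K l $$ (j, y))"
        using that unfolding K_def by (simp add: mult_ac)
    qed
    finally show ?thesis .
  qed
  have "stokes_map R t X = kraus_sum Ks X" if X: "X \<in> carrier_mat 2 2" for X
  proof (rule eq_matI)
    fix i j assume "i < dim_row (kraus_sum Ks X)" "j < dim_col (kraus_sum Ks X)"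
    then have ij: "i < 2" "j < 2" using kraus_sum_index(1)[OF Ks X] by auto
    have sand: "(K l * X * adj (K l)) $$ (i, j) = (\<Sum>x<2. \<Sum>y<2. X $$ (x, y) * (K l $$ (i, x) * cnj (K l $$ (j, y))))" for l
    proof -
      have "(K l * X * adj (K l)) $$ (i, j) = (\<Sum>y<2. (\<Sum>x<2. K l $$ (i, x) * X $$ (x, y)) * adj (K l) $$ (y, j))"
        unfolding mult_mat_index_sum[OF mult_carrier_square[OF K X] adj_carrier[OF K] ij]
        using ij by (simp add: mult_mat_index_sum[OF K X] del: index_mult_mat(1))
      also have "\<dots> = (\<Sum>x<2. \<Sum>y<2. X $$ (x, y) * (K l $$ (i, x) * cnj (K l $$ (j, y))))"
        using ij K[of l] by (simp add: sum_lessThan_2 algebra_simps)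
      finally show ?thesis .
    qed
    have "kraus_sum Ks X $$ (i, j) = (\<Sum>l<4. (K l * X * adj (K l)) $$ (i, j))"
      unfolding kraus_sum_index(2)[OF Ks X ij] unfolding Ks_def
      by (simp add: interv_sum_list_conv_sum_set_nat atLeast0LessThan o_def del: index_mult_mat(1) upt_rec_numeral)
    also have "\<dots> = (\<Sum>x<2. \<Sum>y<2. X $$ (x, y) * (\<Sum>l<4. K l $$ (i, x) * cnj (K l $$ (j, y))))"
      unfolding sand sum_lessThan_2 sum_lessThan_4 by (simp add: algebra_simps)
    also have "\<dots> = stokes_map R t X $$ (i, j)"
      unfolding stokes_map_linear[OF X ij] using ij by (simp add: F)
    finally show "stokes_map R t X $$ (i, j) = kraus_sum Ks X $$ (i, j)" ..
  qed (use kraus_sum_index(1)[OF Ks X] carrier_matD[OF stokes_map_carrier] in auto)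
  then show ?thesis
    unfolding qubit_channel_def is_kraus_def using R t Ks by blast
qed

lemma choi_carrier [simp]: "choi R t \<in> carrier_mat 4 4"
  by (simp add: choi_def)

lemma choi_index:
  "choi R t $$ (0, 0) = (1 + t $ 0 + R $$ (0, 0)) / 4"
  "choi R t $$ (1, 1) = (1 - t $ 0 - R $$ (0, 0)) / 4"
  "choi R t $$ (2, 2) = (1 + t $ 0 - R $$ (0, 0)) / 4"
  "choi R t $$ (3, 3) = (1 - t $ 0 + R $$ (0, 0)) / 4"
  "choi R t $$ (0, 1) = (t $ 1 + R $$ (1, 0) - \<i> * (t $ 2 + R $$ (2, 0))) / 4"
  "choi R t $$ (1, 0) = (t $ 1 + R $$ (1, 0) + \<i> * (t $ 2 + R $$ (2, 0))) / 4"
  "choi R t $$ (2, 3) = (t $ 1 - R $$ (1, 0) - \<i> * (t $ 2 - R $$ (2, 0))) / 4"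
  "choi R t $$ (3, 2) = (t $ 1 - R $$ (1, 0) + \<i> * (t $ 2 - R $$ (2, 0))) / 4"
  "choi R t $$ (0, 2) = (R $$ (0, 1) + \<i> * R $$ (0, 2)) / 4"
  "choi R t $$ (2, 0) = (R $$ (0, 1) - \<i> * R $$ (0, 2)) / 4"
  "choi R t $$ (1, 3) = - (R $$ (0, 1) + \<i> * R $$ (0, 2)) / 4"
  "choi R t $$ (3, 1) = - (R $$ (0, 1) - \<i> * R $$ (0, 2)) / 4"
  "choi R t $$ (0, 3) = (R $$ (1, 1) + R $$ (2, 2) + \<i> * (R $$ (1, 2) - R $$ (2, 1))) / 4"
  "choi R t $$ (3, 0) = (R $$ (1, 1) + R $$ (2, 2) - \<i> * (R $$ (1, 2) - R $$ (2, 1))) / 4"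
  "choi R t $$ (1, 2) = (R $$ (1, 1) - R $$ (2, 2) + \<i> * (R $$ (1, 2) + R $$ (2, 1))) / 4"
  "choi R t $$ (2, 1) = (R $$ (1, 1) - R $$ (2, 2) - \<i> * (R $$ (1, 2) + R $$ (2, 1))) / 4"
proof -
  have d: "(3::nat) mod 2 = 1" "(3::nat) div 2 = 1" "(2::nat) mod 2 = 0" "(2::nat) div 2 = 1"
    "(1::nat) mod 2 = 1" "(1::nat) div 2 = 0" "(0::nat) mod 2 = 0" "(0::nat) div 2 = 0" by auto
  have e: "choi R t $$ (a, b) = stokes_map R t (munit (a div 2) (b div 2)) $$ (a mod 2, b mod 2) / 2"
    if "a < 4" "b < 4" for a b using that by (simp add: choi_def)
  have l: "(0::nat) < 4" "(1::nat) < 4" "(2::nat) < 4" "(3::nat) < 4" by auto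
  show "choi R t $$ (0, 0) = (1 + t $ 0 + R $$ (0, 0)) / 4"
    "choi R t $$ (1, 1) = (1 - t $ 0 - R $$ (0, 0)) / 4"
    "choi R t $$ (2, 2) = (1 + t $ 0 - R $$ (0, 0)) / 4"
    "choi R t $$ (3, 3) = (1 - t $ 0 + R $$ (0, 0)) / 4"
    "choi R t $$ (0, 1) = (t $ 1 + R $$ (1, 0) - \<i> * (t $ 2 + R $$ (2, 0))) / 4"
    "choi R t $$ (1, 0) = (t $ 1 + R $$ (1, 0) + \<i> * (t $ 2 + R $$ (2, 0))) / 4"
    "choi R t $$ (2, 3) = (t $ 1 - R $$ (1, 0) - \<i> * (t $ 2 - R $$ (2, 0))) / 4"
    "choi R t $$ (3, 2) = (t $ 1 - R $$ (1, 0) + \<i> * (t $ 2 - R $$ (2, 0))) / 4"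
    "choi R t $$ (0, 2) = (R $$ (0, 1) + \<i> * R $$ (0, 2)) / 4"
    "choi R t $$ (2, 0) = (R $$ (0, 1) - \<i> * R $$ (0, 2)) / 4"
    "choi R t $$ (1, 3) = - (R $$ (0, 1) + \<i> * R $$ (0, 2)) / 4"
    "choi R t $$ (3, 1) = - (R $$ (0, 1) - \<i> * R $$ (0, 2)) / 4"
    "choi R t $$ (0, 3) = (R $$ (1, 1) + R $$ (2, 2) + \<i> * (R $$ (1, 2) - R $$ (2, 1))) / 4"
    "choi R t $$ (3, 0) = (R $$ (1, 1) + R $$ (2, 2) - \<i> * (R $$ (1, 2) - R $$ (2, 1))) / 4"
    "choi R t $$ (1, 2) = (R $$ (1, 1) - R $$ (2, 2) + \<i> * (R $$ (1, 2) + R $$ (2, 1))) / 4"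
    "choi R t $$ (2, 1) = (R $$ (1, 1) - R $$ (2, 2) - \<i> * (R $$ (1, 2) + R $$ (2, 1))) / 4"
    by (simp_all only: e l d stokes_map_index[OF munit_carrier] stokes_coord_def)
       (simp_all add: munit_def complex_eq_iff field_simps)
qed

section \<open>Rotated Pauli channels\<close>

text \<open>The columns are the vectorised real matrices \<open>r(\<phi>/2)\<close>, \<open>r(\<phi>/2) \<i>\<sigma>\<^sub>y\<close>, \<open>r(\<psi>/2) \<sigma>\<^sub>z\<close>, \<open>r(\<psi>/2) \<sigma>\<^sub>x\<close>,
  where \<open>(c, s)\<close> and \<open>(C, S)\<close> are the cosine and sine of \<open>\<phi>/2\<close> and \<open>\<psi>/2\<close>.\<close>
definition bell_entry :: "real \<Rightarrow> real \<Rightarrow> real \<Rightarrow> real \<Rightarrow> nat \<Rightarrow> nat \<Rightarrow> real" where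
  "bell_entry c s C S k l = [[c, s, C, -S], [s, -c, S, C], [-s, c, S, C], [c, s, -C, S]] ! k ! l"

definition bell_mat :: "real \<Rightarrow> real \<Rightarrow> real \<Rightarrow> real \<Rightarrow> complex mat" where
  "bell_mat c s C S = mat 4 4 (\<lambda>(k, l). complex_of_real (1 / sqrt 2) * complex_of_real (bell_entry c s C S k l))"

text \<open>The \<open>y\<close>-entry \<open>dz dx\<close> makes the \<open>z\<close>- and \<open>x\<close>-flips of the rotated Pauli channel independent, which
  maximises the entropy of its Choi state.\<close>
definition rot_pauli :: "real \<Rightarrow> real \<Rightarrow> real \<Rightarrow> real \<Rightarrow> real \<Rightarrow> real \<Rightarrow> real mat" where
  "rot_pauli c s C S dz dx = mat 3 3 (\<lambda>(i, j).
     [[(dz + dx) / 2 * (c\<^sup>2 - s\<^sup>2) + (dz - dx) / 2 * (C\<^sup>2 - S\<^sup>2), (dz - dx) * (C * S) - (dz + dx) * (c * s), 0],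
      [(dz - dx) * (C * S) + (dz + dx) * (c * s), (dz + dx) / 2 * (c\<^sup>2 - s\<^sup>2) - (dz - dx) / 2 * (C\<^sup>2 - S\<^sup>2), 0],
      [0, 0, dz * dx]] ! i ! j)"

text \<open>The order follows the Bell columns: no error, \<open>\<sigma>\<^sub>y\<close>,
  \<open>\<sigma>\<^sub>z\<close>, \<open>\<sigma>\<^sub>x\<close>. A
  \<open>\<sigma>\<^sub>x\<close> error flips z, a \<open>\<sigma>\<^sub>z\<close> error flips x,
  and \<open>\<sigma>\<^sub>y\<close> flips both.\<close>

definition pauli_prob :: "real \<Rightarrow> real \<Rightarrow> nat \<Rightarrow> real" where
  "pauli_prob dz dx l = [(1 + dz) / 2 * ((1 + dx) / 2), (1 - dz) / 2 * ((1 - dx) / 2),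
     (1 + dz) / 2 * ((1 - dx) / 2), (1 - dz) / 2 * ((1 + dx) / 2)] ! l"

lemma bell_mat_carrier [simp]: "bell_mat c s C S \<in> carrier_mat 4 4"
  by (simp add: bell_mat_def)

lemma bell_mat_index:
  "k < 4 \<Longrightarrow> l < 4 \<Longrightarrow> bell_mat c s C S $$ (k, l) = complex_of_real (1 / sqrt 2) * complex_of_real (bell_entry c s C S k l)"
  by (simp add: bell_mat_def)

lemma bell_mat_mult:
  assumes "k < 4" "l < 4" "i < 4" "j < 4"
  shows "bell_mat c s C S $$ (k, l) * cnj (bell_mat c s C S $$ (i, j)) =
    complex_of_real (bell_entry c s C S k l * bell_entry c s C S i j / 2)"
    "cnj (bell_mat c s C S $$ (k, l)) * bell_mat c s C S $$ (i, j) =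
    complex_of_real (bell_entry c s C S k l * bell_entry c s C S i j / 2)"
  using assms inv_sqrt2_mult[of "complex_of_real (bell_entry c s C S k l)" "complex_of_real (bell_entry c s C S i j)"]
  by (simp_all only: bell_mat_index complex_cnj_mult complex_cnj_divide complex_cnj_complex_of_real of_real_mult of_real_divide of_real_numeral)

lemma bell_entry_simps:
  "bell_entry c s C S 0 0 = c" "bell_entry c s C S 0 1 = s" "bell_entry c s C S 0 2 = C" "bell_entry c s C S 0 3 = -S"
  "bell_entry c s C S 1 0 = s" "bell_entry c s C S 1 1 = -c" "bell_entry c s C S 1 2 = S" "bell_entry c s C S 1 3 = C"
  "bell_entry c s C S 2 0 = -s" "bell_entry c s C S 2 1 = c" "bell_entry c s C S 2 2 = S" "bell_entry c s C S 2 3 = C"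
  "bell_entry c s C S 3 0 = c" "bell_entry c s C S 3 1 = s" "bell_entry c s C S 3 2 = -C" "bell_entry c s C S 3 3 = S"
  by (simp_all add: bell_entry_def)

lemma pauli_prob_simps:
  "pauli_prob dz dx 0 = (1 + dz) / 2 * ((1 + dx) / 2)" "pauli_prob dz dx 1 = (1 - dz) / 2 * ((1 - dx) / 2)"
  "pauli_prob dz dx 2 = (1 + dz) / 2 * ((1 - dx) / 2)" "pauli_prob dz dx 3 = (1 - dz) / 2 * ((1 + dx) / 2)"
  by (simp_all add: pauli_prob_def)

lemma rot_pauli_carrier [simp]: "rot_pauli c s C S dz dx \<in> carrier_mat 3 3"
  by (simp add: rot_pauli_def)

lemma rot_pauli_index:
  "rot_pauli c s C S dz dx $$ (0, 0) = (dz + dx) / 2 * (c\<^sup>2 - s\<^sup>2) + (dz - dx) / 2 * (C\<^sup>2 - S\<^sup>2)"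
  "rot_pauli c s C S dz dx $$ (0, 1) = (dz - dx) * (C * S) - (dz + dx) * (c * s)"
  "rot_pauli c s C S dz dx $$ (1, 0) = (dz - dx) * (C * S) + (dz + dx) * (c * s)"
  "rot_pauli c s C S dz dx $$ (1, 1) = (dz + dx) / 2 * (c\<^sup>2 - s\<^sup>2) - (dz - dx) / 2 * (C\<^sup>2 - S\<^sup>2)"
  "rot_pauli c s C S dz dx $$ (0, 2) = 0" "rot_pauli c s C S dz dx $$ (1, 2) = 0"
  "rot_pauli c s C S dz dx $$ (2, 0) = 0" "rot_pauli c s C S dz dx $$ (2, 1) = 0"
  "rot_pauli c s C S dz dx $$ (2, 2) = dz * dx"
  by (simp_all add: rot_pauli_def)

lemma bell_mat_unitary:
  assumes "c\<^sup>2 + s\<^sup>2 = 1" "C\<^sup>2 + S\<^sup>2 = 1"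
  shows "adj (bell_mat c s C S) * bell_mat c s C S = 1\<^sub>m 4"
proof (rule eq_matI)
  let ?B = "bell_mat c s C S"
  fix i j assume "i < dim_row (1\<^sub>m 4 :: complex mat)" "j < dim_col (1\<^sub>m 4 :: complex mat)"
  then have ij: "i < 4" "j < 4" by auto
  have "(adj ?B * ?B) $$ (i, j) = (\<Sum>k<4. adj ?B $$ (i, k) * ?B $$ (k, j))"
    using ij by (simp only: mult_mat_index_sum[OF adj_carrier[OF bell_mat_carrier] bell_mat_carrier])
  also have "\<dots> = (\<Sum>k<4. cnj (?B $$ (k, i)) * ?B $$ (k, j))"
    using ij by (intro sum.cong refl arg_cong2[of _ _ _ _ "(*)"] adj_index) (auto simp: bell_mat_def)
  also have "\<dots> = (\<Sum>k<4. complex_of_real (bell_entry c s C S k i * bell_entry c s C S k j / 2))"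
    using ij by (intro sum.cong refl bell_mat_mult) auto
  also have "\<dots> = complex_of_real (\<Sum>k<4. bell_entry c s C S k i * bell_entry c s C S k j / 2)" by simp
  also have "(\<Sum>k<4. bell_entry c s C S k i * bell_entry c s C S k j / 2) = (if i = j then 1 else 0)"
    unfolding sum_lessThan_4 using less_4_cases[OF ij(1)] less_4_cases[OF ij(2)] assms
    by (elim disjE; hypsubst; unfold bell_entry_simps) (simp_all add: power2_eq_square)
  finally show "(adj ?B * ?B) $$ (i, j) = 1\<^sub>m 4 $$ (i, j)" using ij by simp
qed (auto simp: bell_mat_def)

lemma rot_pauli_spectral:
  assumes cs: "c\<^sup>2 + s\<^sup>2 = 1" "C\<^sup>2 + S\<^sup>2 = 1"
  shows "spectral 4 (choi (rot_pauli c s C S dz dx) (0\<^sub>v 3)) (bell_mat c s C S) (pauli_prob dz dx)"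
proof -
  let ?B = "bell_mat c s C S" and ?p = "pauli_prob dz dx" and ?R = "rot_pauli c s C S dz dx"
  let ?v = "bell_entry c s C S"
  have c2: "c\<^sup>2 = 1 - s\<^sup>2" and C2: "C\<^sup>2 = 1 - S\<^sup>2" using cs by auto
  have "choi ?R (0\<^sub>v 3) = ?B * diagm 4 ?p * adj ?B"
  proof (rule eq_matI)
    fix a b assume "a < dim_row (?B * diagm 4 ?p * adj ?B)" "b < dim_col (?B * diagm 4 ?p * adj ?B)"
    then have ab: "a < 4" "b < 4" by (auto simp: bell_mat_def)
    have "(?B * diagm 4 ?p * adj ?B) $$ (a, b) = (\<Sum>l<4. complex_of_real (?p l) * (?B $$ (a, l) * cnj (?B $$ (b, l))))"
      by (rule conj_diagm_index[OF bell_mat_carrier ab])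
    also have "\<dots> = (\<Sum>l<4. complex_of_real (?p l * (?v a l * ?v b l / 2)))"
      using ab by (intro sum.cong refl) (simp only: bell_mat_mult of_real_mult[of "?p _"] lessThan_iff)
    also have "\<dots> = complex_of_real (\<Sum>l<4. ?p l * (?v a l * ?v b l / 2))" by simp
    also have "\<dots> = choi ?R (0\<^sub>v 3) $$ (a, b)"
      unfolding sum_lessThan_4 pauli_prob_simps using less_4_cases[OF ab(1)] less_4_cases[OF ab(2)]
      by (elim disjE; hypsubst; unfold bell_entry_simps choi_index rot_pauli_index)
         (simp_all add: complex_eq_iff c2 C2 power2_eq_square[symmetric] field_simps)
    finally show "choi ?R (0\<^sub>v 3) $$ (a, b) = (?B * diagm 4 ?p * adj ?B) $$ (a, b)" ..
  qed (auto simp: bell_mat_def choi_def)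
  then show ?thesis unfolding spectral_def using bell_mat_unitary[OF cs] by simp
qed

definition neg_hbin :: "real \<Rightarrow> real" where
  "neg_hbin d = ent_term ((1 + d) / 2) + ent_term ((1 - d) / 2)"

text \<open>The reference parameter is \<open>e\<close>, and
  \<open>cross_ent d d = neg_hbin d\<close>. Being affine in \<open>d\<close>, it can be evaluated
  from observed correlations.\<close>

definition cross_ent :: "real \<Rightarrow> real \<Rightarrow> real" where
  "cross_ent d e = (1 + d) / 2 * log 2 ((1 + e) / 2) + (1 - d) / 2 * log 2 ((1 - e) / 2)"

lemma mult_diagm_index:
  assumes "M \<in> carrier_mat k n" "i < k" "j < n"
  shows "(M * diagm n p) $$ (i, j) = M $$ (i, j) * complex_of_real (p j)"
proof -
  have "(M * diagm n p) $$ (i, j) = (\<Sum>l<n. if l = j then M $$ (i, j) * complex_of_real (p j) else 0)"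
    unfolding mult_mat_index_sum[OF assms(1) diagm_carrier assms(2,3)]
    by (intro sum.cong refl) (auto simp: diagm_def assms)
  then show ?thesis using assms by simp
qed

lemma adj_diagm [simp]: "adj (diagm n p) = diagm n p"
  by (rule eq_matI) (auto simp: diagm_def)

text \<open>This is \<open>\<sigma>\<^sub>z\<close> on the input: conjugation by it changes the sign
  of exactly those blocks that \<open>pinch\<close> removes.\<close>

definition zsign :: "complex mat" where
  "zsign = diagm 4 (\<lambda>a. if a < 2 then 1 else - 1)"

lemma zsign_unitary: "zsign \<in> carrier_mat 4 4" "adj zsign * zsign = 1\<^sub>m 4"
proof -
  show "zsign \<in> carrier_mat 4 4" by (simp add: zsign_def)
  show "adj zsign * zsign = 1\<^sub>m 4"
  proof (rule eq_matI)
    fix i j assume "i < dim_row (1\<^sub>m 4 :: complex mat)" "j < dim_col (1\<^sub>m 4 :: complex mat)"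
    then have "i < 4" "j < 4" by auto
    then show "(adj zsign * zsign) $$ (i, j) = 1\<^sub>m 4 $$ (i, j)"
      unfolding zsign_def adj_diagm by (simp add: diagm_mult_index[OF diagm_carrier] del: index_mult_mat(1)) (simp add: diagm_def)
  qed (auto simp: zsign_def diagm_def)
qed

lemma pinch_average:
  assumes A: "A \<in> carrier_mat 4 4"
  shows "pinch A = (1/2) \<cdot>\<^sub>m (A + zsign * A * adj zsign)"
proof (rule eq_matI)
  let ?Z = "zsign * A * adj zsign"
  have Z: "?Z \<in> carrier_mat 4 4" using A zsign_unitary by (auto intro!: mult_carrier_square)
  fix i j assume "i < dim_row ((1/2) \<cdot>\<^sub>m (A + ?Z))" "j < dim_col ((1/2) \<cdot>\<^sub>m (A + ?Z))"
  then have ij: "i < 4" "j < 4" using Z by auto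
  have "?Z $$ (i, j) = complex_of_real (if i < 2 then 1 else - 1) * A $$ (i, j) * complex_of_real (if j < 2 then 1 else - 1)"
    unfolding zsign_def adj_diagm mult_diagm_index[OF mult_carrier_square[OF diagm_carrier A] ij] diagm_mult_index[OF A ij] ..
  then show "pinch A $$ (i, j) = ((1/2) \<cdot>\<^sub>m (A + ?Z)) $$ (i, j)"
    using ij A Z by (auto simp: pinch_def simp del: index_mult_mat(1))
qed (use A zsign_unitary in \<open>auto simp: pinch_def\<close>)

lemma choi_gram:
  assumes "qubit_channel R t"
  obtains W m W' m' where "W \<in> carrier_mat 4 m" "choi R t = W * adj W"
    "W' \<in> carrier_mat 4 m'" "pinch (choi R t) = W' * adj W'"
proof -
  from assms obtain Ks where k: "is_kraus R t Ks" unfolding qubit_channel_def by blast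
  show ?thesis
    by (rule that[OF kraus_vecs_carrier kraus_vecs_gram[OF k] kraus_blocks_carrier])
       (unfold kraus_vecs_gram[OF k], rule kraus_blocks_gram)
qed

lemma qform_bell:
  assumes "j < 4"
  shows "qform 4 \<rho> (bell_mat c s C S) j =
    (\<Sum>k<4. \<Sum>l<4. bell_entry c s C S k j * bell_entry c s C S l j * Re (\<rho> $$ (k, l))) / 2"
proof -
  have "qform 4 \<rho> (bell_mat c s C S) j = Re (\<Sum>k<4. \<Sum>l<4. complex_of_real (bell_entry c s C S k j * bell_entry c s C S l j / 2) * \<rho> $$ (k, l))"
    unfolding qform_def
  proof (intro arg_cong[of _ _ Re] sum.cong refl)
    fix k l assume kl: "k \<in> {..<4::nat}" "l \<in> {..<4::nat}"
    have "cnj (bell_mat c s C S $$ (k, j)) * \<rho> $$ (k, l) * bell_mat c s C S $$ (l, j) =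
        (cnj (bell_mat c s C S $$ (k, j)) * bell_mat c s C S $$ (l, j)) * \<rho> $$ (k, l)" by (simp only: mult_ac)
    also have "cnj (bell_mat c s C S $$ (k, j)) * bell_mat c s C S $$ (l, j) =
        complex_of_real (bell_entry c s C S k j * bell_entry c s C S l j / 2)"
      using kl assms by (intro bell_mat_mult) auto
    finally show "cnj (bell_mat c s C S $$ (k, j)) * \<rho> $$ (k, l) * bell_mat c s C S $$ (l, j) =
        complex_of_real (bell_entry c s C S k j * bell_entry c s C S l j / 2) * \<rho> $$ (k, l)" .
  qed
  then show ?thesis by (simp add: sum_divide_distrib)
qed

lemma qform_one:
  assumes "j < 4" shows "qform 4 \<rho> (1\<^sub>m 4) j = Re (\<rho> $$ (j, j))"
  using less_4_cases[OF assms] by (auto simp: qform_def sum_lessThan_4)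

text \<open>The Bell vectors are real and maximally entangled. They therefore see neither
  \<open>t\<close> nor the entries that mix y with z or x; what remains is the z-x block and
  \<open>R $$ (2, 2)\<close>, whose sign separates the first two columns from the last two.\<close>

lemma qform_bell_choi:
  fixes R t c s C S
  assumes cs: "c\<^sup>2 + s\<^sup>2 = 1" "C\<^sup>2 + S\<^sup>2 = 1"
  defines "M \<equiv> (R $$ (0, 0) + R $$ (1, 1)) * (c\<^sup>2 - s\<^sup>2) + (R $$ (1, 0) - R $$ (0, 1)) * (2 * c * s)"
    and "N \<equiv> (R $$ (0, 0) - R $$ (1, 1)) * (C\<^sup>2 - S\<^sup>2) + (R $$ (1, 0) + R $$ (0, 1)) * (2 * C * S)"
  shows "qform 4 (choi R t) (bell_mat c s C S) 0 = (1 + M + R $$ (2, 2)) / 4"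
    "qform 4 (choi R t) (bell_mat c s C S) 1 = (1 - M + R $$ (2, 2)) / 4"
    "qform 4 (choi R t) (bell_mat c s C S) 2 = (1 + N - R $$ (2, 2)) / 4"
    "qform 4 (choi R t) (bell_mat c s C S) 3 = (1 - N - R $$ (2, 2)) / 4"
proof -
  have c2: "c\<^sup>2 = 1 - s\<^sup>2" and C2: "C\<^sup>2 = 1 - S\<^sup>2" using cs by auto
  have l: "(0::nat) < 4" "(1::nat) < 4" "(2::nat) < 4" "(3::nat) < 4" by auto
  show "qform 4 (choi R t) (bell_mat c s C S) 0 = (1 + M + R $$ (2, 2)) / 4"
    "qform 4 (choi R t) (bell_mat c s C S) 1 = (1 - M + R $$ (2, 2)) / 4"
    "qform 4 (choi R t) (bell_mat c s C S) 2 = (1 + N - R $$ (2, 2)) / 4"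
    "qform 4 (choi R t) (bell_mat c s C S) 3 = (1 - N - R $$ (2, 2)) / 4"
    unfolding qform_bell[OF l(1)] qform_bell[OF l(2)] qform_bell[OF l(3)] qform_bell[OF l(4)]
      sum_lessThan_4 bell_entry_simps choi_index M_def N_def
    by (simp_all add: power2_eq_square[symmetric] c2 C2 field_simps)
qed

lemma choi_diag_sum:
  "Re (choi R t $$ (0, 0)) + Re (choi R t $$ (3, 3)) = (1 + R $$ (0, 0)) / 2"
  "Re (choi R t $$ (1, 1)) + Re (choi R t $$ (2, 2)) = (1 - R $$ (0, 0)) / 2"
  unfolding choi_index by (simp_all add: field_simps)

text \<open>Pinching monotonicity against a rotated Pauli channel whose first column points along z.
  The strict bounds on \<open>dz\<close> and \<open>dx\<close> keep the reference
  invertible.\<close>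

lemma H_XE_cross_bound:
  fixes R t c s C S dz dx
  assumes ch: "qubit_channel R t" and cs: "c\<^sup>2 + s\<^sup>2 = 1" "C\<^sup>2 + S\<^sup>2 = 1"
    and d: "\<bar>dz\<bar> < 1" "\<bar>dx\<bar> < 1" and al: "rot_pauli c s C S dz dx $$ (1, 0) = 0"
  defines "M \<equiv> (R $$ (0, 0) + R $$ (1, 1)) * (c\<^sup>2 - s\<^sup>2) + (R $$ (1, 0) - R $$ (0, 1)) * (2 * c * s)"
    and "N \<equiv> (R $$ (0, 0) - R $$ (1, 1)) * (C\<^sup>2 - S\<^sup>2) + (R $$ (1, 0) + R $$ (0, 1)) * (2 * C * S)"
    and "u \<equiv> rot_pauli c s C S dz dx $$ (0, 0)"
  shows "1 + cross_ent ((M + N) / 2) dz + cross_ent ((M - N) / 2) dx - cross_ent (R $$ (0, 0)) u \<le> H_XE R t"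
proof -
  let ?B = "bell_mat c s C S" and ?\<rho> = "choi R t" and ?\<sigma> = "choi (rot_pauli c s C S dz dx) (0\<^sub>v 3)"
  obtain W m W' m' where W: "W \<in> carrier_mat 4 m" "?\<rho> = W * adj W"
    "W' \<in> carrier_mat 4 m'" "pinch ?\<rho> = W' * adj W'" using choi_gram[OF ch] .
  define s' where "s' = (\<lambda>a::nat. if a = 0 \<or> a = 3 then (1 + u) / 4 else (1 - u) / 4)"
  \<comment> \<open>\<open>u\<close> combines \<open>dz\<close> and \<open>dx\<close> with
    coefficients whose moduli sum to at most 1, so the pinched reference is invertible as
    well.\<close>
  have u: "\<bar>u\<bar> < 1"
  proof -
    have ueq: "u = (c\<^sup>2 + C\<^sup>2 - 1) * dz + (c\<^sup>2 - C\<^sup>2) * dx"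
    proof -
      have s2: "s\<^sup>2 = 1 - c\<^sup>2" "S\<^sup>2 = 1 - C\<^sup>2" using cs by auto
      show ?thesis unfolding u_def rot_pauli_index s2 by (simp add: field_simps)
    qed
    have "0 \<le> c\<^sup>2" "c\<^sup>2 \<le> 1" "0 \<le> C\<^sup>2" "C\<^sup>2 \<le> 1"
      using cs zero_le_power2[of c] zero_le_power2[of s] zero_le_power2[of C] zero_le_power2[of S] by linarith+
    then have w: "\<bar>c\<^sup>2 + C\<^sup>2 - 1\<bar> + \<bar>c\<^sup>2 - C\<^sup>2\<bar> \<le> 1" by linarith
    define e where "e = max \<bar>dz\<bar> \<bar>dx\<bar>"
    have e: "\<bar>dz\<bar> \<le> e" "\<bar>dx\<bar> \<le> e" "0 \<le> e" "e < 1" using d unfolding e_def by auto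
    have "\<bar>(c\<^sup>2 + C\<^sup>2 - 1) * dz + (c\<^sup>2 - C\<^sup>2) * dx\<bar> \<le> \<bar>c\<^sup>2 + C\<^sup>2 - 1\<bar> * \<bar>dz\<bar> + \<bar>c\<^sup>2 - C\<^sup>2\<bar> * \<bar>dx\<bar>"
      by (metis abs_mult abs_triangle_ineq)
    also have "\<dots> \<le> \<bar>c\<^sup>2 + C\<^sup>2 - 1\<bar> * e + \<bar>c\<^sup>2 - C\<^sup>2\<bar> * e"
      using e by (intro add_mono mult_left_mono) auto
    also have "\<dots> = (\<bar>c\<^sup>2 + C\<^sup>2 - 1\<bar> + \<bar>c\<^sup>2 - C\<^sup>2\<bar>) * e" by (simp only: distrib_right)
    also have "\<dots> \<le> 1 * e" using w e by (intro mult_right_mono) auto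
    finally show ?thesis using e ueq by linarith
  qed
  have sp: "spectral 4 ?\<sigma> ?B (pauli_prob dz dx)" by (rule rot_pauli_spectral[OF cs])
  \<comment> \<open>With entry \<open>(1, 0)\<close> equal to zero, nothing off the diagonal is left
    in the two blocks that survive pinching.\<close>
  have z: "?\<sigma> $$ (0, 1) = 0" "?\<sigma> $$ (1, 0) = 0" "?\<sigma> $$ (2, 3) = 0" "?\<sigma> $$ (3, 2) = 0"
    unfolding choi_index al rot_pauli_index(7) by simp_all
  have dg: "?\<sigma> $$ (0, 0) = (1 + u) / 4" "?\<sigma> $$ (1, 1) = (1 - u) / 4" "?\<sigma> $$ (2, 2) = (1 - u) / 4" "?\<sigma> $$ (3, 3) = (1 + u) / 4"
    unfolding choi_index u_def by simp_all
  have "pinch ?\<sigma> = diagm 4 s'"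
  proof (rule eq_matI)
    fix a b assume "a < dim_row (diagm 4 s')" "b < dim_col (diagm 4 s')"
    then have ab: "a < 4" "b < 4" by (auto simp: diagm_def)
    show "pinch ?\<sigma> $$ (a, b) = diagm 4 s' $$ (a, b)"
      using less_4_cases[OF ab(1)] less_4_cases[OF ab(2)]
      by (elim disjE; hypsubst)
         (simp_all add: pinch_def diagm_def s'_def z[simplified] dg[simplified])
  qed (auto simp: pinch_def diagm_def)
  then have sp': "spectral 4 (pinch ?\<sigma>) (1\<^sub>m 4) s'"
    unfolding spectral_def by (simp add: left_mult_one_mat[OF diagm_carrier] right_mult_one_mat[OF diagm_carrier])
  have p0: "(1 + dz) / 2 > 0" "(1 - dz) / 2 > 0" "(1 + dx) / 2 > 0" "(1 - dx) / 2 > 0" using d by auto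
  have pos: "pauli_prob dz dx j > 0" if "j < 4" for j
    using less_4_cases[OF that] p0 by (elim disjE; hypsubst; unfold pauli_prob_simps) (intro mult_pos_pos, assumption, assumption)+
  have pos': "s' j > 0" if "j < 4" for j using u by (auto simp: s'_def)
  have "(\<Sum>j<4. qform 4 ?\<rho> ?B j * log 2 (pauli_prob dz dx j)) - (\<Sum>j<4. qform 4 (pinch ?\<rho>) (1\<^sub>m 4) j * log 2 (s' j))
      \<le> H_XE R t"
    unfolding H_XE_eq[OF ch]
    by (rule entropy_gain_pinching[OF W sp sp' pos pos' zsign_unitary pinch_average[OF choi_carrier] pinch_average[OF choi_carrier]])
  moreover have "(\<Sum>j<4. qform 4 ?\<rho> ?B j * log 2 (pauli_prob dz dx j)) = cross_ent ((M + N) / 2) dz + cross_ent ((M - N) / 2) dx"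
  proof -
    \<comment> \<open>The product eigenvalues split every logarithm in two. Each half then collects
      one Bell expectation of either sign class, and \<open>R $$ (2, 2)\<close> cancels.\<close>
    have lg: "log 2 (pauli_prob dz dx 0) = log 2 ((1 + dz) / 2) + log 2 ((1 + dx) / 2)"
      "log 2 (pauli_prob dz dx 1) = log 2 ((1 - dz) / 2) + log 2 ((1 - dx) / 2)"
      "log 2 (pauli_prob dz dx 2) = log 2 ((1 + dz) / 2) + log 2 ((1 - dx) / 2)"
      "log 2 (pauli_prob dz dx 3) = log 2 ((1 - dz) / 2) + log 2 ((1 + dx) / 2)"
      unfolding pauli_prob_simps using p0 by (simp_all only: log_mult_pos)
    show ?thesis
      unfolding sum_lessThan_4 lg qform_bell_choi[OF cs, of R t, folded M_def N_def] cross_ent_def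
      by (simp add: field_simps)
  qed
  moreover have "(\<Sum>j<4. qform 4 (pinch ?\<rho>) (1\<^sub>m 4) j * log 2 (s' j)) = cross_ent (R $$ (0, 0)) u - 1"
  proof -
    \<comment> \<open>The uniform input halves every pinched eigenvalue; the logarithm of this
      factor is the constant 1 of the bound.\<close>
    have l4: "log 2 (x / 4) = log 2 (x / 2) - 1" if "x > 0" for x :: real
    proof -
      have "log 2 (x / 2 / 2) = log 2 (x / 2) - log 2 2" using that by (intro log_divide_pos) auto
      then show ?thesis by simp
    qed
    have q: "qform 4 (pinch ?\<rho>) (1\<^sub>m 4) j = Re (?\<rho> $$ (j, j))" if "j < 4" for j
      unfolding qform_one[OF that] using that by (simp add: pinch_def)
    have "(\<Sum>j<4. qform 4 (pinch ?\<rho>) (1\<^sub>m 4) j * log 2 (s' j)) =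
       (Re (?\<rho> $$ (0, 0)) + Re (?\<rho> $$ (3, 3))) * log 2 ((1 + u) / 4) + (Re (?\<rho> $$ (1, 1)) + Re (?\<rho> $$ (2, 2))) * log 2 ((1 - u) / 4)"
      unfolding sum_lessThan_4 by (simp add: q s'_def algebra_simps)
    also have "\<dots> = cross_ent (R $$ (0, 0)) u - 1"
      unfolding choi_diag_sum cross_ent_def using u by (simp add: l4 field_simps)
    finally show ?thesis .
  qed
  ultimately show ?thesis by linarith
qed

text \<open>At \<open>d = 1\<close> or \<open>d = -1\<close> one of the logarithms diverges as
  \<open>l\<close> tends to 1, but its weight is then zero, so the limit is still the
  entropy.\<close>

lemma cross_ent_limit:
  assumes "\<bar>d\<bar> \<le> 1"
  shows "((\<lambda>l. cross_ent d (l * d)) \<longlongrightarrow> neg_hbin d) (at_left 1)"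
proof -
  have half: "((\<lambda>l. (1 + e) / 2 * log 2 ((1 + l * e) / 2)) \<longlongrightarrow> ent_term ((1 + e) / 2)) (at_left 1)"
    if "\<bar>e\<bar> \<le> 1" for e :: real
  proof (cases "1 + e = 0")
    case True
    then show ?thesis by simp
  next
    case False
    then have "((\<lambda>l. ln ((1 + l * e) / 2)) \<longlongrightarrow> ln ((1 + 1 * e) / 2)) (at_left 1)"
      by (intro tendsto_intros) auto
    then have "((\<lambda>l. (1 + e) / 2 * (ln ((1 + l * e) / 2) / ln 2)) \<longlongrightarrow> (1 + e) / 2 * (ln ((1 + 1 * e) / 2) / ln 2)) (at_left 1)"
      by (rule tendsto_mult[OF tendsto_const tendsto_divide[OF _ tendsto_const]]) simp
    then show ?thesis by (simp add: ent_term_eq log_def)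
  qed
  show ?thesis
    unfolding cross_ent_def neg_hbin_def
    using tendsto_add[OF half[of d] half[of "- d"]] assms by simp
qed

lemma choi_diag_nonneg:
  assumes "qubit_channel R t" "j < 4"
  shows "Re (choi R t $$ (j, j)) \<ge> 0"
proof -
  obtain W m W' m' where "W \<in> carrier_mat 4 m" "choi R t = W * adj W"
    "W' \<in> carrier_mat 4 m'" "pinch (choi R t) = W' * adj W'" using choi_gram[OF assms(1)] .
  from qform_nonneg[OF this(1,2) one_carrier_mat assms(2)] show ?thesis
    unfolding qform_one[OF assms(2)] .
qed

lemma P_XY_eq:
  "P_XY R t 0 0 = Re (choi R t $$ (0, 0))" "P_XY R t 0 1 = Re (choi R t $$ (1, 1))"
  "P_XY R t 1 0 = Re (choi R t $$ (2, 2))" "P_XY R t 1 1 = Re (choi R t $$ (3, 3))"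
  unfolding P_XY_def proj_eq_munit by (simp_all add: choi_def)

lemma ent_term_mult:
  "x \<ge> 0 \<Longrightarrow> y \<ge> 0 \<Longrightarrow> ent_term (x * y) = y * ent_term x + x * ent_term y"
  by (cases "x = 0"; cases "y = 0") (auto simp: ent_term_eq log_mult_pos algebra_simps)

lemma ent_term_quarter:
  "\<bar>x\<bar> \<le> 1 \<Longrightarrow> ent_term ((1 + x) / 4) = ent_term ((1 + x) / 2) / 2 - (1 + x) / 4"
  using ent_term_mult[of "(1 + x) / 2" "1 / 2"] by (simp add: ent_term_eq[of "1/2"] log_divide_pos)

text \<open>Given Y, the input is known once it is known whether X and Y agree. So H(X|Y) is the
  entropy of the error bit given Y, at most that of the error bit alone, whose probabilities are
  \<open>e\<close> and \<open>f\<close>.\<close>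

lemma H_XY_le:
  assumes ch: "qubit_channel R t"
  shows "H_XY R t \<le> - neg_hbin (R $$ (0, 0))"
proof -
  define p where "p = (\<lambda>j. Re (choi R t $$ (j, j)))"
  have p: "p 0 \<ge> 0" "p 1 \<ge> 0" "p 2 \<ge> 0" "p 3 \<ge> 0"
    unfolding p_def by (rule choi_diag_nonneg[OF ch]; simp)+
  define y0 y1 e f where "y0 = p 0 + p 2" and "y1 = p 1 + p 3" and "e = p 0 + p 3" and "f = p 1 + p 2"
  have ef: "e = (1 + R $$ (0, 0)) / 2" "f = (1 - R $$ (0, 0)) / 2"
    unfolding e_def f_def p_def choi_diag_sum by simp_all
  have sum1: "p 0 + p 1 + p 2 + p 3 = 1" using ef unfolding e_def f_def by (simp add: field_simps)
  have nn: "y0 \<ge> 0" "y1 \<ge> 0" "e \<ge> 0" "f \<ge> 0" using p unfolding y0_def y1_def e_def f_def by auto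
  have g: "a * log 2 y + a * log 2 z + (a - y * z) / ln 2 \<le> ent_term a"
    if "0 \<le> a" "a \<le> y" "a \<le> z" for a y z :: real
  proof (cases "a = 0")
    case True
    then show ?thesis using that by simp
  next
    case False
    then have "a > 0" "y > 0" "z > 0" using that by auto
    then show ?thesis using ent_term_gibbs[of a "y * z"] by (simp add: log_mult_pos algebra_simps)
  qed
  \<comment> \<open>Gibbs' inequality against the product of the laws of the output and of the error
    bit.\<close>
  have "p 0 * log 2 y0 + p 0 * log 2 e + (p 0 - y0 * e) / ln 2 \<le> ent_term (p 0)"
    "p 1 * log 2 y1 + p 1 * log 2 f + (p 1 - y1 * f) / ln 2 \<le> ent_term (p 1)"
    "p 2 * log 2 y0 + p 2 * log 2 f + (p 2 - y0 * f) / ln 2 \<le> ent_term (p 2)"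
    "p 3 * log 2 y1 + p 3 * log 2 e + (p 3 - y1 * e) / ln 2 \<le> ent_term (p 3)"
    by (rule g; use p in \<open>simp add: y0_def y1_def e_def f_def\<close>)+
  moreover have "(p 0 - y0 * e) / ln 2 + (p 1 - y1 * f) / ln 2 + (p 2 - y0 * f) / ln 2 + (p 3 - y1 * e) / ln 2 =
      (p 0 + p 1 + p 2 + p 3 - (y0 + y1) * (e + f)) / ln 2"
    by (simp add: add_divide_distrib diff_divide_distrib algebra_simps)
  moreover have "\<dots> = 0"
  proof -
    have "y0 + y1 = 1" "e + f = 1" using sum1 unfolding y0_def y1_def e_def f_def by auto
    then show ?thesis using sum1 by simp
  qed
  moreover have "p 0 * log 2 y0 + p 2 * log 2 y0 = ent_term y0" "p 1 * log 2 y1 + p 3 * log 2 y1 = ent_term y1"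
    "p 0 * log 2 e + p 3 * log 2 e = ent_term e" "p 1 * log 2 f + p 2 * log 2 f = ent_term f"
    unfolding ent_term_eq y0_def y1_def e_def f_def by (simp_all add: distrib_right)
  ultimately have "ent_term y0 + ent_term y1 + ent_term e + ent_term f \<le> ent_term (p 0) + ent_term (p 1) + ent_term (p 2) + ent_term (p 3)"
    by linarith
  moreover have "H_XY R t = - (ent_term (p 0) + ent_term (p 1) + ent_term (p 2) + ent_term (p 3)) + ent_term y0 + ent_term y1"
    unfolding H_XY_def sum_lessThan_2 P_XY_eq p_def y0_def y1_def by simp
  ultimately show ?thesis unfolding neg_hbin_def ef[symmetric] by linarith
qed

lemma H_XY_unital: "H_XY R (0\<^sub>v 3) = - neg_hbin (R $$ (0, 0))" if "\<bar>R $$ (0, 0)\<bar> \<le> 1"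
proof -
  let ?u = "R $$ (0, 0)"
  have P: "P_XY R (0\<^sub>v 3) 0 0 = (1 + ?u) / 4" "P_XY R (0\<^sub>v 3) 0 1 = (1 + - ?u) / 4"
    "P_XY R (0\<^sub>v 3) 1 0 = (1 + - ?u) / 4" "P_XY R (0\<^sub>v 3) 1 1 = (1 + ?u) / 4"
    unfolding P_XY_eq choi_index by simp_all
  have Y: "(1 + ?u) / 4 + (1 + - ?u) / 4 = 1 / 2" "(1 + - ?u) / 4 + (1 + ?u) / 4 = 1 / 2" by (simp_all add: field_simps)
  show ?thesis
    unfolding H_XY_def sum_lessThan_2 P Y neg_hbin_def using ent_term_quarter[of ?u] ent_term_quarter[of "- ?u"] that
    by (simp add: ent_term_eq[of "1/2"] log_divide_pos field_simps)
qed

text \<open>Bell expectations of a positive matrix are nonnegative; adding one from each sign class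
  eliminates \<open>R $$ (2, 2)\<close>.\<close>

lemma rotated_diag_le_one:
  fixes R t c s C S
  assumes ch: "qubit_channel R t" and cs: "c\<^sup>2 + s\<^sup>2 = 1" "C\<^sup>2 + S\<^sup>2 = 1"
  defines "M \<equiv> (R $$ (0, 0) + R $$ (1, 1)) * (c\<^sup>2 - s\<^sup>2) + (R $$ (1, 0) - R $$ (0, 1)) * (2 * c * s)"
    and "N \<equiv> (R $$ (0, 0) - R $$ (1, 1)) * (C\<^sup>2 - S\<^sup>2) + (R $$ (1, 0) + R $$ (0, 1)) * (2 * C * S)"
  shows "\<bar>(M + N) / 2\<bar> \<le> 1" and "\<bar>(M - N) / 2\<bar> \<le> 1"
proof -
  obtain W m W' m' where W: "W \<in> carrier_mat 4 m" "choi R t = W * adj W"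
    "W' \<in> carrier_mat 4 m'" "pinch (choi R t) = W' * adj W'" using choi_gram[OF ch] .
  note q = qform_nonneg[OF W(1,2) bell_mat_carrier]
  have q4: "(1 + M + R $$ (2, 2)) / 4 \<ge> 0" "(1 - M + R $$ (2, 2)) / 4 \<ge> 0"
    "(1 + N - R $$ (2, 2)) / 4 \<ge> 0" "(1 - N - R $$ (2, 2)) / 4 \<ge> 0"
    unfolding M_def N_def qform_bell_choi[OF cs, symmetric, of R t] by (rule q; simp)+
  then show "\<bar>(M + N) / 2\<bar> \<le> 1" and "\<bar>(M - N) / 2\<bar> \<le> 1" by auto
qed

text \<open>The reference is built from the correlations of \<open>R\<close> itself, which turns
  cross entropies into entropies. Its entry \<open>(0, 0)\<close> agrees with that of
  \<open>R\<close>, so \<open>neg_hbin (R $$ (0, 0))\<close> cancels against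
  \<open>H_XY_le\<close>.\<close>

theorem Kr_lower_bound:
  fixes R t c s C S
  assumes ch: "qubit_channel R t" and cs: "c\<^sup>2 + s\<^sup>2 = 1" "C\<^sup>2 + S\<^sup>2 = 1"
  defines "M \<equiv> (R $$ (0, 0) + R $$ (1, 1)) * (c\<^sup>2 - s\<^sup>2) + (R $$ (1, 0) - R $$ (0, 1)) * (2 * c * s)"
    and "N \<equiv> (R $$ (0, 0) - R $$ (1, 1)) * (C\<^sup>2 - S\<^sup>2) + (R $$ (1, 0) + R $$ (0, 1)) * (2 * C * S)"
  assumes d: "dz = (M + N) / 2" "dx = (M - N) / 2"
    and al: "rot_pauli c s C S dz dx $$ (1, 0) = 0" "rot_pauli c s C S dz dx $$ (0, 0) = R $$ (0, 0)"
  shows "1 + neg_hbin dz + neg_hbin dx \<le> Kr R t"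
proof -
  have dz: "\<bar>dz\<bar> \<le> 1" and dx: "\<bar>dx\<bar> \<le> 1"
    unfolding d M_def N_def by (rule rotated_diag_le_one[OF ch cs])+
  let ?u = "R $$ (0, 0)"
  have u: "\<bar>?u\<bar> \<le> 1"
    using choi_diag_nonneg[OF ch, of 0] choi_diag_nonneg[OF ch, of 1] choi_diag_nonneg[OF ch, of 2]
      choi_diag_nonneg[OF ch, of 3] choi_diag_sum[of R t] by auto
  let ?f = "\<lambda>l. 1 + cross_ent dz (l * dz) + cross_ent dx (l * dx) - cross_ent ?u (l * ?u)"
  have "(?f \<longlongrightarrow> 1 + neg_hbin dz + neg_hbin dx - neg_hbin ?u) (at_left 1)"
    by (intro tendsto_diff tendsto_add tendsto_const cross_ent_limit dz dx u)
  moreover have "eventually (\<lambda>l. ?f l \<le> H_XE R t) (at_left 1)"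
    using eventually_at_left_real[of 0 "1::real"]
  proof (rule eventually_mono)
    show "(0::real) < 1" by simp
    fix l :: real assume l: "l \<in> {0<..<1}"
    have lt: "\<bar>l * x\<bar> < 1" if "\<bar>x\<bar> \<le> 1" for x
    proof -
      have "\<bar>l * x\<bar> \<le> l * 1" using l that unfolding abs_mult by (intro mult_mono) auto
      then show ?thesis using l by auto
    qed
    \<comment> \<open>These entries are linear in \<open>(dz, dx)\<close>: shrinking keeps the first
      column along z and multiplies \<open>u\<close> by the same \<open>l\<close>.\<close>
    have sc: "rot_pauli c s C S (l * dz) (l * dx) $$ (1, 0) = l * rot_pauli c s C S dz dx $$ (1, 0)"
      "rot_pauli c s C S (l * dz) (l * dx) $$ (0, 0) = l * rot_pauli c s C S dz dx $$ (0, 0)"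
      unfolding rot_pauli_index by (simp_all add: field_simps)
    have "rot_pauli c s C S (l * dz) (l * dx) $$ (1, 0) = 0" unfolding sc al by simp
    from H_XE_cross_bound[OF ch cs lt[OF dz] lt[OF dx] this, folded M_def N_def d]
    show "?f l \<le> H_XE R t" unfolding sc al .
  qed
  ultimately have "1 + neg_hbin dz + neg_hbin dx - neg_hbin ?u \<le> H_XE R t"
    by (intro tendsto_upperbound[of ?f _ "at_left 1"]) auto
  then show "1 + neg_hbin dz + neg_hbin dx \<le> Kr R t"
    unfolding Kr_def using H_XY_le[OF ch] by linarith
qed

text \<open>The entropy of the Choi state is exact because the two flips are independent; that of
  the pinched state is only bounded through its diagonal. Since no alignment is assumed, the upper
  bound holds for all angles.\<close>

theorem rot_pauli_channel:
  assumes cs: "c\<^sup>2 + s\<^sup>2 = 1" "C\<^sup>2 + S\<^sup>2 = 1" and d: "\<bar>dz\<bar> \<le> 1" "\<bar>dx\<bar> \<le> 1"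
  shows "qubit_channel (rot_pauli c s C S dz dx) (0\<^sub>v 3)"
    and "Kr (rot_pauli c s C S dz dx) (0\<^sub>v 3) \<le> 1 + neg_hbin dz + neg_hbin dx"
proof -
  let ?R = "rot_pauli c s C S dz dx" and ?t = "0\<^sub>v 3 :: real vec"
  have p0: "(1 + dz) / 2 \<ge> 0" "(1 - dz) / 2 \<ge> 0" "(1 + dx) / 2 \<ge> 0" "(1 - dx) / 2 \<ge> 0" using d by auto
  have pos: "pauli_prob dz dx j \<ge> 0" if "j < 4" for j
    using less_4_cases[OF that] p0 by (elim disjE; hypsubst; unfold pauli_prob_simps) (intro mult_nonneg_nonneg, assumption, assumption)+
  show ch: "qubit_channel ?R ?t"
    by (rule qubit_channel_if_spectral[OF rot_pauli_carrier _ rot_pauli_spectral[OF cs] pos]) simp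
  obtain W m W' m' where W: "W \<in> carrier_mat 4 m" "choi ?R ?t = W * adj W"
    "W' \<in> carrier_mat 4 m'" "pinch (choi ?R ?t) = W' * adj W'" using choi_gram[OF ch] .
  have e: "vn_entropy (choi ?R ?t) = - (neg_hbin dz + neg_hbin dx)"
    unfolding vn_entropy_spectral[OF rot_pauli_spectral[OF cs]] sum_lessThan_4 pauli_prob_simps neg_hbin_def
    using p0 by (simp only: ent_term_mult) (simp add: field_simps)
  let ?u = "?R $$ (0, 0)"
  have u: "\<bar>?u\<bar> \<le> 1"
    using choi_diag_nonneg[OF ch, of 0] choi_diag_nonneg[OF ch, of 1] choi_diag_nonneg[OF ch, of 2]
      choi_diag_nonneg[OF ch, of 3] choi_diag_sum[of ?R ?t] by auto
  have dg: "Re (choi ?R ?t $$ (0, 0)) = (1 + ?u) / 4" "Re (choi ?R ?t $$ (1, 1)) = (1 + - ?u) / 4"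
    "Re (choi ?R ?t $$ (2, 2)) = (1 + - ?u) / 4" "Re (choi ?R ?t $$ (3, 3)) = (1 + ?u) / 4"
    unfolding choi_index by simp_all
  have "vn_entropy (pinch (choi ?R ?t)) \<le> - (\<Sum>k<4. ent_term (Re (pinch (choi ?R ?t) $$ (k, k))))"
    by (rule vn_entropy_le_diag[OF W(3,4)])
  also have "(\<Sum>k<4. ent_term (Re (pinch (choi ?R ?t) $$ (k, k)))) = (\<Sum>k<4. ent_term (Re (choi ?R ?t $$ (k, k))))"
    by (intro sum.cong refl) (simp add: pinch_def)
  also have "\<dots> = neg_hbin ?u - 1"
    unfolding sum_lessThan_4 dg neg_hbin_def using ent_term_quarter[of ?u] ent_term_quarter[of "- ?u"] u by (simp add: field_simps)
  finally show "Kr ?R ?t \<le> 1 + neg_hbin dz + neg_hbin dx"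
    unfolding Kr_def H_XE_eq[OF ch] H_XY_unital[OF u] e by simp
qed

section \<open>Optimal rotations\<close>

lemma neg_hbin_minus [simp]: "neg_hbin (- d) = neg_hbin d"
  by (simp add: neg_hbin_def add.commute)

lemma neg_hbin_jensen:
  assumes fin: "finite I" and w: "\<And>i. i \<in> I \<Longrightarrow> w i \<ge> 0" "sum w I = 1" and x: "\<And>i. i \<in> I \<Longrightarrow> \<bar>x i\<bar> \<le> 1"
  shows "neg_hbin (\<Sum>i\<in>I. w i * x i) \<le> (\<Sum>i\<in>I. w i * neg_hbin (x i))"
    and "neg_hbin (\<Sum>i\<in>I. w i * x i) = (\<Sum>i\<in>I. w i * neg_hbin (x i)) \<Longrightarrow>
      i \<in> I \<Longrightarrow> w i > 0 \<Longrightarrow> x i = (\<Sum>i\<in>I. w i * x i)"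
proof -
  let ?p = "\<lambda>i. (1 + x i) / 2" and ?m = "\<lambda>i. (1 - x i) / 2"
  have nn: "?p i \<ge> 0" "?m i \<ge> 0" if "i \<in> I" for i using x[OF that] by auto
  have sp: "(1 + (\<Sum>i\<in>I. w i * x i)) / 2 = (\<Sum>i\<in>I. w i * ?p i)"
  proof -
    have "(\<Sum>i\<in>I. w i * ?p i) = (\<Sum>i\<in>I. w i / 2 + w i * x i / 2)"
      by (intro sum.cong refl) (simp add: field_simps)
    also have "\<dots> = sum w I / 2 + (\<Sum>i\<in>I. w i * x i) / 2"
      unfolding sum.distrib sum_divide_distrib ..
    finally show ?thesis unfolding w(2) by simp
  qed
  have sm: "(1 - (\<Sum>i\<in>I. w i * x i)) / 2 = (\<Sum>i\<in>I. w i * ?m i)"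
  proof -
    have "(\<Sum>i\<in>I. w i * ?m i) = (\<Sum>i\<in>I. w i / 2 - w i * x i / 2)"
      by (intro sum.cong refl) (simp add: field_simps)
    also have "\<dots> = sum w I / 2 - (\<Sum>i\<in>I. w i * x i) / 2"
      unfolding sum_subtractf sum_divide_distrib ..
    finally show ?thesis unfolding w(2) by simp
  qed
  have split: "(\<Sum>i\<in>I. w i * neg_hbin (x i)) = (\<Sum>i\<in>I. w i * ent_term (?p i)) + (\<Sum>i\<in>I. w i * ent_term (?m i))"
    unfolding neg_hbin_def by (simp add: distrib_left sum.distrib)
  have jp: "ent_term (\<Sum>i\<in>I. w i * ?p i) \<le> (\<Sum>i\<in>I. w i * ent_term (?p i))"
    by (rule ent_term_jensen(1)[OF fin _ w(2)]) (use w(1) nn in auto)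
  have jm: "ent_term (\<Sum>i\<in>I. w i * ?m i) \<le> (\<Sum>i\<in>I. w i * ent_term (?m i))"
    by (rule ent_term_jensen(1)[OF fin _ w(2)]) (use w(1) nn in auto)
  show "neg_hbin (\<Sum>i\<in>I. w i * x i) \<le> (\<Sum>i\<in>I. w i * neg_hbin (x i))"
    unfolding split unfolding neg_hbin_def sp sm by (rule add_mono[OF jp jm])
  assume eq: "neg_hbin (\<Sum>i\<in>I. w i * x i) = (\<Sum>i\<in>I. w i * neg_hbin (x i))" and i: "i \<in> I" "w i > 0"
  have "ent_term (\<Sum>i\<in>I. w i * ?p i) = (\<Sum>i\<in>I. w i * ent_term (?p i))"
    using eq jp jm unfolding split unfolding neg_hbin_def sp sm by linarith
  then have "?p i = (\<Sum>i\<in>I. w i * ?p i)"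
    by (intro ent_term_jensen(2)[OF fin _ w(2)] i) (use w(1) nn in auto)
  then show "x i = (\<Sum>i\<in>I. w i * x i)" unfolding sp[symmetric] by simp
qed

text \<open>In the coordinates \<open>x + y\<close> and \<open>x - y\<close> the point lies in a
  rectangle centred at the origin, with corners \<open>\<plusminus>(dz, dx)\<close> and
  \<open>\<plusminus>(dx, dz)\<close> in terms of \<open>(x, y)\<close>. The sum takes the same
  value at all corners, and strict convexity allows this value nowhere else.\<close>

lemma neg_hbin_rotated:
  fixes dz dx \<phi> \<psi> :: real
  assumes d: "\<bar>dz\<bar> \<le> 1" "\<bar>dx\<bar> \<le> 1"
  defines "x \<equiv> (dz + dx) / 2 * cos \<phi> + (dz - dx) / 2 * cos \<psi>"
    and "y \<equiv> (dz + dx) / 2 * cos \<phi> - (dz - dx) / 2 * cos \<psi>"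
  shows "neg_hbin x + neg_hbin y \<le> neg_hbin dz + neg_hbin dx"
    and "neg_hbin x + neg_hbin y = neg_hbin dz + neg_hbin dx \<longleftrightarrow> (dz + dx) * sin \<phi> = 0 \<and> (dz - dx) * sin \<psi> = 0"
    and "\<bar>x\<bar> \<le> 1" and "\<bar>y\<bar> \<le> 1"
proof -
  let ?a = "cos \<phi>" and ?b = "cos \<psi>"
  \<comment> \<open>Barycentric weights in the rectangle: products of
    \<open>(1 \<plusminus> cos \<phi>) / 2\<close> and
    \<open>(1 \<plusminus> cos \<psi>) / 2\<close>. \<open>X\<close> and \<open>Y\<close> list the
    two coordinates of the corners in the same order.\<close>
  define w where "w k = [(1 + ?a) * (1 + ?b) / 4, (1 + ?a) * (1 - ?b) / 4, (1 - ?a) * (1 + ?b) / 4, (1 - ?a) * (1 - ?b) / 4] ! k" for k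
  define X where "X k = [dz, dx, - dx, - dz] ! k" for k
  define Y where "Y k = [dx, dz, - dz, - dx] ! k" for k
  have ws: "w 0 = (1 + ?a) * (1 + ?b) / 4" "w 1 = (1 + ?a) * (1 - ?b) / 4"
    "w 2 = (1 - ?a) * (1 + ?b) / 4" "w 3 = (1 - ?a) * (1 - ?b) / 4" by (simp_all add: w_def)
  have Xs: "X 0 = dz" "X 1 = dx" "X 2 = - dx" "X 3 = - dz" by (simp_all add: X_def)
  have Ys: "Y 0 = dx" "Y 1 = dz" "Y 2 = - dz" "Y 3 = - dx" by (simp_all add: Y_def)
  have ab: "0 \<le> 1 + ?a" "0 \<le> 1 - ?a" "0 \<le> 1 + ?b" "0 \<le> 1 - ?b"
    using cos_ge_minus_one[of \<phi>] cos_le_one[of \<phi>] cos_ge_minus_one[of \<psi>] cos_le_one[of \<psi>] by linarith+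
  have w0: "w k \<ge> 0" if "k \<in> {..<4::nat}" for k
  proof -
    have "w 0 \<ge> 0" "w 1 \<ge> 0" "w 2 \<ge> 0" "w 3 \<ge> 0"
      unfolding ws using ab by (simp_all only: mult_nonneg_nonneg divide_nonneg_pos zero_less_numeral)
    then show ?thesis using less_4_cases[of k] that by auto
  qed
  have w1: "sum w {..<4} = 1" unfolding sum_lessThan_4 ws by (simp add: field_simps)
  have Xb: "\<bar>X k\<bar> \<le> 1" and Yb: "\<bar>Y k\<bar> \<le> 1" if "k \<in> {..<4::nat}" for k
    using less_4_cases[of k] that d by (auto simp: Xs[simplified] Ys[simplified])
  have xs: "(\<Sum>k<4. w k * X k) = x" unfolding sum_lessThan_4 ws Xs x_def by (simp add: field_simps)
  have ys: "(\<Sum>k<4. w k * Y k) = y" unfolding sum_lessThan_4 ws Ys y_def by (simp add: field_simps)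
  have XY: "neg_hbin (X k) + neg_hbin (Y k) = neg_hbin dz + neg_hbin dx" if "k \<in> {..<4::nat}" for k
    using less_4_cases[of k] that by (auto simp: Xs[simplified] Ys[simplified])
  have "(\<Sum>k<4. w k * neg_hbin (X k)) + (\<Sum>k<4. w k * neg_hbin (Y k)) = (\<Sum>k<4. w k * (neg_hbin dz + neg_hbin dx))"
    unfolding sum.distrib[symmetric] by (intro sum.cong refl) (simp add: XY[symmetric] distrib_left)
  then have S: "(\<Sum>k<4. w k * neg_hbin (X k)) + (\<Sum>k<4. w k * neg_hbin (Y k)) = neg_hbin dz + neg_hbin dx"
    unfolding sum_distrib_right[symmetric] w1 by simp
  have jx: "neg_hbin x \<le> (\<Sum>k<4. w k * neg_hbin (X k))"
    unfolding xs[symmetric] by (rule neg_hbin_jensen(1)[OF finite_lessThan _ w1]) (use w0 Xb in auto)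
  have jy: "neg_hbin y \<le> (\<Sum>k<4. w k * neg_hbin (Y k))"
    unfolding ys[symmetric] by (rule neg_hbin_jensen(1)[OF finite_lessThan _ w1]) (use w0 Yb in auto)
  show "neg_hbin x + neg_hbin y \<le> neg_hbin dz + neg_hbin dx"
    using jx jy S by linarith
  have bnd: "\<bar>\<Sum>k<4. w k * Z k\<bar> \<le> 1" if "\<And>k. k \<in> {..<4::nat} \<Longrightarrow> \<bar>Z k\<bar> \<le> 1" for Z
  proof -
    have "\<bar>\<Sum>k<4. w k * Z k\<bar> \<le> (\<Sum>k<4. \<bar>w k * Z k\<bar>)" by (rule sum_abs)
    also have "\<dots> \<le> (\<Sum>k<4. w k * 1)"
      unfolding abs_mult by (intro sum_mono mult_mono) (use w0 that in auto)
    finally show ?thesis using w1 by simp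
  qed
  show "\<bar>x\<bar> \<le> 1" unfolding xs[symmetric] by (rule bnd[OF Xb])
  show "\<bar>y\<bar> \<le> 1" unfolding ys[symmetric] by (rule bnd[OF Yb])
  have sum_xy: "x + y = (dz + dx) * ?a" "x - y = (dz - dx) * ?b" unfolding x_def y_def by (simp_all add: field_simps)
  show "neg_hbin x + neg_hbin y = neg_hbin dz + neg_hbin dx \<longleftrightarrow> (dz + dx) * sin \<phi> = 0 \<and> (dz - dx) * sin \<psi> = 0"
  proof
    assume eq: "neg_hbin x + neg_hbin y = neg_hbin dz + neg_hbin dx"
    have ex: "neg_hbin x = (\<Sum>k<4. w k * neg_hbin (X k))" and ey: "neg_hbin y = (\<Sum>k<4. w k * neg_hbin (Y k))"
      using jx jy S eq by linarith+
    \<comment> \<open>Some corner has positive weight; equality in Jensen's inequality identifies it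
      with the point itself.\<close>
    obtain k where k: "k \<in> {..<4::nat}" "w k > 0"
    proof -
      have "\<not> (\<forall>k\<in>{..<4::nat}. w k \<le> 0)"
      proof
        assume "\<forall>k\<in>{..<4::nat}. w k \<le> 0"
        then have "sum w {..<4} \<le> 0" by (intro sum_nonpos) auto
        then show False using w1 by simp
      qed
      then show ?thesis using that by fastforce
    qed
    have xk: "X k = x"
      unfolding xs[symmetric] by (rule neg_hbin_jensen(2)[OF finite_lessThan _ w1 _ _ k]) (use w0 Xb ex xs in auto)
    have yk: "Y k = y"
      unfolding ys[symmetric] by (rule neg_hbin_jensen(2)[OF finite_lessThan _ w1 _ _ k]) (use w0 Yb ey ys in auto)
    have "(X k + Y k)\<^sup>2 = (dz + dx)\<^sup>2" "(X k - Y k)\<^sup>2 = (dz - dx)\<^sup>2"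
      using less_4_cases[of k] k(1) by (auto simp: Xs[simplified] Ys[simplified] power2_eq_square algebra_simps)
    then have "((dz + dx) * ?a)\<^sup>2 = (dz + dx)\<^sup>2" "((dz - dx) * ?b)\<^sup>2 = (dz - dx)\<^sup>2"
      unfolding xk yk sum_xy by auto
    moreover have "((dz + dx) * sin \<phi>)\<^sup>2 = (dz + dx)\<^sup>2 - ((dz + dx) * ?a)\<^sup>2"
      "((dz - dx) * sin \<psi>)\<^sup>2 = (dz - dx)\<^sup>2 - ((dz - dx) * ?b)\<^sup>2"
      unfolding power_mult_distrib sin_squared_eq by (simp_all add: algebra_simps)
    ultimately have "((dz + dx) * sin \<phi>)\<^sup>2 = 0" "((dz - dx) * sin \<psi>)\<^sup>2 = 0" by linarith+
    then show "(dz + dx) * sin \<phi> = 0 \<and> (dz - dx) * sin \<psi> = 0" by (simp only: power_eq_0_iff)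
  next
    assume z: "(dz + dx) * sin \<phi> = 0 \<and> (dz - dx) * sin \<psi> = 0"
    have sgn: "e * cos \<theta> = e \<or> e * cos \<theta> = - e" if "e * sin \<theta> = 0" for e \<theta> :: real
    proof (cases "e = 0")
      case False
      then have "(cos \<theta>)\<^sup>2 = 1" using that by (simp add: cos_squared_eq)
      then have "cos \<theta> = 1 \<or> cos \<theta> = - 1" by (rule power2_eq_1_iff[THEN iffD1])
      then show ?thesis by auto
    qed simp
    have "x + y = dz + dx \<or> x + y = - (dz + dx)" "x - y = dz - dx \<or> x - y = - (dz - dx)"
      unfolding sum_xy by (rule sgn, use z in blast)+
    then have "x = dz \<and> y = dx \<or> x = dx \<and> y = dz \<or> x = - dx \<and> y = - dz \<or> x = - dz \<and> y = - dx"
      by auto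
    then show "neg_hbin x + neg_hbin y = neg_hbin dz + neg_hbin dx" by auto
  qed
qed

text \<open>At 0 the slope is infinite, so a square root bound is used, from
  \<open>ln (1 / r) \<le> 1 / r - 1\<close> with \<open>r = sqrt \<bar>y\<bar>\<close>. Negative
  arguments are covered since \<open>ln y = ln \<bar>y\<bar>\<close>. Continuity serves to show that
  the one-sided maximum is attained.\<close>

lemma isCont_ent_term: "isCont ent_term x"
proof (cases "x = 0")
  case False
  then have "isCont (\<lambda>x. x * (ln x / ln 2)) x" by (intro continuous_intros) auto
  then show ?thesis unfolding ent_term_eq[abs_def] log_def .
next
  case True
  have bound: "\<bar>ent_term y\<bar> \<le> 2 * sqrt \<bar>y\<bar> / ln 2" if y: "\<bar>y\<bar> < 1" for y
  proof (cases "y = 0")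
    case False
    let ?r = "sqrt \<bar>y\<bar>"
    have r: "?r > 0" "?r \<le> 1" "?r * ?r = \<bar>y\<bar>" using False y by auto
    have ly: "ln y = ln \<bar>y\<bar>" using ln_minus[of y] by (cases "y \<ge> 0") auto
    have "ln (1 / ?r) \<le> 1 / ?r - 1" using r by (intro ln_le_minus_one) auto
    moreover have "ln \<bar>y\<bar> = 2 * ln ?r" using r by (metis ln_mult mult_2 less_irrefl)
    moreover have "ln (1 / ?r) = - ln ?r" using r by (simp add: ln_div)
    ultimately have "- ln \<bar>y\<bar> \<le> 2 / ?r" by simp
    then have "\<bar>y\<bar> * (- ln \<bar>y\<bar>) \<le> \<bar>y\<bar> * (2 / ?r)" by (intro mult_left_mono) auto
    also have "\<bar>y\<bar> * (2 / ?r) = 2 * ?r" using r by (simp add: field_simps)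
    finally have "\<bar>y * ln y\<bar> \<le> 2 * ?r"
      unfolding abs_mult ly using y False by (simp add: abs_of_nonpos)
    then show ?thesis by (simp add: ent_term_eq log_def abs_divide divide_right_mono)
  qed simp
  have "(ent_term \<longlongrightarrow> 0) (at 0)"
  proof (rule tendsto_0_le)
    show "\<forall>\<^sub>F y in at 0. norm (ent_term y) \<le> norm (2 * sqrt \<bar>y\<bar> / ln 2) * 1"
      unfolding eventually_at by (intro exI[of _ 1]) (use bound in \<open>auto simp: dist_real_def\<close>)
    have "((\<lambda>y::real. 2 * sqrt \<bar>y\<bar> / ln 2) \<longlongrightarrow> 2 * sqrt \<bar>0\<bar> / ln 2) (at 0)"
      by (intro tendsto_intros) auto
    then show "((\<lambda>y::real. 2 * sqrt \<bar>y\<bar> / ln 2) \<longlongrightarrow> 0) (at 0)" by simp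
  qed
  then show ?thesis unfolding True isCont_def by simp
qed

lemma isCont_neg_hbin: "isCont neg_hbin x"
  unfolding neg_hbin_def[abs_def]
  by (intro continuous_add isCont_o2[OF _ isCont_ent_term] continuous_intros) auto

section \<open>Plane rotations and their action on the z-x block\<close>

definition rot :: "real \<Rightarrow> real mat" where
  "rot \<theta> = mat 2 2 (\<lambda>(i, j). [[cos \<theta>, - sin \<theta>], [sin \<theta>, cos \<theta>]] ! i ! j)"

lemma rot_carrier [simp]: "rot \<theta> \<in> carrier_mat 2 2"
  by (simp add: rot_def)

lemma rot_index:
  "rot \<theta> $$ (0, 0) = cos \<theta>" "rot \<theta> $$ (0, 1) = - sin \<theta>" "rot \<theta> $$ (1, 0) = sin \<theta>" "rot \<theta> $$ (1, 1) = cos \<theta>"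
  by (simp_all add: rot_def)

lemma det_2:
  fixes A :: "real mat"
  assumes A: "A \<in> carrier_mat 2 2"
  shows "det A = A $$ (0, 0) * A $$ (1, 1) - A $$ (0, 1) * A $$ (1, 0)"
proof -
  have "det A = (\<Sum>i<2. A $$ (i, 0) * cofactor A i 0)"
    using laplace_expansion_column[OF A, of 0] by simp
  then have 1: "det A = A $$ (0, 0) * det (mat_delete A 0 0) - A $$ (1, 0) * det (mat_delete A 1 0)"
    by (simp add: sum_lessThan_2 cofactor_def)
  have 2: "det (mat_delete A i 0) = mat_delete A i 0 $$ (0, 0)" for i
    using mat_delete_carrier[OF A, of i 0] by (intro det_single) simp
  have 3: "mat_delete A 0 0 $$ (0, 0) = A $$ (1, 1)" "mat_delete A 1 0 $$ (0, 0) = A $$ (0, 1)"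
    using A by (simp_all add: mat_delete_def)
  show ?thesis unfolding 1 2 3 by simp
qed

lemma rot_in_SO2 [simp]: "rot \<theta> \<in> SO2"
proof -
  have "transpose_mat (rot \<theta>) * rot \<theta> = 1\<^sub>m 2"
  proof (rule eq_matI)
    fix i j assume "i < dim_row (1\<^sub>m 2 :: real mat)" "j < dim_col (1\<^sub>m 2 :: real mat)"
    then have ij: "i < 2" "j < 2" by auto
    have T: "transpose_mat (rot \<theta>) \<in> carrier_mat 2 2" by simp
    have ij': "i = 0 \<or> i = 1" "j = 0 \<or> j = 1" using ij by auto
    have "(transpose_mat (rot \<theta>) * rot \<theta>) $$ (i, j) = rot \<theta> $$ (0, i) * rot \<theta> $$ (0, j) + rot \<theta> $$ (1, i) * rot \<theta> $$ (1, j)"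
      unfolding mult_mat_index_sum[OF T rot_carrier ij] sum_lessThan_2
      using ij carrier_matD[OF rot_carrier, of \<theta>] by simp
    then show "(transpose_mat (rot \<theta>) * rot \<theta>) $$ (i, j) = 1\<^sub>m 2 $$ (i, j)"
      using ij' by (elim disjE; hypsubst; simp only: rot_index) (simp_all add: power2_eq_square[symmetric])
  qed (use carrier_matD[OF rot_carrier, of \<theta>] in auto)
  moreover have "det (rot \<theta>) = 1"
    unfolding det_2[OF rot_carrier] rot_index by (simp add: power2_eq_square[symmetric])
  ultimately show ?thesis by (simp add: SO2_def)
qed

lemma SO2_rot:
  assumes "Q \<in> SO2"
  obtains \<theta> where "0 \<le> \<theta>" "\<theta> \<le> 2 * pi" "Q = rot \<theta>"
proof -
  from assms have Q: "Q \<in> carrier_mat 2 2" and o: "transpose_mat Q * Q = 1\<^sub>m 2" and det: "det Q = 1"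
    by (auto simp: SO2_def)
  have T: "transpose_mat Q \<in> carrier_mat 2 2" using Q by simp
  have e: "Q $$ (0, i) * Q $$ (0, j) + Q $$ (1, i) * Q $$ (1, j) = (if i = j then 1 else 0)" if "i < 2" "j < 2" for i j
  proof -
    have "(transpose_mat Q * Q) $$ (i, j) = Q $$ (0, i) * Q $$ (0, j) + Q $$ (1, i) * Q $$ (1, j)"
      unfolding mult_mat_index_sum[OF T Q that] sum_lessThan_2 using that Q by simp
    then show ?thesis using that unfolding o by simp
  qed
  let ?a = "Q $$ (0, 0)" and ?b = "Q $$ (0, 1)" and ?c = "Q $$ (1, 0)" and ?d = "Q $$ (1, 1)"
  have 1: "?a\<^sup>2 + ?c\<^sup>2 = 1" and 2: "?b\<^sup>2 + ?d\<^sup>2 = 1"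
    using e[of 0 0] e[of 1 1] by (simp_all add: power2_eq_square)
  have 3: "?a * ?d - ?b * ?c = 1" using det unfolding det_2[OF Q] .
  \<comment> \<open>This sum of squares vanishes exactly when \<open>Q\<close> has the shape of a
    rotation; unit columns and determinant 1 force it to be zero.\<close>
  have "(?a - ?d)\<^sup>2 + (?b + ?c)\<^sup>2 = (?a\<^sup>2 + ?c\<^sup>2) + (?b\<^sup>2 + ?d\<^sup>2) - 2 * (?a * ?d - ?b * ?c)"
    by (simp add: power2_eq_square algebra_simps)
  also have "\<dots> = 0" unfolding 1 2 3 by simp
  finally have "?d = ?a" "?b = - ?c" unfolding sum_power2_eq_zero_iff by auto
  moreover obtain \<theta> where \<theta>: "0 \<le> \<theta>" "\<theta> < 2 * pi" "?a = cos \<theta>" "?c = sin \<theta>" using sincos_total_2pi[OF 1] .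
  ultimately have "Q = rot \<theta>"
    using Q by (intro eq_matI) (auto simp: rot_def less_2_cases_iff)
  then show ?thesis using that \<theta> by simp
qed

lemma transpose_rot: "transpose_mat (rot \<theta>) = rot (- \<theta>)"
  by (rule eq_matI) (auto simp: rot_def less_2_cases_iff)

text \<open>The block \<open>rot \<beta> diag(dz, dx) rot \<alpha>\<close> is the sum of a multiple of the rotation by \<open>\<phi> = \<alpha> + \<beta>\<close> and a
  multiple of the reflection \<open>rot \<psi> diag(1, -1)\<close> with \<open>\<psi> = \<beta> - \<alpha>\<close>.\<close>
definition zx_block :: "real mat \<Rightarrow> real \<Rightarrow> real \<Rightarrow> real \<Rightarrow> real \<Rightarrow> bool" where
  "zx_block R dz dx \<phi> \<psi> \<longleftrightarrow>
     R $$ (0, 0) = (dz + dx) / 2 * cos \<phi> + (dz - dx) / 2 * cos \<psi>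
   \<and> R $$ (0, 1) = (dz - dx) / 2 * sin \<psi> - (dz + dx) / 2 * sin \<phi>
   \<and> R $$ (1, 0) = (dz - dx) / 2 * sin \<psi> + (dz + dx) / 2 * sin \<phi>
   \<and> R $$ (1, 1) = (dz + dx) / 2 * cos \<phi> - (dz - dx) / 2 * cos \<psi>"

lemma diag2_carrier [simp]: "diag2 a b \<in> carrier_mat 2 2"
  by (rule carrier_matI) (simp_all add: diag2_def mat_of_rows_list_def)

lemma diag2_index: "diag2 a b $$ (0, 0) = a" "diag2 a b $$ (0, 1) = 0" "diag2 a b $$ (1, 0) = 0" "diag2 a b $$ (1, 1) = b"
  by (simp_all add: diag2_def mat_of_rows_list_def)

lemma zx_block_svd:
  assumes "Sblock R = rot \<beta> * diag2 dz dx * rot \<alpha>"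
  shows "zx_block R dz dx (\<alpha> + \<beta>) (\<beta> - \<alpha>)"
proof -
  have R: "R $$ (i, j) = (rot \<beta> * diag2 dz dx * rot \<alpha>) $$ (i, j)" if "i < 2" "j < 2" for i j
    unfolding assms[symmetric] using that by (simp add: Sblock_def)
  have c: "rot \<beta> * diag2 dz dx \<in> carrier_mat 2 2"
    by (rule mult_carrier_mat[OF rot_carrier diag2_carrier])
  have l: "(0::nat) < 2" "(1::nat) < 2" by auto
  note e = R[OF l(1) l(1)] R[OF l(1) l(2)] R[OF l(2) l(1)] R[OF l(2) l(2)]
  show ?thesis
    unfolding zx_block_def e mult_mat_index_sum[OF c rot_carrier l(1) l(1)] mult_mat_index_sum[OF c rot_carrier l(1) l(2)]
      mult_mat_index_sum[OF c rot_carrier l(2) l(1)] mult_mat_index_sum[OF c rot_carrier l(2) l(2)] sum_lessThan_2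
      mult_mat_index_sum[OF rot_carrier diag2_carrier l(1) l(1)] mult_mat_index_sum[OF rot_carrier diag2_carrier l(1) l(2)]
      mult_mat_index_sum[OF rot_carrier diag2_carrier l(2) l(1)] mult_mat_index_sum[OF rot_carrier diag2_carrier l(2) l(2)]
      diag2_index rot_index cos_add sin_add cos_diff sin_diff
    by (simp add: field_simps)
qed

lemma blk_carrier [simp]: "blk Q \<in> carrier_mat 3 3"
  by (simp add: blk_def)

lemma blk_rot_index:
  "blk (rot \<theta>) $$ (0, 0) = cos \<theta>" "blk (rot \<theta>) $$ (0, 1) = - sin \<theta>" "blk (rot \<theta>) $$ (0, 2) = 0"
  "blk (rot \<theta>) $$ (1, 0) = sin \<theta>" "blk (rot \<theta>) $$ (1, 1) = cos \<theta>" "blk (rot \<theta>) $$ (1, 2) = 0"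
  "blk (rot \<theta>) $$ (2, 0) = 0" "blk (rot \<theta>) $$ (2, 1) = 0"
  by (simp_all add: blk_def rot_index[simplified])

lemma blk_rot_left:
  assumes R: "R \<in> carrier_mat 3 3" and j: "j < 3"
  shows "(blk (rot \<gamma>) * R) $$ (0, j) = cos \<gamma> * R $$ (0, j) - sin \<gamma> * R $$ (1, j)"
    "(blk (rot \<gamma>) * R) $$ (1, j) = sin \<gamma> * R $$ (0, j) + cos \<gamma> * R $$ (1, j)"
proof -
  have l: "(0::nat) < 3" "(1::nat) < 3" by auto
  show "(blk (rot \<gamma>) * R) $$ (0, j) = cos \<gamma> * R $$ (0, j) - sin \<gamma> * R $$ (1, j)"
    "(blk (rot \<gamma>) * R) $$ (1, j) = sin \<gamma> * R $$ (0, j) + cos \<gamma> * R $$ (1, j)"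
    unfolding mult_mat_index_sum[OF blk_carrier R l(1) j] mult_mat_index_sum[OF blk_carrier R l(2) j]
      sum_lessThan_3 blk_rot_index by simp_all
qed

lemma blk_rot_right:
  assumes R: "R \<in> carrier_mat 3 3" and i: "i < 3"
  shows "(R * blk (rot \<delta>)) $$ (i, 0) = R $$ (i, 0) * cos \<delta> + R $$ (i, 1) * sin \<delta>"
    "(R * blk (rot \<delta>)) $$ (i, 1) = R $$ (i, 1) * cos \<delta> - R $$ (i, 0) * sin \<delta>"
proof -
  have l: "(0::nat) < 3" "(1::nat) < 3" by auto
  show "(R * blk (rot \<delta>)) $$ (i, 0) = R $$ (i, 0) * cos \<delta> + R $$ (i, 1) * sin \<delta>"
    "(R * blk (rot \<delta>)) $$ (i, 1) = R $$ (i, 1) * cos \<delta> - R $$ (i, 0) * sin \<delta>"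
    unfolding mult_mat_index_sum[OF R blk_carrier i l(1)] mult_mat_index_sum[OF R blk_carrier i l(2)]
      sum_lessThan_3 blk_rot_index by simp_all
qed

text \<open>A left rotation shifts both phases alike. The invariance of
  \<open>\<phi> - \<psi>\<close> is the obstruction in the one-sided problem.\<close>

lemma zx_block_left:
  assumes R: "R \<in> carrier_mat 3 3" and z: "zx_block R dz dx \<phi> \<psi>"
  shows "zx_block (blk (rot \<gamma>) * R) dz dx (\<phi> + \<gamma>) (\<psi> + \<gamma>)"
proof -
  have l: "(0::nat) < 3" "(1::nat) < 3" by auto
  from z have e: "R $$ (0, 0) = (dz + dx) / 2 * cos \<phi> + (dz - dx) / 2 * cos \<psi>"
    "R $$ (0, 1) = (dz - dx) / 2 * sin \<psi> - (dz + dx) / 2 * sin \<phi>"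
    "R $$ (1, 0) = (dz - dx) / 2 * sin \<psi> + (dz + dx) / 2 * sin \<phi>"
    "R $$ (1, 1) = (dz + dx) / 2 * cos \<phi> - (dz - dx) / 2 * cos \<psi>" unfolding zx_block_def by blast+
  show ?thesis
    unfolding zx_block_def blk_rot_left[OF R l(1)] blk_rot_left[OF R l(2)] e cos_add sin_add
    by (simp add: field_simps)
qed

text \<open>A rotation passes through a reflection as its inverse, hence the opposite signs.
  Together with left rotations, both phases can be chosen freely.\<close>

lemma zx_block_right:
  assumes R: "R \<in> carrier_mat 3 3" and z: "zx_block R dz dx \<phi> \<psi>"
  shows "zx_block (R * blk (rot \<delta>)) dz dx (\<phi> + \<delta>) (\<psi> - \<delta>)"
proof -
  have l: "(0::nat) < 3" "(1::nat) < 3" by auto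
  from z have e: "R $$ (0, 0) = (dz + dx) / 2 * cos \<phi> + (dz - dx) / 2 * cos \<psi>"
    "R $$ (0, 1) = (dz - dx) / 2 * sin \<psi> - (dz + dx) / 2 * sin \<phi>"
    "R $$ (1, 0) = (dz - dx) / 2 * sin \<psi> + (dz + dx) / 2 * sin \<phi>"
    "R $$ (1, 1) = (dz + dx) / 2 * cos \<phi> - (dz - dx) / 2 * cos \<psi>" unfolding zx_block_def by blast+
  show ?thesis
    unfolding zx_block_def blk_rot_right[OF R l(1)] blk_rot_right[OF R l(2)] e cos_add sin_add cos_diff sin_diff
    by (simp add: field_simps)
qed

lemma half_angle:
  fixes \<phi> :: real
  shows "(cos (\<phi> / 2))\<^sup>2 + (sin (\<phi> / 2))\<^sup>2 = 1" "(cos (\<phi> / 2))\<^sup>2 - (sin (\<phi> / 2))\<^sup>2 = cos \<phi>"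
    "2 * cos (\<phi> / 2) * sin (\<phi> / 2) = sin \<phi>" "cos (\<phi> / 2) * sin (\<phi> / 2) = sin \<phi> / 2"
  using cos_double[of "\<phi> / 2"] sin_double[of "\<phi> / 2"] by simp_all

lemma zx_block_rot_pauli:
  "zx_block (rot_pauli (cos (\<phi> / 2)) (sin (\<phi> / 2)) (cos (\<psi> / 2)) (sin (\<psi> / 2)) dz dx) dz dx \<phi> \<psi>"
  unfolding zx_block_def rot_pauli_index half_angle by (simp add: field_simps)

text \<open>Projecting the rotation part and the reflection part onto their phases recovers
  \<open>dz + dx\<close> and \<open>dz - dx\<close>. At half angles these are the \<open>M\<close>
  and \<open>N\<close> of \<open>Kr_lower_bound\<close>.\<close>

lemma zx_block_correlations:
  assumes "zx_block R dz dx \<phi> \<psi>"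
  shows "dz = ((R $$ (0, 0) + R $$ (1, 1)) * cos \<phi> + (R $$ (1, 0) - R $$ (0, 1)) * sin \<phi>
      + ((R $$ (0, 0) - R $$ (1, 1)) * cos \<psi> + (R $$ (1, 0) + R $$ (0, 1)) * sin \<psi>)) / 2"
    "dx = ((R $$ (0, 0) + R $$ (1, 1)) * cos \<phi> + (R $$ (1, 0) - R $$ (0, 1)) * sin \<phi>
      - ((R $$ (0, 0) - R $$ (1, 1)) * cos \<psi> + (R $$ (1, 0) + R $$ (0, 1)) * sin \<psi>)) / 2"
proof -
  have 1: "(R $$ (0, 0) + R $$ (1, 1)) = (dz + dx) * cos \<phi>" "(R $$ (1, 0) - R $$ (0, 1)) = (dz + dx) * sin \<phi>"
    "(R $$ (0, 0) - R $$ (1, 1)) = (dz - dx) * cos \<psi>" "(R $$ (1, 0) + R $$ (0, 1)) = (dz - dx) * sin \<psi>"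
    using assms unfolding zx_block_def by (simp_all add: field_simps)
  have 2: "e * cos \<theta> * cos \<theta> + e * sin \<theta> * sin \<theta> = e" for e \<theta> :: real
  proof -
    have "e * cos \<theta> * cos \<theta> + e * sin \<theta> * sin \<theta> = e * ((sin \<theta>)\<^sup>2 + (cos \<theta>)\<^sup>2)"
      by (simp only: power2_eq_square distrib_left mult.assoc add.commute)
    then show ?thesis by simp
  qed
  show "dz = ((R $$ (0, 0) + R $$ (1, 1)) * cos \<phi> + (R $$ (1, 0) - R $$ (0, 1)) * sin \<phi>
      + ((R $$ (0, 0) - R $$ (1, 1)) * cos \<psi> + (R $$ (1, 0) + R $$ (0, 1)) * sin \<psi>)) / 2"
    "dx = ((R $$ (0, 0) + R $$ (1, 1)) * cos \<phi> + (R $$ (1, 0) - R $$ (0, 1)) * sin \<phi>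
      - ((R $$ (0, 0) - R $$ (1, 1)) * cos \<psi> + (R $$ (1, 0) + R $$ (0, 1)) * sin \<psi>)) / 2"
    unfolding 1 2 by simp_all
qed

lemma zx_block_le_one:
  assumes ch: "qubit_channel R t" and z: "zx_block R dz dx \<phi> \<psi>"
  shows "\<bar>dz\<bar> \<le> 1" "\<bar>dx\<bar> \<le> 1"
  using rotated_diag_le_one[OF ch half_angle(1)[of \<phi>] half_angle(1)[of \<psi>]]
  unfolding half_angle(2,3) zx_block_correlations[OF z, symmetric] .

section \<open>Inner minima over the compatible channels\<close>

lemma Kr_ge_Pbc:
  assumes "(R', t') \<in> Pbc R t"
  shows "1 + neg_hbin (R $$ (0, 0)) + neg_hbin (R $$ (1, 1)) \<le> Kr R' t'"
proof -
  from assms have ch: "qubit_channel R' t'" and e: "R' $$ (0, 0) = R $$ (0, 0)" "R' $$ (1, 1) = R $$ (1, 1)"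
    by (auto simp: Pbc_def)
  \<comment> \<open>At zero angles the reference is the unrotated Pauli channel with the observed
    diagonal; its first column is aligned automatically.\<close>
  have "1 + neg_hbin (R' $$ (0, 0)) + neg_hbin (R' $$ (1, 1)) \<le> Kr R' t'"
    by (rule Kr_lower_bound[OF ch, of 1 0 1 0]) (unfold rot_pauli_index, simp_all add: field_simps)
  then show ?thesis unfolding e .
qed

text \<open>The reference shares the whole block of \<open>R\<close>, so its alignment is the
  hypothesis on \<open>R $$ (1, 0)\<close>.\<close>

lemma Kr_ge_Pba:
  assumes c: "(R', t') \<in> Pba R t" and z: "zx_block R dz dx \<phi> \<psi>" and al: "R $$ (1, 0) = 0"
  shows "1 + neg_hbin dz + neg_hbin dx \<le> Kr R' t'"
proof -
  from c have ch: "qubit_channel R' t'" and e: "\<forall>i<2. \<forall>j<2. R' $$ (i, j) = R $$ (i, j)"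
    by (auto simp: Pba_def)
  have e': "R' $$ (0, 0) = R $$ (0, 0)" "R' $$ (0, 1) = R $$ (0, 1)" "R' $$ (1, 0) = R $$ (1, 0)" "R' $$ (1, 1) = R $$ (1, 1)"
    using e by auto
  have z': "zx_block R' dz dx \<phi> \<psi>" using z unfolding zx_block_def e' .
  note zp = zx_block_rot_pauli[of \<phi> \<psi> dz dx]
  have "rot_pauli (cos (\<phi> / 2)) (sin (\<phi> / 2)) (cos (\<psi> / 2)) (sin (\<psi> / 2)) dz dx $$ (1, 0) = 0"
    using al zp z unfolding zx_block_def by simp
  moreover have "rot_pauli (cos (\<phi> / 2)) (sin (\<phi> / 2)) (cos (\<psi> / 2)) (sin (\<psi> / 2)) dz dx $$ (0, 0) = R' $$ (0, 0)"
    using zp z' unfolding zx_block_def by simp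
  ultimately show ?thesis
    by (intro Kr_lower_bound[OF ch half_angle(1)[of \<phi>] half_angle(1)[of \<psi>]])
       (unfold half_angle(2,3), (rule zx_block_correlations[OF z'])+)
qed

lemma Pba_subset_Pbc: "Pba R t \<subseteq> Pbc R t"
  by (auto simp: Pba_def Pbc_def)

lemma Kr_bdd_below: "bdd_below ((\<lambda>c. Kr (fst c) (snd c)) ` Pbc R t)"
  by (rule bdd_belowI2[of _ "1 + neg_hbin (R $$ (0, 0)) + neg_hbin (R $$ (1, 1))"]) (metis Kr_ge_Pbc prod.collapse)

lemma INF_Pbc:
  assumes "\<bar>R $$ (0, 0)\<bar> \<le> 1" "\<bar>R $$ (1, 1)\<bar> \<le> 1"
  shows "(INF c\<in>Pbc R t. Kr (fst c) (snd c)) = 1 + neg_hbin (R $$ (0, 0)) + neg_hbin (R $$ (1, 1))"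
proof -
  let ?c = "(rot_pauli 1 0 1 0 (R $$ (0, 0)) (R $$ (1, 1)), 0\<^sub>v 3)"
  have ch: "qubit_channel (fst ?c) (snd ?c)" "Kr (fst ?c) (snd ?c) \<le> 1 + neg_hbin (R $$ (0, 0)) + neg_hbin (R $$ (1, 1))"
    using rot_pauli_channel[of 1 0 1 0, OF _ _ assms] by simp_all
  have "fst ?c $$ (0, 0) = R $$ (0, 0)" "fst ?c $$ (1, 1) = R $$ (1, 1)"
    unfolding fst_conv rot_pauli_index by (simp_all add: field_simps)
  then have c: "?c \<in> Pbc R t" using ch(1) unfolding Pbc_def by simp
  show ?thesis
  proof (rule antisym)
    show "(INF c\<in>Pbc R t. Kr (fst c) (snd c)) \<le> 1 + neg_hbin (R $$ (0, 0)) + neg_hbin (R $$ (1, 1))"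
      by (rule cINF_lower2[OF Kr_bdd_below c ch(2)])
    show "1 + neg_hbin (R $$ (0, 0)) + neg_hbin (R $$ (1, 1)) \<le> (INF c\<in>Pbc R t. Kr (fst c) (snd c))"
      using c by (intro cINF_greatest) (blast, metis Kr_ge_Pbc prod.collapse)
  qed
qed

text \<open>Without alignment the infimum is only trapped between the \<open>Pbc\<close> value and
  the value of the rotated Pauli channel. This suffices wherever the \<open>Pbc\<close> value is
  already optimal.\<close>

lemma INF_Pba:
  assumes z: "zx_block R dz dx \<phi> \<psi>" and d: "\<bar>dz\<bar> \<le> 1" "\<bar>dx\<bar> \<le> 1" and t: "t = 0\<^sub>v 3"
  shows "(INF c\<in>Pba R t. Kr (fst c) (snd c)) \<le> 1 + neg_hbin dz + neg_hbin dx"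
    and "(INF c\<in>Pbc R t. Kr (fst c) (snd c)) \<le> (INF c\<in>Pba R t. Kr (fst c) (snd c))"
    and "R $$ (1, 0) = 0 \<Longrightarrow> 1 + neg_hbin dz + neg_hbin dx \<le> (INF c\<in>Pba R t. Kr (fst c) (snd c))"
proof -
  let ?c = "(rot_pauli (cos (\<phi> / 2)) (sin (\<phi> / 2)) (cos (\<psi> / 2)) (sin (\<psi> / 2)) dz dx, 0\<^sub>v 3 :: real vec)"
  note ch = rot_pauli_channel[OF half_angle(1)[of \<phi>] half_angle(1)[of \<psi>] d]
  have "fst ?c $$ (i, j) = R $$ (i, j)" if "i < 2" "j < 2" for i j
    using zx_block_rot_pauli[of \<phi> \<psi> dz dx] z that unfolding zx_block_def fst_conv
    by (auto simp: less_2_cases_iff)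
  then have c: "?c \<in> Pba R t" using ch(1) unfolding Pba_def t by simp
  have bdd: "bdd_below ((\<lambda>c. Kr (fst c) (snd c)) ` Pba R t)"
    by (rule bdd_below_mono[OF Kr_bdd_below[of R t]]) (use Pba_subset_Pbc in blast)
  show "(INF c\<in>Pba R t. Kr (fst c) (snd c)) \<le> 1 + neg_hbin dz + neg_hbin dx"
    by (rule cINF_lower2[OF bdd c]) (simp add: ch(2))
  show "(INF c\<in>Pbc R t. Kr (fst c) (snd c)) \<le> (INF c\<in>Pba R t. Kr (fst c) (snd c))"
    using c by (intro cINF_superset_mono Kr_bdd_below Pba_subset_Pbc) auto
  show "1 + neg_hbin dz + neg_hbin dx \<le> (INF c\<in>Pba R t. Kr (fst c) (snd c))" if "R $$ (1, 0) = 0"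
    using c Kr_ge_Pba[OF _ z that] by (intro cINF_greatest) auto
qed

text \<open>The sine equations say when a rotation is optimal; the explicit form in the phases
  serves the continuity argument.\<close>

lemma INF_Pbc_zx_block:
  assumes z: "zx_block R dz dx \<phi> \<psi>" and d: "\<bar>dz\<bar> \<le> 1" "\<bar>dx\<bar> \<le> 1"
  shows "(INF c\<in>Pbc R t. Kr (fst c) (snd c)) \<le> 1 + neg_hbin dz + neg_hbin dx"
    and "(INF c\<in>Pbc R t. Kr (fst c) (snd c)) = 1 + neg_hbin dz + neg_hbin dx \<longleftrightarrow> (dz + dx) * sin \<phi> = 0 \<and> (dz - dx) * sin \<psi> = 0"
    and "(INF c\<in>Pbc R t. Kr (fst c) (snd c)) = 1 + neg_hbin ((dz + dx) / 2 * cos \<phi> + (dz - dx) / 2 * cos \<psi>)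
      + neg_hbin ((dz + dx) / 2 * cos \<phi> - (dz - dx) / 2 * cos \<psi>)"
proof -
  note n = neg_hbin_rotated[OF d, of \<phi> \<psi>]
  from z have e: "R $$ (0, 0) = (dz + dx) / 2 * cos \<phi> + (dz - dx) / 2 * cos \<psi>"
    "R $$ (1, 1) = (dz + dx) / 2 * cos \<phi> - (dz - dx) / 2 * cos \<psi>" by (auto simp: zx_block_def)
  show eq: "(INF c\<in>Pbc R t. Kr (fst c) (snd c)) = 1 + neg_hbin ((dz + dx) / 2 * cos \<phi> + (dz - dx) / 2 * cos \<psi>)
      + neg_hbin ((dz + dx) / 2 * cos \<phi> - (dz - dx) / 2 * cos \<psi>)"
    using INF_Pbc[of R t] n(3,4) unfolding e by blast
  show "(INF c\<in>Pbc R t. Kr (fst c) (snd c)) \<le> 1 + neg_hbin dz + neg_hbin dx"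
    unfolding eq using n(1) by linarith
  show "(INF c\<in>Pbc R t. Kr (fst c) (snd c)) = 1 + neg_hbin dz + neg_hbin dx \<longleftrightarrow> (dz + dx) * sin \<phi> = 0 \<and> (dz - dx) * sin \<psi> = 0"
    unfolding eq n(2)[symmetric] by linarith
qed

lemma blk_mult_zero: "blk Q *\<^sub>v 0\<^sub>v 3 = 0\<^sub>v 3"
  by (rule eq_vecI) (auto simp: blk_def)

lemma col_inner:
  "col (diag2 dz dx * rot \<alpha>) 0 \<bullet> col (diag2 dz dx * rot \<alpha>) 1 = - ((dz + dx) * (dz - dx) * (sin \<alpha> * cos \<alpha>))"
proof -
  let ?D = "diag2 dz dx * rot \<alpha>"
  have D: "?D \<in> carrier_mat 2 2" by (rule mult_carrier_mat[OF diag2_carrier rot_carrier])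
  have l: "(0::nat) < 2" "(1::nat) < 2" by auto
  have "col ?D 0 \<bullet> col ?D 1 = (\<Sum>i<2. ?D $$ (i, 0) * ?D $$ (i, 1))"
  proof -
    have "col M 0 \<bullet> col M 1 = (\<Sum>i<2. M $$ (i, 0) * M $$ (i, 1))" if "M \<in> carrier_mat 2 2" for M :: "real mat"
      using that by (simp add: scalar_prod_def atLeast0LessThan)
    then show ?thesis using D by blast
  qed
  also have "\<dots> = - ((dz + dx) * (dz - dx) * (sin \<alpha> * cos \<alpha>))"
    unfolding sum_lessThan_2 mult_mat_index_sum[OF diag2_carrier rot_carrier l(1) l(1)] mult_mat_index_sum[OF diag2_carrier rot_carrier l(1) l(2)]
      mult_mat_index_sum[OF diag2_carrier rot_carrier l(2) l(1)] mult_mat_index_sum[OF diag2_carrier rot_carrier l(2) l(2)]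
      diag2_index rot_index by (simp add: algebra_simps)
  finally show ?thesis .
qed

theorem theorem4:
  fixes R U V :: "real mat" and dz dx :: real
  assumes unital: "qubit_channel R (0\<^sub>v 3)"
    and U: "U \<in> SO2" and V: "V \<in> SO2"
    and svd: "Sblock R = V * diag2 dz dx * U"
  shows "G2 R (0\<^sub>v 3) = G2t R (0\<^sub>v 3)
    \<and> val2_bc R (0\<^sub>v 3) (transpose_mat U) (transpose_mat V) = G2t R (0\<^sub>v 3)
    \<and> (\<forall>QA\<in>SO2. \<forall>QB\<in>SO2. val2_bc R (0\<^sub>v 3) QA QB \<le> val2_bc R (0\<^sub>v 3) (transpose_mat U) (transpose_mat V))
    \<and> (G1 R (0\<^sub>v 3) = G1t R (0\<^sub>v 3) \<longleftrightarrow>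
         col (diag2 dz dx * U) 0 \<bullet> col (diag2 dz dx * U) 1 = 0)
    \<and> (col (diag2 dz dx * U) 0 \<bullet> col (diag2 dz dx * U) 1 = 0 \<longrightarrow>
         (\<forall>QB\<in>SO2.
            (\<exists>a. row QB 0 = a \<cdot>\<^sub>v vec_of_list [R $$ (0, 0), R $$ (1, 0)])
          \<and> (\<exists>b. row QB 1 = b \<cdot>\<^sub>v vec_of_list [R $$ (0, 1), R $$ (1, 1)])
          \<longrightarrow> val1_bc R (0\<^sub>v 3) QB = G1t R (0\<^sub>v 3)
            \<and> (\<forall>Q\<in>SO2. val1_bc R (0\<^sub>v 3) Q \<le> val1_bc R (0\<^sub>v 3) QB)))"
proof -
  let ?t = "0\<^sub>v 3 :: real vec"
  obtain \<alpha> where \<alpha>: "U = rot \<alpha>" using SO2_rot[OF U] by blast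
  obtain \<beta> where \<beta>: "V = rot \<beta>" using SO2_rot[OF V] by blast
  have R: "R \<in> carrier_mat 3 3" using unital by (simp add: qubit_channel_def)
  define \<phi> \<psi> where "\<phi> = \<alpha> + \<beta>" and "\<psi> = \<beta> - \<alpha>"
  have z: "zx_block R dz dx \<phi> \<psi>" using zx_block_svd svd unfolding \<alpha> \<beta> \<phi>_def \<psi>_def by blast
  note d = zx_block_le_one[OF unital z]
  define Kopt where "Kopt = 1 + neg_hbin dz + neg_hbin dx"
  have z2: "zx_block (blk (rot \<gamma>) * R * blk (rot \<delta>)) dz dx (\<phi> + \<gamma> + \<delta>) (\<psi> + \<gamma> - \<delta>)" for \<gamma> \<delta>
    by (rule zx_block_right[OF mult_carrier_mat[OF blk_carrier R] zx_block_left[OF R z]])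
  note z1 = zx_block_left[OF R z]

  have bc2: "val2_bc R ?t QA QB \<le> Kopt" if Q: "QA \<in> SO2" "QB \<in> SO2" for QA QB
  proof -
    obtain \<delta> where \<delta>: "QA = rot \<delta>" using SO2_rot[OF Q(1)] by blast
    obtain \<gamma> where \<gamma>: "QB = rot \<gamma>" using SO2_rot[OF Q(2)] by blast
    show ?thesis unfolding val2_bc_def \<delta> \<gamma> Kopt_def by (rule INF_Pbc_zx_block(1)[OF z2 d])
  qed
  \<comment> \<open>The inverse rotations bring both phases to zero.\<close>
  have bc2_opt: "val2_bc R ?t (transpose_mat U) (transpose_mat V) = Kopt"
    unfolding val2_bc_def \<alpha> \<beta> transpose_rot Kopt_def INF_Pbc_zx_block(2)[OF z2 d]
    by (simp add: \<phi>_def \<psi>_def)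
  have tU: "transpose_mat U \<in> SO2" and tV: "transpose_mat V \<in> SO2" unfolding \<alpha> \<beta> transpose_rot by simp_all
  have G2t: "G2t R ?t = Kopt"
    unfolding G2t_def
  proof (rule cSup_eq_maximum)
    show "Kopt \<in> (\<lambda>Q. val2_bc R ?t (fst Q) (snd Q)) ` (SO2 \<times> SO2)"
      using bc2_opt tU tV by (intro image_eqI[of _ _ "(transpose_mat U, transpose_mat V)"]) auto
  qed (use bc2 in auto)
  have ba2: "val2_ba R ?t QA QB \<le> Kopt" if Q: "QA \<in> SO2" "QB \<in> SO2" for QA QB
  proof -
    obtain \<delta> where \<delta>: "QA = rot \<delta>" using SO2_rot[OF Q(1)] by blast
    obtain \<gamma> where \<gamma>: "QB = rot \<gamma>" using SO2_rot[OF Q(2)] by blast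
    show ?thesis unfolding val2_ba_def blk_mult_zero \<delta> \<gamma> Kopt_def by (rule INF_Pba(1)[OF z2 d refl])
  qed
  \<comment> \<open>Both bounds coincide here: the \<open>Pbc\<close> infimum is \<open>Kopt\<close>
    and lies below the \<open>Pba\<close> infimum.\<close>
  have ba2_opt: "val2_ba R ?t (transpose_mat U) (transpose_mat V) = Kopt"
  proof (rule antisym[OF ba2[OF tU tV]])
    show "Kopt \<le> val2_ba R ?t (transpose_mat U) (transpose_mat V)"
      unfolding bc2_opt[symmetric] val2_ba_def val2_bc_def \<alpha> \<beta> transpose_rot blk_mult_zero
      by (rule INF_Pba(2)[OF z2 d refl])
  qed
  have G2: "G2 R ?t = Kopt"
    unfolding G2_def
  proof (rule cSup_eq_maximum)
    show "Kopt \<in> (\<lambda>Q. val2_ba R ?t (fst Q) (snd Q)) ` (SO2 \<times> SO2)"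
      using ba2_opt tU tV by (intro image_eqI[of _ _ "(transpose_mat U, transpose_mat V)"]) auto
  qed (use ba2 in auto)

  have G1: "G1 R ?t = Kopt"
    unfolding G1_def
  proof (rule cSup_eq_maximum)
    \<comment> \<open>The polar form of the first column supplies the left rotation that turns it
      onto the z axis. Such a rotation exists for every block, so the one-sided \<open>Pba\<close>
      problem always reaches \<open>Kopt\<close>.\<close>
    obtain r \<theta> where r: "R $$ (0, 0) = r * cos \<theta>" "R $$ (1, 0) = r * sin \<theta>" using polar_Ex by blast
    have "(blk (rot (- \<theta>)) * R) $$ (1, 0) = 0"
      using blk_rot_left(2)[OF R, of 0 "- \<theta>"] unfolding r by simp
    then have "val1_ba R ?t (rot (- \<theta>)) = Kopt"
      unfolding val1_ba_def blk_mult_zero Kopt_def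
      by (rule antisym[OF INF_Pba(1)[OF z1 d refl] INF_Pba(3)[OF z1 d refl]])
    then show "Kopt \<in> val1_ba R ?t ` SO2" by (metis rot_in_SO2 image_eqI)
  next
    fix x assume "x \<in> val1_ba R ?t ` SO2"
    then obtain Q where Q: "Q \<in> SO2" "x = val1_ba R ?t Q" by blast
    then obtain \<gamma> where "Q = rot \<gamma>" using SO2_rot by blast
    then show "x \<le> Kopt"
      unfolding Q(2) val1_ba_def blk_mult_zero Kopt_def by (simp only: INF_Pba(1)[OF z1 d refl])
  qed

  have bc1: "val1_bc R ?t Q \<le> Kopt" if Q: "Q \<in> SO2" for Q
  proof -
    obtain \<gamma> where \<gamma>: "Q = rot \<gamma>" using SO2_rot[OF Q] by blast
    show ?thesis unfolding val1_bc_def \<gamma> Kopt_def by (rule INF_Pbc_zx_block(1)[OF z1 d])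
  qed
  have bc1_eq: "val1_bc R ?t (rot \<gamma>) = Kopt \<longleftrightarrow> (dz + dx) * sin (\<phi> + \<gamma>) = 0 \<and> (dz - dx) * sin (\<psi> + \<gamma>) = 0" for \<gamma>
    unfolding val1_bc_def Kopt_def by (rule INF_Pbc_zx_block(2)[OF z1 d])
  have G1t_max: "G1t R ?t = Kopt" if "Q \<in> SO2" "val1_bc R ?t Q = Kopt" for Q
    unfolding G1t_def using that bc1 by (intro cSup_eq_maximum) (auto intro: image_eqI[of _ _ Q])
  \<comment> \<open>\<open>G1t\<close> is a mere supremum. Compactness of the circle provides a
    maximiser, so that \<open>G1 = G1t\<close> yields an actual rotation satisfying the sine
    equations.\<close>
  have attained: "\<exists>\<gamma>. G1t R ?t = val1_bc R ?t (rot \<gamma>)"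
  proof -
    let ?f = "\<lambda>\<gamma>. 1 + neg_hbin ((dz + dx) / 2 * cos (\<phi> + \<gamma>) + (dz - dx) / 2 * cos (\<psi> + \<gamma>))
      + neg_hbin ((dz + dx) / 2 * cos (\<phi> + \<gamma>) - (dz - dx) / 2 * cos (\<psi> + \<gamma>))"
    have f: "val1_bc R ?t (rot \<gamma>) = ?f \<gamma>" for \<gamma>
      unfolding val1_bc_def by (rule INF_Pbc_zx_block(3)[OF z1 d])
    have "continuous_on {0..2 * pi} ?f"
      by (intro continuous_at_imp_continuous_on ballI continuous_add continuous_const isCont_o2[OF _ isCont_neg_hbin] continuous_intros)
    then obtain \<gamma> where \<gamma>: "\<gamma> \<in> {0..2 * pi}" "\<forall>y\<in>{0..2 * pi}. ?f y \<le> ?f \<gamma>"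
      using continuous_attains_sup[of "{0..2 * pi}" ?f] by auto
    have "G1t R ?t = val1_bc R ?t (rot \<gamma>)"
      unfolding G1t_def
    proof (rule cSup_eq_maximum)
      fix x assume "x \<in> val1_bc R ?t ` SO2"
      then obtain Q where Q: "Q \<in> SO2" "x = val1_bc R ?t Q" by blast
      obtain \<theta> where "0 \<le> \<theta>" "\<theta> \<le> 2 * pi" "Q = rot \<theta>" using SO2_rot[OF Q(1)] .
      then show "x \<le> val1_bc R ?t (rot \<gamma>)" using \<gamma>(2) unfolding Q(2) f by (simp add: f)
    qed simp
    then show ?thesis ..
  qed
  \<comment> \<open>Here \<open>\<phi> - \<psi> = 2 * \<alpha>\<close>, so the inner product of the
    columns is governed by the invariant phase difference.\<close>
  have orth: "col (diag2 dz dx * U) 0 \<bullet> col (diag2 dz dx * U) 1 = 0 \<longleftrightarrow> (dz + dx) * (dz - dx) * sin (\<phi> - \<psi>) = 0"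
    unfolding \<alpha> col_inner \<phi>_def \<psi>_def using sin_double[of \<alpha>] by simp
  have "G1 R ?t = G1t R ?t \<longleftrightarrow> col (diag2 dz dx * U) 0 \<bullet> col (diag2 dz dx * U) 1 = 0"
    unfolding orth
  proof
    assume "G1 R ?t = G1t R ?t"
    then obtain \<gamma> where "val1_bc R ?t (rot \<gamma>) = Kopt" using attained unfolding G1 by metis
    then have s: "(dz + dx) * sin (\<phi> + \<gamma>) = 0" "(dz - dx) * sin (\<psi> + \<gamma>) = 0" unfolding bc1_eq by auto
    \<comment> \<open>A combination of the two sine equations eliminates \<open>\<gamma>\<close> and
      leaves the phase difference.\<close>
    have sd: "sin (\<phi> - \<psi>) = sin (\<phi> + \<gamma>) * cos (\<psi> + \<gamma>) - cos (\<phi> + \<gamma>) * sin (\<psi> + \<gamma>)"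
      using sin_diff[of "\<phi> + \<gamma>" "\<psi> + \<gamma>"] by simp
    have "(dz + dx) * (dz - dx) * sin (\<phi> - \<psi>) = (dz - dx) * cos (\<psi> + \<gamma>) * ((dz + dx) * sin (\<phi> + \<gamma>))
        - (dz + dx) * cos (\<phi> + \<gamma>) * ((dz - dx) * sin (\<psi> + \<gamma>))"
      unfolding sd by (simp add: algebra_simps)
    then show "(dz + dx) * (dz - dx) * sin (\<phi> - \<psi>) = 0" unfolding s by simp
  next
    assume "(dz + dx) * (dz - dx) * sin (\<phi> - \<psi>) = 0"
    then consider "dz + dx = 0" | "(dz - dx) * sin (\<psi> - \<phi>) = 0"
      using sin_minus[of "\<phi> - \<psi>"] by auto
    \<comment> \<open>If \<open>dz + dx = 0\<close>, only the second equation matters and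
      \<open>- \<psi>\<close> solves it. In the other case \<open>- \<phi>\<close> solves the first,
      and the second becomes the assumption.\<close>
    then have "\<exists>\<gamma>. (dz + dx) * sin (\<phi> + \<gamma>) = 0 \<and> (dz - dx) * sin (\<psi> + \<gamma>) = 0"
    proof cases
      case 1
      then show ?thesis by (intro exI[of _ "- \<psi>"]) simp
    next
      case 2
      then show ?thesis by (intro exI[of _ "- \<phi>"]) simp
    qed
    then obtain \<gamma> where "val1_bc R ?t (rot \<gamma>) = Kopt" unfolding bc1_eq by blast
    then show "G1 R ?t = G1t R ?t" using G1t_max[OF rot_in_SO2] unfolding G1 by simp
  qed
  moreover have "val1_bc R ?t QB = Kopt"
    if Q: "QB \<in> SO2" and a: "row QB 0 = a \<cdot>\<^sub>v vec_of_list [R $$ (0, 0), R $$ (1, 0)]"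
      and b: "row QB 1 = b \<cdot>\<^sub>v vec_of_list [R $$ (0, 1), R $$ (1, 1)]" for QB a b
  proof -
    obtain \<gamma> where \<gamma>: "QB = rot \<gamma>" using SO2_rot[OF Q] by blast
    have ra: "cos \<gamma> = a * R $$ (0, 0)" "- sin \<gamma> = a * R $$ (1, 0)"
      using arg_cong[OF a, of "\<lambda>v. v $ 0"] arg_cong[OF a, of "\<lambda>v. v $ 1"] unfolding \<gamma> by (simp_all add: rot_def)
    have rb: "sin \<gamma> = b * R $$ (0, 1)" "cos \<gamma> = b * R $$ (1, 1)"
      using arg_cong[OF b, of "\<lambda>v. v $ 0"] arg_cong[OF b, of "\<lambda>v. v $ 1"] unfolding \<gamma> by (simp_all add: rot_def)
    \<comment> \<open>The rows of a rotation are unit vectors, so neither multiple can be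
      zero.\<close>
    have nz: "a \<noteq> 0" "b \<noteq> 0"
      using ra rb sin_cos_squared_add[of \<gamma>] by auto
    let ?S = "blk (rot \<gamma>) * R"
    have l: "(0::nat) < 3" "(1::nat) < 3" by auto
    \<comment> \<open>Each row of \<open>QB\<close> is parallel to one column of the block, so the
      other row is orthogonal to that column; the rotated block is diagonal.\<close>
    have "a * ?S $$ (1, 0) = sin \<gamma> * (a * R $$ (0, 0)) + cos \<gamma> * (a * R $$ (1, 0))"
      unfolding blk_rot_left[OF R l(1)] by (simp add: algebra_simps)
    then have s1: "?S $$ (1, 0) = 0" using nz unfolding ra[symmetric] by simp
    have "b * ?S $$ (0, 1) = cos \<gamma> * (b * R $$ (0, 1)) - sin \<gamma> * (b * R $$ (1, 1))"
      unfolding blk_rot_left[OF R l(2)] by (simp add: algebra_simps)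
    then have s2: "?S $$ (0, 1) = 0" using nz unfolding rb[symmetric] by simp
    \<comment> \<open>Sum and difference of the vanishing off-diagonal entries are the two sine
      terms.\<close>
    show ?thesis
      unfolding \<gamma> bc1_eq using z1[of \<gamma>] s1 s2 unfolding zx_block_def by auto
  qed
  ultimately show ?thesis
    unfolding G2 G2t bc2_opt using bc2 bc1 G1t_max by auto
qed

end
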